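(* Let $c\in\mathbb{C}$ and let $P$ be a polynomial with constant complex coefficients. Every meromorphic solution $w$ of $$ww''-(w')^2+P(w)=0$$ and every meromorphic solution $w$ of $$w''+c(w')^2+P(w)=0$$ is of finite order. Hence the classical conjecture holds for both equations, i.e. for every such $w$ there exist $a,b,\gamma\in\mathbb{R}^{+}$ such that $T(r,w)<a\exp(br^{\gamma})$ for all $0\le r<\infty$.
   Context: "Meromorphic" means meromorphic on the whole complex plane $\mathbb{C}$. $T(r,w)$ is the Nevanlinna characteristic of $w$. A meromorphic function $w$ has finite order if there exist $a,\gamma\in\mathbb{R}^{+}$ such that $T(r,w)<ar^{\gamma}$ for $0\le r<\infty$ (as usual, this is a growth condition as $r\to\infty$). Hayman's classical conjecture for an algebraic ODE $Q(z,w,w',\dots,w^{(n)})=0$ ($Q$ a polynomial in all its arguments) asserts that each meromorphic solution $w$ satisfies $T(r,w)<a\exp_{n-1}(br^{\gamma})$, $0\le r<\infty$, for some $a,b,\gamma\in\mathbb{R}^{+}$, where $\exp_0(x)=x$ and $\exp_l(x)=\exp(\exp_{l-1}(x))$; here $n=2$. *)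

theory Defs
  imports "HOL-Complex_Analysis.Complex_Analysis"
begin

definition log_plus :: "real \<Rightarrow> real" where
  "log_plus x = max 0 (ln x)"

text \<open>
  The poles of \<open>w\<close> on the circle form a finite set of angles, so the value of the integrand
  there (where \<open>w\<close> is \<open>0\<close> by the convention of \<^const>\<open>nicely_meromorphic_on\<close>) is irrelevant.
\<close>

definition proximity :: "real \<Rightarrow> (complex \<Rightarrow> complex) \<Rightarrow> real" where
  "proximity r w =
     1 / (2 * pi) * integral {0..2 * pi} (\<lambda>\<theta>. log_plus (norm (w (of_real r * cis \<theta>))))"

text \<open>At a pole, \<^const>\<open>zorder\<close> is the negative of the multiplicity.\<close>

definition pole_count :: "real \<Rightarrow> (complex \<Rightarrow> complex) \<Rightarrow> nat" where
  "pole_count r w = (\<Sum>z\<in>{z. norm z \<le> r \<and> is_pole w z}. nat (- zorder w z))"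

definition pole_count_integrated :: "real \<Rightarrow> (complex \<Rightarrow> complex) \<Rightarrow> real" where
  "pole_count_integrated r w =
     integral {0..r} (\<lambda>t. (real (pole_count t w) - real (pole_count 0 w)) / t)
     + real (pole_count 0 w) * ln r"

text \<open>
  For \<open>r > 0\<close> this is the usual characteristic \<open>T(r, w) = m(r, w) + N(r, w)\<close>. At \<open>r = 0\<close> it
  evaluates to \<open>log\<^sup>+ \<bar>w(0)\<bar>\<close>, since \<open>ln 0 = 0\<close> (and to \<open>0\<close> if \<open>0\<close> is a pole of \<open>w\<close>).
\<close>

definition nevanlinna_T :: "real \<Rightarrow> (complex \<Rightarrow> complex) \<Rightarrow> real" where
  "nevanlinna_T r w = proximity r w + pole_count_integrated r w"

text \<open>
  The bound is required for large \<open>r\<close> only: at \<open>r = 0\<close> it would read \<open>T(0, w) < 0\<close>.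
\<close>

definition finite_order :: "(complex \<Rightarrow> complex) \<Rightarrow> bool" where
  "finite_order w \<longleftrightarrow>
     (\<exists>a>0. \<exists>\<gamma>>0. eventually (\<lambda>r. nevanlinna_T r w < a * r powr \<gamma>) at_top)"

text \<open>
  A meromorphic solution, on the whole plane, of the autonomous second-order equation
  \<open>Q(w, w', w'') = 0\<close>. A meromorphic function is represented by its normalised representative,
  which is continuous (hence analytic) away from its poles; the equation is imposed at all
  points that are not poles.
\<close>

definition meromorphic_solution ::
    "(complex \<Rightarrow> complex \<Rightarrow> complex \<Rightarrow> complex) \<Rightarrow> (complex \<Rightarrow> complex) \<Rightarrow> bool" where
  "meromorphic_solution Q w \<longleftrightarrow>
     w nicely_meromorphic_on UNIV \<and>
     (\<forall>z. \<not> is_pole w z \<longrightarrow> Q (w z) (deriv w z) (deriv (deriv w) z) = 0)"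

end

theory Submission
  imports Defs
begin

text \<open>
  Both equations are autonomous and of second order, so each has a first integral. For
  \<open>w'' + c w'\<^sup>2 + P(w) = 0\<close> the function \<open>(w'\<^sup>2 - R(w)) exp(2 c w)\<close> is constant, where \<open>R\<close> is a
  polynomial with \<open>R' + 2 c R = -2 P\<close>. For \<open>w w'' - w'\<^sup>2 + P(w) = 0\<close>, with
  \<open>P(y) = p0 + p1 y + p2 y\<^sup>2 + y\<^sup>3 Q(y)\<close> and \<open>Q1' = Q\<close>, the function
  \<open>(w'/w)\<^sup>2 - p0/w\<^sup>2 - 2 p1/w + 2 Q1(w) + 2 p2 log w\<close> is constant. Two situations arise.

  If the exponential or the logarithm drops out, then \<open>w'\<^sup>2 = R(w)\<close> with a polynomial \<open>R\<close> of
  some degree \<open>d\<close>. At a pole of order \<open>m\<close> both sides have the same order, so \<open>m (d - 2) = 2\<close> and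
  the poles are simple with \<open>d = 4\<close> or double with \<open>d = 3\<close>; these are the elliptic functions and
  their degenerations. The reciprocal \<open>v = 1/w\<close> solves \<open>v'\<^sup>2 = T(v)\<close> with a polynomial \<open>T\<close>.
  Since this equation has no explicit \<open>z\<close>, it controls \<open>v\<close> on discs of a fixed radius: where
  \<open>v\<close> is small it has a zero nearby, and its zeros are uniformly separated. Hence the poles of \<open>w\<close> are
  uniformly separated, \<open>w\<close> is bounded away from them, and it is of size \<open>dist\<^sup>-\<^sup>m\<close> near them.
  An entire \<open>w\<close> is bounded if \<open>d \<ge> 3\<close> and of exponential growth if \<open>d \<le> 2\<close>
  (\<open>nevanlinna_T_polynomial_ode_bound\<close>).

  Otherwise \<open>exp(2 c w)\<close> is a rational expression in meromorphic functions, or \<open>w\<close> is the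
  exponential of one. Because the exponential of a function with a pole has an essential
  singularity, \<open>w\<close> has no poles in the first situation, and neither poles nor zeros in the second. So
  there is an entire function \<open>g\<close>, namely \<open>-2 c w\<close>, \<open>log w\<close> or \<open>-log w\<close>, for which the first integral says
  that \<open>exp(Re g)\<close> is bounded by a multiple of a power of \<open>1 + |g| + |g'|\<close>. The exponential of an entire
  function is much larger than that unless the function grows slowly: by the inequality of Borel
  and Caratheodory \<open>g\<close> is \<open>O(|z|\<^sup>2)\<close> (\<open>entire_quadratic_of_exp_bound\<close>). The logarithm can also occur without any
  exponential; then \<open>g'\<^sup>2\<close> is linear in \<open>g\<close>, and \<open>g\<close> is again \<open>O(|z|\<^sup>2)\<close>.

  In every case a pointwise bound on \<open>w\<close> away from its poles is known together with the
  separation of the poles. These give \<open>T(r, w) < C (1 + r)\<^sup>n\<close> for all \<open>r \<ge> 0\<close> by direct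
  estimates of the two terms of the characteristic (\<open>nevanlinna_T_polynomial_bound\<close>), and both
  conclusions follow.
\<close>

section \<open>Growth of entire functions\<close>

text \<open>
  A form of Borel's growth lemma. If \<open>M\<close> doubled over every step of length \<open>M\<^sup>-\<^sup>1\<^sup>/\<^sup>4\<close>, then
  the step lengths would decrease geometrically, and \<open>M\<close> would be infinite at a finite radius.
\<close>

lemma slow_growth_radius:
  fixes M :: "real \<Rightarrow> real"
  assumes mono: "\<And>r s. r0 \<le> r \<Longrightarrow> r \<le> s \<Longrightarrow> M r \<le> M s" and ge1: "M r0 \<ge> 1"
  obtains r where "r \<ge> r0" "M (r + M r powr (-1/4)) < 2 * M r"
proof (rule ccontr)
  note found = that
  assume "\<not> thesis"
  then have dbl: "2 * M r \<le> M (r + M r powr (-1/4))" if "r \<ge> r0" for r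
    using that found by (meson not_le)
  define \<rho> where "\<rho> = (2::real) powr (-1/4)"
  have \<rho>: "0 < \<rho>" "\<rho> < 1"
    unfolding \<rho>_def by (auto simp: powr_less_one)
  define q where "q = 1 / (1 - \<rho>)"
  have q: "q > 0" "q * (1 - \<rho>) = 1" using \<rho> by (auto simp: q_def)
  define s where "s = rec_nat r0 (\<lambda>_ t. t + M t powr (-1/4))"
  have s_Suc: "s (Suc n) = s n + M (s n) powr (-1/4)" for n by (simp add: s_def)
  \<comment> \<open>The radii stay below \<open>r0 + q\<close>, the sum of the geometric series, while \<open>M\<close> doubles.\<close>
  have inv: "s n \<ge> r0 \<and> M (s n) \<ge> 2 ^ n \<and> s n \<le> r0 + q * (1 - \<rho> ^ n)" for n
  proof (induction n)
    case 0
    then show ?case using ge1 by (simp add: s_def)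
  next
    case (Suc n)
    have "M (s n) powr (-1/4) \<le> (2 ^ n) powr (-1/4)"
      using Suc by (intro powr_mono2') auto
    also have "\<dots> = \<rho> ^ n"
      unfolding \<rho>_def by (simp add: powr_powr powr_realpow[symmetric] mult.commute)
    finally have step: "M (s n) powr (-1/4) \<le> \<rho> ^ n" .
    have "q * (1 - \<rho> ^ n) + \<rho> ^ n = q * (1 - \<rho> ^ n) + (q * (1 - \<rho>)) * \<rho> ^ n"
      using q by simp
    also have "\<dots> = q * (1 - \<rho> ^ Suc n)" by (simp add: algebra_simps)
    finally have "s (Suc n) \<le> r0 + q * (1 - \<rho> ^ Suc n)" using step Suc unfolding s_Suc by linarith
    moreover have "2 ^ Suc n \<le> M (s (Suc n))"
      using dbl[of "s n"] Suc unfolding s_Suc by simp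
    moreover have "r0 \<le> s (Suc n)" using Suc unfolding s_Suc by (simp add: add_increasing2)
    ultimately show ?case by blast
  qed
  have "2 ^ n \<le> M (r0 + q)" for n :: nat
  proof -
    have "q * (1 - \<rho> ^ n) \<le> q" using q \<rho> by simp
    then have "s n \<le> r0 + q" using inv[of n] by linarith
    then show ?thesis using mono[of "s n" "r0 + q"] inv[of n] by linarith
  qed
  moreover obtain n where "M (r0 + q) < 2 ^ n" using real_arch_pow[of 2] by auto
  ultimately show False by (meson not_le)
qed

definition maxmod :: "(complex \<Rightarrow> complex) \<Rightarrow> real \<Rightarrow> real" where
  "maxmod g r = Sup ((\<lambda>z. norm (g z)) ` cball 0 r)"

lemma norm_le_maxmod:
  assumes "g holomorphic_on UNIV" "norm z \<le> r"
  shows "norm (g z) \<le> maxmod g r"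
  unfolding maxmod_def
proof (rule cSup_upper)
  have "compact ((\<lambda>z. norm (g z)) ` cball 0 r)"
    using assms(1) by (intro compact_continuous_image continuous_intros holomorphic_on_imp_continuous_on)
      (auto intro: holomorphic_on_subset)
  then show "bdd_above ((\<lambda>z. norm (g z)) ` cball 0 r)"
    by (simp add: bounded_imp_bdd_above compact_imp_bounded)
qed (use assms in auto)

lemma maxmod_le:
  assumes "\<And>z. norm z \<le> r \<Longrightarrow> norm (g z) \<le> B" "r \<ge> 0"
  shows "maxmod g r \<le> B"
  unfolding maxmod_def using assms by (intro cSup_least) auto

lemma maxmod_mono:
  assumes "g holomorphic_on UNIV" "0 \<le> r" "r \<le> s"
  shows "maxmod g r \<le> maxmod g s"
  using assms by (intro maxmod_le norm_le_maxmod) auto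

lemma norm_deriv_le_maxmod:
  assumes g: "g holomorphic_on UNIV" and d: "d > 0" and z: "norm z + d \<le> s"
  shows "norm (deriv g z) \<le> maxmod g s / d"
proof -
  have "norm ((deriv ^^ 1) g z) \<le> fact 1 * maxmod g s / d ^ 1"
  proof (rule Cauchy_inequality)
    show "norm (g x) \<le> maxmod g s" if "norm (z - x) = d" for x
    proof (rule norm_le_maxmod[OF g])
      have "norm x \<le> norm z + norm (z - x)"
        using norm_triangle_sub[of x z] by (simp add: norm_minus_commute)
      then show "norm x \<le> s" using that z by simp
    qed
  qed (use g d in \<open>auto intro: holomorphic_on_subset holomorphic_on_imp_continuous_on\<close>)
  then show ?thesis by simp
qed

text \<open>
  A solution of \<open>w' = w\<^sup>3\<^sup>/\<^sup>2\<close> blows up in finite time, so an entire function cannot have such a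
  large derivative. At a radius of slow growth Cauchy's estimate bounds the derivative by
  \<open>2 m\<^sup>5\<^sup>/\<^sup>4\<close>, where \<open>m\<close> is the maximum modulus, and \<open>5/4 < 3/2\<close> makes \<open>m\<close> bounded.
\<close>

lemma entire_bounded_of_superlinear_derivative:
  assumes g: "g holomorphic_on UNIV" and K: "K > 0"
    and der: "\<And>z. norm (g z) powr (3/2) \<le> K * (1 + norm (deriv g z))"
  shows "\<exists>B. \<forall>z. norm (g z) \<le> B"
proof (rule ccontr)
  assume "\<not> ?thesis"
  then have unb: "\<exists>z. norm (g z) > B" for B by (meson not_le)
  define B where "B = 1 + (3 * K) powr 4"
  have B: "B \<ge> 1" by (simp add: B_def)
  obtain z0 where z0: "norm (g z0) > B" using unb by blast
  define r0 where "r0 = norm z0"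
  have M0: "maxmod g r0 > B"
    using norm_le_maxmod[OF g, of z0 r0] z0 by (simp add: r0_def)
  obtain r where r: "r \<ge> r0" "maxmod g (r + maxmod g r powr (-1/4)) < 2 * maxmod g r"
  proof (rule slow_growth_radius[of r0 "maxmod g"])
    show "maxmod g a \<le> maxmod g b" if "r0 \<le> a" "a \<le> b" for a b
      using maxmod_mono[OF g, of a b] that by (auto simp: r0_def intro: order_trans[OF norm_ge_zero])
    show "1 \<le> maxmod g r0" using M0 B by simp
  qed blast
  define m where "m = maxmod g r"
  have r_nonneg: "r \<ge> 0" using r(1) order_trans[OF norm_ge_zero] by (auto simp: r0_def)
  have m: "m > B" using maxmod_mono[OF g, of r0 r] r(1) M0 by (auto simp: m_def r0_def)
  define d where "d = m powr (-1/4)"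
  have d: "d > 0" using m B by (simp add: d_def)
  \<comment> \<open>Cauchy's estimate on a disc of radius \<open>d = m powr (-1/4)\<close>.\<close>
  have pt: "norm (g z) powr (3/2) \<le> K * (1 + 2 * m powr (5/4))" if "norm z \<le> r" for z
  proof -
    have "norm (deriv g z) \<le> maxmod g (r + d) / d"
      using that by (intro norm_deriv_le_maxmod[OF g d]) auto
    also have "\<dots> \<le> 2 * m / d"
      using r(2) d by (intro divide_right_mono) (auto simp: d_def m_def)
    also have "\<dots> = 2 * m powr (5/4)"
    proof -
      have "m / d = m powr 1 / m powr (-1/4)" using m B by (simp add: d_def)
      also have "\<dots> = m powr (1 - (-1/4))" by (rule powr_diff[symmetric])
      also have "1 - (-1/4) = (5/4 :: real)" by simp
      finally show ?thesis by (metis times_divide_eq_right)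
    qed
    finally show ?thesis using der[of z] K by (smt (verit) mult_left_mono)
  qed
  define E where "E = K * (1 + 2 * m powr (5/4))"
  have E0: "E > 0" unfolding E_def using K by (simp add: add_pos_nonneg)
  have "m \<le> E powr (2/3)"
    unfolding m_def
  proof (rule maxmod_le[OF _ r_nonneg])
    fix z :: complex assume "norm z \<le> r"
    have "norm (g z) = (norm (g z) powr (3/2)) powr (2/3)" by (simp add: powr_powr)
    also have "\<dots> \<le> E powr (2/3)"
      using pt[OF \<open>norm z \<le> r\<close>] by (intro powr_mono2) (auto simp: E_def)
    finally show "norm (g z) \<le> E powr (2/3)" .
  qed
  then have "m powr (3/2) \<le> (E powr (2/3)) powr (3/2)"
    using m B by (intro powr_mono2) auto
  also have "\<dots> = E" using E0 by (simp add: powr_powr)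
  also have "E \<le> 3 * K * m powr (5/4)"
  proof -
    have "1 \<le> m powr (5/4)" using m B by (intro ge_one_powr_ge_zero) auto
    then have "K * (1 + 2 * m powr (5/4)) \<le> K * (3 * m powr (5/4))" using K by (intro mult_left_mono) auto
    then show ?thesis by (simp add: E_def)
  qed
  also have "m powr (3/2) = m powr (1/4) * m powr (5/4)" by (simp add: powr_add[symmetric])
  finally have "m powr (1/4) \<le> 3 * K"
    using m B by (simp add: mult_le_cancel_right)
  then have "(m powr (1/4)) powr 4 \<le> (3 * K) powr 4" by (intro powr_mono2) auto
  then have "m \<le> (3 * K) powr 4" using m B by (simp add: powr_powr)
  then show False using m by (simp add: B_def)
qed

text \<open>
  If \<open>Re h < B\<close> and \<open>h(0) = 0\<close>, then \<open>h / (2 B - h)\<close> maps the disc into the unit disc and fixes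
  \<open>0\<close>, so that the Schwarz lemma bounds it. This is applied to \<open>h = g - g(0)\<close>. The summand \<open>1\<close> makes
  the bound on the real part strict.
\<close>

lemma Borel_Caratheodory:
  assumes g: "g holomorphic_on ball 0 R" and A: "A \<ge> 0" "\<And>z. norm z < R \<Longrightarrow> Re (g z) \<le> A"
    and r: "r < R" "norm z \<le> r"
  shows "norm (g z) \<le> norm (g 0) + 2 * (A + norm (g 0) + 1) * r / (R - r)"
proof -
  define B where "B = A + norm (g 0) + 1"
  have B: "B > 0" using A by (simp add: B_def add_nonneg_pos)
  have R: "R > 0" "r \<ge> 0" using r norm_ge_zero[of z] by linarith+
  define h where "h = (\<lambda>z. g z - g 0)"
  have Reh: "Re (h u) < B" if "norm u < R" for u
    using A(2)[OF that] abs_Re_le_cmod[of "g 0"] by (simp add: h_def B_def)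
  have key: "norm (h u) < norm (2 * B - h u)" if "norm u < R" for u
  proof -
    have "B * (B - Re (h u)) > 0" using Reh[OF that] B by simp
    then have "(norm (h u))\<^sup>2 < (norm (2 * B - h u))\<^sup>2"
      unfolding cmod_power2 by (simp add: power2_eq_square algebra_simps)
    then show ?thesis by (rule power2_less_imp_less) simp
  qed
  define \<phi> where "\<phi> = (\<lambda>z. h z / (2 * of_real B - h z))"
  have nz: "2 * of_real B - h u \<noteq> 0" if "norm u < R" for u
    using key[OF that] by auto
  have norm_\<phi>: "norm (\<phi> (of_real R * u)) \<le> norm u" if "norm u < 1" for u
  proof (rule Schwarz_Lemma(1)[of "\<lambda>u. \<phi> (of_real R * u)"])
    have "\<phi> holomorphic_on ball 0 R"
      unfolding \<phi>_def h_def using nz g by (auto intro!: holomorphic_intros simp: h_def)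
    then have "(\<phi> \<circ> (\<lambda>u. of_real R * u)) holomorphic_on ball 0 1"
      using R by (intro holomorphic_on_compose_gen[of _ _ _ "ball 0 R"] holomorphic_intros)
        (auto simp: norm_mult)
    then show "(\<lambda>u. \<phi> (of_real R * u)) holomorphic_on ball 0 1" by (simp add: o_def)
    show "norm (\<phi> (of_real R * v)) < 1" if "norm v < 1" for v
    proof -
      have "norm (of_real R * v) < R" using R that by (simp add: norm_mult)
      from key[OF this] nz[OF this] show ?thesis by (simp add: \<phi>_def norm_divide)
    qed
  qed (use that in \<open>auto simp: \<phi>_def h_def\<close>)
  define t where "t = r / R"
  have t: "0 \<le> t" "t < 1" using r R by (auto simp: t_def)
  have zR: "norm z < R" using r by simp
  have \<phi>z: "norm (\<phi> z) \<le> t"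
  proof -
    have "norm (z / of_real R) < 1" using zR R by (simp add: norm_divide)
    from norm_\<phi>[OF this] have "norm (\<phi> z) \<le> norm z / R" using R by (simp add: norm_divide)
    also have "\<dots> \<le> t" unfolding t_def using r R by (intro divide_right_mono) auto
    finally show ?thesis .
  qed
  have "h z = \<phi> z * (2 * of_real B - h z)" using nz[OF zR] by (simp add: \<phi>_def)
  then have "norm (h z) \<le> t * (2 * B + norm (h z))"
  proof -
    have "norm (h z) = norm (\<phi> z) * norm (2 * of_real B - h z)"
      using \<open>h z = _\<close> norm_mult by metis
    also have "\<dots> \<le> t * (2 * B + norm (h z))"
      using \<phi>z t B norm_triangle_ineq4[of "2 * of_real B" "h z"] by (intro mult_mono) auto
    finally show ?thesis .
  qed
  then have "norm (h z) * (1 - t) \<le> 2 * B * t" by (simp add: algebra_simps)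
  then have "norm (h z) \<le> 2 * B * t / (1 - t)" using t by (simp add: pos_le_divide_eq)
  also have "\<dots> = 2 * B * r / (R - r)" using R r by (simp add: t_def field_simps)
  finally show ?thesis using norm_triangle_sub[of "g z" "g 0"] by (simp add: h_def B_def)
qed

text \<open>
  Liouville's theorem for polynomial growth, in the version where the growth bound is known only
  on some arbitrarily large circles: Cauchy's inequalities still annihilate all Taylor coefficients
  beyond the quadratic one.
\<close>

lemma entire_quadratic_bound:
  assumes g: "g holomorphic_on UNIV"
    and bnd: "\<And>r1. \<exists>r\<ge>r1. \<forall>z. norm z \<le> r \<longrightarrow> norm (g z) \<le> B * r ^ 2"
  shows "\<exists>C. \<forall>z. norm (g z) \<le> C * (1 + norm z) ^ 2"
proof -
  have van: "(deriv ^^ k) g 0 = 0" if k: "k \<ge> 3" for k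
  proof (rule ccontr)
    assume "(deriv ^^ k) g 0 \<noteq> 0"
    define c where "c = norm ((deriv ^^ k) g 0)"
    have c: "c > 0" using \<open>_ \<noteq> 0\<close> by (simp add: c_def)
    obtain r where r: "r \<ge> 1 + fact k * \<bar>B\<bar> / c" "\<And>z. norm z \<le> r \<Longrightarrow> norm (g z) \<le> B * r ^ 2"
      using bnd by blast
    have "0 \<le> fact k * \<bar>B\<bar> / c" using c by simp
    then have r1: "r \<ge> 1" using r(1) by linarith
    have "c \<le> fact k * (\<bar>B\<bar> * r ^ 2) / r ^ k"
      unfolding c_def
    proof (rule Cauchy_inequality)
      show "norm (g x) \<le> \<bar>B\<bar> * r ^ 2" if "norm (0 - x) = r" for x
        using r(2)[of x] that by (smt (verit) diff_0 mult_right_mono norm_minus_cancel zero_le_power2)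
    qed (use g r1 in \<open>auto intro: holomorphic_on_subset holomorphic_on_imp_continuous_on\<close>)
    also have "\<dots> \<le> fact k * (\<bar>B\<bar> * r ^ 2) / r ^ 3"
      using r1 k by (intro divide_left_mono power_increasing) (auto intro!: mult_nonneg_nonneg)
    also have "\<dots> = fact k * \<bar>B\<bar> / r" using r1 by (simp add: power2_eq_square power3_eq_cube)
    finally have "r \<le> fact k * \<bar>B\<bar> / c" using c r1 by (simp add: field_simps)
    then show False using r(1) by simp
  qed
  define a where "a = (\<lambda>k. (deriv ^^ k) g 0 / fact k)"
  have gz: "g z = (\<Sum>k<3. a k * z ^ k)" for z
  proof -
    have "(\<lambda>k. (deriv ^^ k) g 0 / fact k * (z - 0) ^ k) sums g z"
      using g by (intro holomorphic_power_series[of _ _ "norm z + 1"]) (auto intro: holomorphic_on_subset)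
    then have "(\<lambda>k. a k * z ^ k) sums g z" by (simp add: a_def)
    moreover have "(\<lambda>k. a k * z ^ k) sums (\<Sum>k<3. a k * z ^ k)"
      using van by (intro sums_finite) (auto simp: a_def)
    ultimately show ?thesis using sums_unique2 by blast
  qed
  have "norm (g z) \<le> (\<Sum>k<3. norm (a k)) * (1 + norm z) ^ 2" for z
  proof -
    have "norm (g z) \<le> (\<Sum>k<3. norm (a k) * norm z ^ k)"
      unfolding gz by (rule order_trans[OF norm_sum]) (simp add: norm_mult norm_power)
    also have "\<dots> \<le> (\<Sum>k<3. norm (a k) * (1 + norm z) ^ 2)"
    proof (intro sum_mono mult_left_mono)
      fix k :: nat assume "k \<in> {..<3}"
      have "norm z ^ k \<le> (1 + norm z) ^ k" by (intro power_mono) auto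
      also have "\<dots> \<le> (1 + norm z) ^ 2" using \<open>k \<in> _\<close> by (intro power_increasing) auto
      finally show "norm z ^ k \<le> (1 + norm z) ^ 2" .
    qed auto
    finally show ?thesis by (simp add: sum_distrib_right)
  qed
  then show ?thesis by blast
qed

text \<open>
  At a radius \<open>r\<close> of slow growth with maximum modulus \<open>m = x\<^sup>4\<close>, the functions \<open>g\<close> and \<open>g'\<close> are at most
  \<open>4 x\<^sup>5\<close> on the slightly larger disc of radius \<open>r + 1/(2x)\<close>. The hypothesis then gives
  \<open>Re g = O(log x)\<close> there, for which the weaker \<open>O(x)\<close> is enough. The inequality of Borel and Caratheodory turns
  this into \<open>m = O(r x\<^sup>2) = O(r m\<^sup>1\<^sup>/\<^sup>2)\<close>, that is, \<open>m = O(r\<^sup>2)\<close>.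
\<close>

lemma entire_quadratic_of_exp_bound:
  assumes g: "g holomorphic_on UNIV" and K: "K > 0"
    and bnd: "\<And>z. exp (Re (g z)) \<le> K * (1 + norm (g z) + norm (deriv g z)) ^ n"
  shows "\<exists>C. \<forall>z. norm (g z) \<le> C * (1 + norm z) ^ 2"
proof (cases "\<exists>z. norm (g z) > 1")
  case False
  then have "norm (g z) \<le> 1 * (1 + norm z) ^ 2" for z
    by (smt (verit) mult_1 norm_ge_zero one_le_power)
  then show ?thesis by blast
next
  case True
  then obtain z0 where z0: "norm (g z0) > 1" by blast
  define K2 where "K2 = \<bar>ln K\<bar> + 7 * n"
  define C where "C = norm (g 0) + 4 * (K2 + norm (g 0) + 1)"
  have K2: "K2 \<ge> 0" by (simp add: K2_def)
  show ?thesis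
  proof (rule entire_quadratic_bound[OF g, of "C\<^sup>2"])
    fix r1 :: real
    define r0 where "r0 = norm z0 + \<bar>r1\<bar> + 1"
    obtain r where r: "r \<ge> r0" "maxmod g (r + maxmod g r powr (-1/4)) < 2 * maxmod g r"
    proof (rule slow_growth_radius[of r0 "maxmod g"])
      show "maxmod g a \<le> maxmod g b" if "r0 \<le> a" "a \<le> b" for a b
        using that norm_ge_zero[of z0] unfolding r0_def by (intro maxmod_mono[OF g]) linarith+
      show "1 \<le> maxmod g r0" using norm_le_maxmod[OF g, of z0 r0] z0 by (simp add: r0_def)
    qed blast
    have r1: "r \<ge> 1" "r \<ge> r1" "r \<ge> norm z0" using r(1) norm_ge_zero[of z0] unfolding r0_def by linarith+
    define m where "m = maxmod g r"
    have m: "m > 1" using norm_le_maxmod[OF g, of z0 r] z0 r1 by (simp add: m_def)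
    define x where "x = m powr (1/4)"
    have x: "x \<ge> 1" unfolding x_def using m by (intro ge_one_powr_ge_zero) auto
    have x4: "x ^ 4 = m" using m by (simp add: x_def powr_power)
    have d: "m powr (-1/4) = 1 / x" using m by (simp add: x_def powr_minus_divide)
    \<comment> \<open>Half of the step of slow growth is used for the discs on which \<open>Re g\<close> is bounded,
      and the other half for Cauchy's estimate of \<open>g'\<close>.\<close>
    define d where "d = 1 / (2 * x)"
    have d0: "d > 0" and dx: "1 / x = d + d" "1 / d = 2 * x" using x by (auto simp: d_def)
    have M2: "maxmod g (r + d + d) < 2 * m" using r(2) unfolding m_def[symmetric] d dx by (simp add: add.assoc)
    define A where "A = K2 * x"
    have A: "A \<ge> 0" using K2 x by (simp add: A_def)
    have ReA: "Re (g z) \<le> A" if z: "norm z < r + d" for z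
    proof -
      have "norm (g z) \<le> maxmod g (r + d + d)" using z d0 by (intro norm_le_maxmod[OF g]) auto
      then have 1: "norm (g z) \<le> 2 * m" using M2 by simp
      have "norm (deriv g z) \<le> maxmod g (r + d + d) / d" using z by (intro norm_deriv_le_maxmod[OF g d0]) auto
      also have "\<dots> \<le> 2 * m / d" using M2 d0 by (intro divide_right_mono) auto
      also have "\<dots> = 4 * x ^ 5" using dx(2) d0 by (simp add: x4[symmetric] d_def power_numeral_reduce)
      finally have 2: "norm (deriv g z) \<le> 4 * x ^ 5" .
      have "1 \<le> x ^ 5" "x ^ 4 \<le> x ^ 5" using x by (auto intro: power_increasing)
      then have "1 + norm (g z) + norm (deriv g z) \<le> 7 * x ^ 5" using 1 2 x4 by linarith
      then have "K * (1 + norm (g z) + norm (deriv g z)) ^ n \<le> K * (7 * x ^ 5) ^ n"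
        using K by (intro mult_left_mono power_mono) auto
      then have "exp (Re (g z)) \<le> K * (7 * x ^ 5) ^ n" using bnd[of z] by linarith
      then have "Re (g z) \<le> ln (K * (7 * x ^ 5) ^ n)" using K x by (subst ln_ge_iff) auto
      also have "\<dots> = ln K + n * (ln 7 + 5 * ln x)" using K x by (simp add: ln_mult ln_realpow algebra_simps)
      also have "\<dots> \<le> \<bar>ln K\<bar> * x + n * (7 * x)"
      proof (intro add_mono mult_left_mono)
        show "ln K \<le> \<bar>ln K\<bar> * x" using x mult_left_mono[of 1 x "\<bar>ln K\<bar>"] by simp
        have "ln (7::real) \<le> 2"
        proof -
          have "(7::real) \<le> (27/10) ^ 2" by (simp add: power2_eq_square)
          also have "\<dots> \<le> exp 1 ^ 2" using e_approx_32 by (intro power_mono) (auto simp: abs_if split: if_splits)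
          also have "\<dots> = exp 2" by (simp add: exp_of_nat_mult[symmetric])
          finally show ?thesis by (metis exp_gt_zero ln_exp ln_le_cancel_iff zero_less_numeral)
        qed
        moreover have "ln x \<le> x - 1" using x by (intro ln_le_minus_one) auto
        ultimately show "ln 7 + 5 * ln x \<le> 7 * x" using x by linarith
      qed auto
      also have "\<dots> = A" by (simp add: A_def K2_def algebra_simps)
      finally show ?thesis .
    qed
    have "norm (g z) \<le> C * r * x ^ 2" if z: "norm z \<le> r" for z
    proof -
      have "norm (g z) \<le> norm (g 0) + 2 * (A + norm (g 0) + 1) * r / (r + d - r)"
        using g d0 z by (intro Borel_Caratheodory[OF _ A ReA]) (auto intro: holomorphic_on_subset)
      also have "\<dots> = norm (g 0) + 4 * (A + norm (g 0) + 1) * r * x"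
        using d0 dx by (simp add: d_def)
      also have "\<dots> \<le> norm (g 0) * (r * x ^ 2) + 4 * (K2 * x + norm (g 0) * x + x) * r * x"
      proof (intro add_mono mult_right_mono mult_left_mono)
        have "1 * 1 \<le> r * x ^ 2" using r1 x by (intro mult_mono) auto
        then show "norm (g 0) \<le> norm (g 0) * (r * x ^ 2)"
          using mult_left_mono[of 1 "r * x^2" "norm (g 0)"] by simp
        show "norm (g 0) \<le> norm (g 0) * x" using x mult_left_mono[of 1 x "norm (g 0)"] by simp
      qed (use r1 x in \<open>auto simp: A_def\<close>)
      also have "\<dots> = C * r * x ^ 2" by (simp add: C_def algebra_simps power2_eq_square)
      finally show ?thesis .
    qed
    then have "m \<le> C * r * x ^ 2" unfolding m_def using r1 by (intro maxmod_le) auto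
    then have "x ^ 2 * x ^ 2 \<le> C * r * x ^ 2" by (simp add: x4[symmetric] power_add[symmetric])
    then have "x ^ 2 \<le> C * r" by (rule mult_right_le_imp_le) (use x in auto)
    then have "(x ^ 2) ^ 2 \<le> (C * r) ^ 2" by (intro power_mono) auto
    then have "m \<le> C\<^sup>2 * r ^ 2" by (simp add: x4[symmetric] power_mult_distrib power_mult[symmetric])
    then show "\<exists>r\<ge>r1. \<forall>z. norm z \<le> r \<longrightarrow> norm (g z) \<le> C\<^sup>2 * r ^ 2"
      using r1 norm_le_maxmod[OF g, of _ r] unfolding m_def by (meson order_trans)
  qed
qed

section \<open>Upper bounds for the characteristic\<close>

lemma pi_upper: "pi \<le> 16/5"
  using pi_approx by simp

lemma log_plus_mono: "0 \<le> x \<Longrightarrow> x \<le> y \<Longrightarrow> log_plus x \<le> log_plus y"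
  unfolding log_plus_def by (cases "x = 0") (auto intro: max.coboundedI2)

lemma log_plus_mult_le:
  assumes "0 \<le> x" "0 \<le> y"
  shows "log_plus (x * y) \<le> log_plus x + log_plus y"
  using assms unfolding log_plus_def by (cases "x = 0 \<or> y = 0") (auto simp: ln_mult)

lemma log_plus_power_le:
  assumes "0 \<le> x"
  shows "log_plus (x ^ k) \<le> real k * log_plus x"
proof (induction k)
  case 0
  then show ?case by (simp add: log_plus_def)
next
  case (Suc k)
  have "log_plus (x * x ^ k) \<le> log_plus x + real k * log_plus x"
    using log_plus_mult_le[of x "x ^ k"] Suc assms by simp
  then show ?case by (simp add: algebra_simps)
qed

text \<open>
  An integral that does not exist has the value \<open>0\<close>. With a nonnegative majorant, upper bounds
  therefore follow without proving that the integrand is integrable.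
\<close>

lemma integral_le_majorant:
  fixes f g :: "real \<Rightarrow> real"
  assumes g: "g integrable_on S" and le: "\<And>x. x \<in> S \<Longrightarrow> f x \<le> g x" and nn: "\<And>x. x \<in> S \<Longrightarrow> 0 \<le> g x"
  shows "integral S f \<le> integral S g"
proof (cases "f integrable_on S")
  case True
  then show ?thesis using g le by (intro integral_le) auto
next
  case False
  then show ?thesis using g nn by (simp add: not_integrable_integral integral_nonneg)
qed

lemma abs_sin_ge_half:
  assumes "\<bar>x\<bar> \<le> pi / 2"
  shows "\<bar>x\<bar> / 2 \<le> \<bar>sin x\<bar>"
proof -
  have "\<bar>sin x - (\<Sum>m<3. sin_coeff m * x ^ m)\<bar> \<le> inverse (fact 3) * \<bar>x\<bar> ^ 3"
    by (rule Maclaurin_sin_bound)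
  moreover have "(\<Sum>m<3. sin_coeff m * x ^ m) = x" by (simp add: sin_coeff_def eval_nat_numeral)
  moreover have "inverse (fact 3) * \<bar>x\<bar> ^ 3 \<le> \<bar>x\<bar> / 2"
  proof -
    \<comment> \<open>The cubic error term is at most \<open>|x| / 2\<close>, since \<open>x\<^sup>2 < 3\<close>.\<close>
    have "\<bar>x\<bar> \<le> 17/10" using assms pi_upper by linarith
    then have "\<bar>x\<bar> ^ 2 \<le> (17/10) ^ 2" by (intro power_mono) auto
    then have "\<bar>x\<bar> * \<bar>x\<bar> ^ 2 \<le> \<bar>x\<bar> * 3" by (intro mult_left_mono) (auto simp: power2_eq_square)
    then show ?thesis by (simp add: fact_numeral power2_eq_square power3_eq_cube)
  qed
  ultimately show ?thesis by linarith
qed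

lemma abs_sin_ge_dist:
  assumes "\<bar>x\<bar> \<le> 3 * pi"
  obtains j :: int where "j \<in> {-3..3}" "\<bar>x - of_int j * pi\<bar> / 2 \<le> \<bar>sin x\<bar>"
proof -
  define j where "j = round (x / pi)"
  have j: "\<bar>of_int j - x / pi\<bar> \<le> 1 / 2" unfolding j_def by (rule of_int_round_abs_le)
  have "x - of_int j * pi = - pi * (of_int j - x / pi)" by (simp add: field_simps)
  then have "\<bar>x - of_int j * pi\<bar> = pi * \<bar>of_int j - x / pi\<bar>" by (simp add: abs_mult)
  also have "\<dots> \<le> pi * (1/2)" using j by (intro mult_left_mono) auto
  finally have "\<bar>x - of_int j * pi\<bar> / 2 \<le> \<bar>sin (x - of_int j * pi)\<bar>" by (intro abs_sin_ge_half) auto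
  also have "\<dots> = \<bar>sin x\<bar>" by (auto simp: sin_diff abs_mult mult.commute[of _ pi])
  finally have 1: "\<bar>x - of_int j * pi\<bar> / 2 \<le> \<bar>sin x\<bar>" .
  have "\<bar>x / pi\<bar> \<le> 3" using assms by (simp add: abs_divide divide_le_eq)
  then have "\<bar>real_of_int j\<bar> < 4" using j by linarith
  then have "j \<in> {-3..3}" by auto
  with 1 that show ?thesis by blast
qed

text \<open>
  The square root is an odd function on all of the reals here, so \<open>2 sqrt (x - a)\<close> is a continuous
  antiderivative on both sides of the singularity.
\<close>

lemma has_integral_inverse_sqrt_abs:
  fixes a s t :: real
  assumes "s \<le> t"
  shows "((\<lambda>x. 1 / sqrt \<bar>x - a\<bar>) has_integral (2 * sqrt (t - a) - 2 * sqrt (s - a))) {s..t}"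
proof (rule fundamental_theorem_of_calculus_interior_strong[of "{a}"])
  show "((\<lambda>x. 2 * sqrt (x - a)) has_vector_derivative 1 / sqrt \<bar>x - a\<bar>) (at x)" if "x \<in> {s<..<t} - {a}" for x
  proof -
    have "((\<lambda>x. sqrt (x - a)) has_real_derivative (1 / sqrt \<bar>x - a\<bar> / 2) * 1) (at x)"
    proof (rule DERIV_chain2[of sqrt])
      show "(sqrt has_real_derivative 1 / sqrt \<bar>x - a\<bar> / 2) (at (x - a))"
      proof (rule DERIV_real_sqrt_generic)
        assume "x - a < 0"
        then have "sqrt \<bar>x - a\<bar> = - sqrt (x - a)" by (metis abs_of_neg real_sqrt_minus)
        then show "1 / sqrt \<bar>x - a\<bar> / 2 = - inverse (sqrt (x - a)) / 2" by (simp add: field_simps)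
      qed (use that in \<open>auto simp: field_simps\<close>)
    qed (auto intro!: derivative_eq_intros)
    from DERIV_cmult[OF this, of 2] show ?thesis
      by (simp add: has_real_derivative_iff_has_vector_derivative)
  qed
qed (use assms in \<open>auto intro!: continuous_intros\<close>)

text \<open>
  The logarithmic singularity is replaced by the inverse square root, which has an elementary integral.
\<close>

lemma log_plus_inverse_le:
  assumes "0 < c" "c \<le> y"
  shows "log_plus (1 / y) \<le> 2 / sqrt c"
proof -
  have y: "y > 0" using assms by simp
  have "ln (1 / y) = 2 * ln (1 / sqrt y)" using y by (simp add: ln_div ln_sqrt)
  also have "\<dots> \<le> 2 * (1 / sqrt y)" using y ln_le_minus_one[of "1 / sqrt y"] by simp
  also have "\<dots> \<le> 2 / sqrt c" using assms y by (simp add: frac_le)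
  finally show ?thesis using assms by (simp add: log_plus_def)
qed

text \<open>
  The distance from \<open>p\<close> to a point is at least the distance of that point from the line through \<open>0\<close> and \<open>p\<close>.
\<close>

lemma norm_circle_diff_ge:
  assumes "r \<ge> 0"
  shows "r * \<bar>sin (\<theta> - Arg p)\<bar> \<le> norm (of_real r * cis \<theta> - p)"
proof -
  have "of_real r * cis \<theta> - p = (of_real r * cis (\<theta> - Arg p) - of_real (norm p)) * cis (Arg p)"
    using rcis_cmod_Arg[of p] by (simp add: algebra_simps cis_mult rcis_def flip: mult.assoc)
  then have "norm (of_real r * cis \<theta> - p) = norm (of_real r * cis (\<theta> - Arg p) - of_real (norm p))"
    by (simp add: norm_mult)
  also have "\<dots> \<ge> \<bar>Im (of_real r * cis (\<theta> - Arg p) - of_real (norm p))\<bar>" by (rule abs_Im_le_cmod)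
  finally show ?thesis using assms by (simp add: abs_mult)
qed

text \<open>
  The contribution of a single pole \<open>p\<close> to the proximity function is bounded uniformly in \<open>p\<close> and
  in the radius \<open>r \<ge> r1\<close>. After the angle is measured from the argument of \<open>p\<close>, the distance to \<open>p\<close> is
  at least \<open>r\<close> times the absolute value of a sine, which vanishes linearly at the multiples of \<open>\<pi>\<close>.
\<close>

lemma log_plus_circle_majorant:
  assumes r1: "r1 > 0"
  obtains C where "C \<ge> 0" "\<And>r p. r \<ge> r1 \<Longrightarrow> \<exists>g. g integrable_on {0..2*pi} \<and> integral {0..2*pi} g \<le> C \<and>
      (\<forall>\<theta>\<in>{0..2*pi}. log_plus (1 / norm (of_real r * cis \<theta> - p)) \<le> g \<theta>)"
proof
  define c where "c = 2 / sqrt (r1 / 2)"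
  have c: "c \<ge> 0" using r1 by (simp add: c_def)
  show "0 \<le> c * (\<Sum>j::int\<in>{-3..3}. 20)" using c by simp
  fix r p assume r: "r \<ge> r1"
  define a where "a = (\<lambda>j::int. Arg p + of_int j * pi)"
  define h where "h = (\<lambda>\<theta>. c * (\<Sum>j\<in>{-3..3}. 1 / sqrt \<bar>\<theta> - a j\<bar>))"
  have h_nonneg: "h \<theta> \<ge> 0" for \<theta> unfolding h_def using c by (intro mult_nonneg_nonneg sum_nonneg) auto
  define f where "f = (\<lambda>\<theta>. log_plus (1 / norm (of_real r * cis \<theta> - p)))"
  define S where "S = a ` {-3..3}"
  have S: "finite S" by (simp add: S_def)
  have int_h: "(h has_integral c * (\<Sum>j\<in>{-3..3}. 2 * sqrt (2 * pi - a j) - 2 * sqrt (0 - a j))) {0..2*pi}"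
    unfolding h_def by (intro has_integral_mult_right has_integral_sum has_integral_inverse_sqrt_abs) auto
  \<comment> \<open>At the points of \<open>S\<close> a summand of \<open>h\<close> has the value \<open>1 / 0 = 0\<close> and bounds nothing.\<close>
  define g where "g = (\<lambda>\<theta>. if \<theta> \<in> S then f \<theta> else h \<theta>)"
  have int_g: "(g has_integral c * (\<Sum>j\<in>{-3..3}. 2 * sqrt (2 * pi - a j) - 2 * sqrt (0 - a j))) {0..2*pi}"
    by (rule has_integral_spike_finite[OF S _ int_h]) (auto simp: g_def)
  show "\<exists>g. g integrable_on {0..2*pi} \<and> integral {0..2*pi} g \<le> c * (\<Sum>j::int\<in>{-3..3}. 20) \<and>
      (\<forall>\<theta>\<in>{0..2*pi}. log_plus (1 / norm (of_real r * cis \<theta> - p)) \<le> g \<theta>)"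
  proof (intro exI[of _ g] conjI ballI)
    show "g integrable_on {0..2*pi}" using int_g by blast
    have "integral {0..2*pi} g = c * (\<Sum>j\<in>{-3..3}. 2 * sqrt (2 * pi - a j) - 2 * sqrt (0 - a j))"
      using int_g by blast
    also have "\<dots> \<le> c * (\<Sum>j::int\<in>{-3..3}. 20)"
    proof (intro mult_left_mono sum_mono c)
      fix j :: int assume j: "j \<in> {-3..3}"
      have "\<bar>Arg p\<bar> \<le> pi" using Arg_bounded[of p] by linarith
      moreover have "\<bar>of_int j * pi\<bar> \<le> 3 * pi" using j by (auto simp: abs_mult intro!: mult_right_mono)
      ultimately have "\<bar>a j\<bar> \<le> 4 * pi" unfolding a_def by linarith
      then have "2 * pi - a j \<le> 5 ^ 2" "- (5 ^ 2) \<le> 0 - a j" using pi_upper by (auto simp: power2_eq_square)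
      then have "sqrt (2 * pi - a j) \<le> sqrt (5 ^ 2)" "sqrt (- (5 ^ 2)) \<le> sqrt (0 - a j)"
        by (intro real_sqrt_le_mono; simp)+
      then show "2 * sqrt (2 * pi - a j) - 2 * sqrt (0 - a j) \<le> 20"
        unfolding real_sqrt_minus real_sqrt_abs by linarith
    qed
    finally show "integral {0..2*pi} g \<le> c * (\<Sum>j::int\<in>{-3..3}. 20)" .
    fix \<theta> :: real assume \<theta>: "\<theta> \<in> {0..2*pi}"
    show "log_plus (1 / norm (of_real r * cis \<theta> - p)) \<le> g \<theta>"
    proof (cases "\<theta> \<in> S")
      case False
      have "\<bar>\<theta> - Arg p\<bar> \<le> 3 * pi" using \<theta> Arg_bounded[of p] by auto
      then obtain j :: int where j: "j \<in> {-3..3}" "\<bar>(\<theta> - Arg p) - of_int j * pi\<bar> / 2 \<le> \<bar>sin (\<theta> - Arg p)\<bar>"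
        by (rule abs_sin_ge_dist)
      have ne: "\<bar>\<theta> - a j\<bar> > 0" using False j(1) by (auto simp: S_def)
      have "r1 / 2 * \<bar>\<theta> - a j\<bar> \<le> r * \<bar>sin (\<theta> - Arg p)\<bar>"
      proof -
        have "r1 * (\<bar>\<theta> - a j\<bar> / 2) \<le> r * \<bar>sin (\<theta> - Arg p)\<bar>"
          using j(2) r r1 by (intro mult_mono) (auto simp: a_def algebra_simps)
        then show ?thesis by simp
      qed
      also have "\<dots> \<le> norm (of_real r * cis \<theta> - p)" using r r1 by (intro norm_circle_diff_ge) auto
      finally have "log_plus (1 / norm (of_real r * cis \<theta> - p)) \<le> 2 / sqrt (r1 / 2 * \<bar>\<theta> - a j\<bar>)"
        using r1 ne by (intro log_plus_inverse_le) auto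
      also have "\<dots> = c * (1 / sqrt \<bar>\<theta> - a j\<bar>)" unfolding c_def real_sqrt_mult by simp
      also have "\<dots> \<le> h \<theta>"
        unfolding h_def using j(1) c
        by (intro mult_left_mono member_le_sum[of j "{-3..3}" "\<lambda>j. 1 / sqrt \<bar>\<theta> - a j\<bar>"]) auto
      finally show ?thesis using False by (simp add: g_def)
    qed (simp add: g_def f_def)
  qed
qed

text \<open>
  A grid of squares with side \<open>\<delta> / 2\<close> has at most one point of the set in each square.
\<close>

lemma separated_set_card:
  fixes S :: "complex set"
  assumes d: "\<delta> > 0" and sep: "\<And>p q. p \<in> S \<Longrightarrow> q \<in> S \<Longrightarrow> p \<noteq> q \<Longrightarrow> \<delta> \<le> norm (p - q)"
    and R: "\<And>p. p \<in> S \<Longrightarrow> norm p \<le> R" "R \<ge> 0"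
  shows "finite S" "real (card S) \<le> (4 * R / \<delta> + 5) ^ 2"
proof -
  define m where "m = \<lceil>2 * R / \<delta>\<rceil> + 1"
  define cell where "cell = (\<lambda>z. (\<lfloor>2 * Re z / \<delta>\<rfloor>, \<lfloor>2 * Im z / \<delta>\<rfloor>))"
  have close: "\<bar>x - y\<bar> \<le> \<delta> / 2" if "\<lfloor>2 * x / \<delta>\<rfloor> = \<lfloor>2 * y / \<delta>\<rfloor>" for x y :: real
  proof -
    have "\<bar>2 * x / \<delta> - 2 * y / \<delta>\<bar> \<le> 1" using that by linarith
    also have "2 * x / \<delta> - 2 * y / \<delta> = 2 / \<delta> * (x - y)"
      by (simp add: diff_divide_distrib right_diff_distrib)
    finally have "2 / \<delta> * \<bar>x - y\<bar> \<le> 1" using d unfolding abs_mult by simp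
    then have "\<bar>x - y\<bar> * 2 \<le> \<delta>" using d by (simp add: pos_divide_le_eq mult.commute)
    then show ?thesis by simp
  qed
  have inj: "inj_on cell S"
  proof (rule inj_onI, rule ccontr)
    fix p q assume pq: "p \<in> S" "q \<in> S" "cell p = cell q" "p \<noteq> q"
    have "\<delta> ^ 2 \<le> norm (p - q) ^ 2" using sep[OF pq(1,2,4)] d by (intro power_mono) auto
    also have "\<dots> = \<bar>Re p - Re q\<bar> ^ 2 + \<bar>Im p - Im q\<bar> ^ 2" by (simp add: cmod_power2)
    also have "\<dots> \<le> (\<delta> / 2) ^ 2 + (\<delta> / 2) ^ 2"
      using pq(3) by (intro add_mono power_mono close) (auto simp: cell_def)
    also have "\<dots> < \<delta> ^ 2" using d by (simp add: power2_eq_square)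
    finally show False by simp
  qed
  have coord: "\<lfloor>2 * x / \<delta>\<rfloor> \<in> {-m..m}" if "\<bar>x\<bar> \<le> R" for x
  proof -
    have "\<bar>2 * x / \<delta>\<bar> \<le> 2 * R / \<delta>" using that d by (simp add: abs_mult divide_right_mono)
    then have "- (2 * R / \<delta>) \<le> 2 * x / \<delta>" "2 * x / \<delta> \<le> 2 * R / \<delta>" by (simp_all only: abs_le_iff) linarith
    then have "- of_int m \<le> 2 * x / \<delta>" "2 * x / \<delta> < of_int m + 1"
      unfolding m_def by linarith+
    then show ?thesis by (simp add: le_floor_iff floor_le_iff)
  qed
  have sub: "cell ` S \<subseteq> {-m..m} \<times> {-m..m}"
    using R(1) abs_Re_le_cmod abs_Im_le_cmod
    by (auto simp: cell_def simp del: atLeastAtMost_iff intro!: coord intro: order_trans)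
  show fin: "finite S" using inj sub by (meson finite_SigmaI finite_atLeastAtMost_int finite_imageD finite_subset)
  have "card S = card (cell ` S)" using inj by (simp add: card_image)
  also have "\<dots> \<le> card ({-m..m} \<times> {-m..m})" using sub by (intro card_mono) auto
  also have "\<dots> = nat (2 * m + 1) ^ 2" by (simp add: card_cartesian_product power2_eq_square)
  finally have "real (card S) \<le> real (nat (2 * m + 1)) ^ 2" by (metis of_nat_le_iff of_nat_power)
  also have "\<dots> \<le> (4 * R / \<delta> + 5) ^ 2"
  proof (rule power_mono)
    have "0 \<le> 2 * R / \<delta>" using R d by simp
    then have "0 \<le> m" unfolding m_def by linarith
    then have "real (nat (2 * m + 1)) = 2 * of_int m + 1" by simp
    also have "\<dots> \<le> 2 * (2 * R / \<delta> + 2) + 1"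
    proof -
      have "of_int m \<le> 2 * R / \<delta> + 2" unfolding m_def using ceiling_correct[of "2 * R / \<delta>"] by linarith
      then show ?thesis by simp
    qed
    finally show "real (nat (2 * m + 1)) \<le> 4 * R / \<delta> + 5" by simp
  qed auto
  finally show "real (card S) \<le> (4 * R / \<delta> + 5) ^ 2" .
qed

text \<open>
  The leading term of the Laurent expansion dominates, or \<open>w\<close> has a limit. The bound serves for the characteristic at radii close to \<open>0\<close>.
\<close>

lemma meromorphic_punctured_bound:
  assumes w: "w meromorphic_on UNIV"
  obtains d B where "d > 0" "B > 0"
    "\<And>z. z \<noteq> p \<Longrightarrow> norm (z - p) \<le> d \<Longrightarrow> \<not> is_pole w z"
    "\<And>z. z \<noteq> p \<Longrightarrow> norm (z - p) \<le> d \<Longrightarrow>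
       norm (w z) \<le> B / norm (z - p) ^ (if is_pole w p then nat (- zorder w p) else 0)"
proof -
  have iso: "isolated_singularity_at w p" and ness: "not_essential w p"
    using w meromorphic_at_iff meromorphic_on_subset by blast+
  obtain e where e: "e > 0" "w analytic_on ball p e - {p}"
    using iso unfolding isolated_singularity_at_def by blast
  have npole: "\<not> is_pole w z" if "z \<noteq> p" "norm (z - p) < e" for z
    using e(2) that analytic_at_imp_no_pole[of w z]
    by (auto simp: analytic_on_analytic_at[of w "ball p e - {p}"] dist_norm norm_minus_commute)
  show thesis
  proof (cases "is_pole w p")
    case True
    have "w holomorphic_on ball p e - {p}" using e(2) by (rule analytic_imp_holomorphic)
    from zorder_exist_pole[OF this open_ball _ True] e(1)
    obtain r where "r > 0" "cball p r \<subseteq> ball p e" "zor_poly w p holomorphic_on cball p r"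
      "\<forall>z\<in>cball p r - {p}. w z = zor_poly w p z / (z - p) ^ nat (- zorder w p) \<and> zor_poly w p z \<noteq> 0"
      by auto
    then obtain r g where r: "r > 0" "cball p r \<subseteq> ball p e" "g holomorphic_on cball p r"
      "\<And>z. z \<in> cball p r - {p} \<Longrightarrow> w z = g z / (z - p) ^ nat (- zorder w p)"
      by blast
    have "compact (g ` cball p r)"
      using r(3) by (intro compact_continuous_image holomorphic_on_imp_continuous_on) auto
    then obtain B where B: "B > 0" "\<And>z. z \<in> cball p r \<Longrightarrow> norm (g z) \<le> B"
      by (metis bounded_pos compact_imp_bounded imageI)
    show thesis
    proof (rule that[of r B])
      fix z assume z: "z \<noteq> p" "norm (z - p) \<le> r"
      then have zr: "z \<in> cball p r - {p}" by (auto simp: dist_norm norm_minus_commute)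
      then show "\<not> is_pole w z" using npole z r(2) by (auto simp: dist_norm norm_minus_commute)
      show "norm (w z) \<le> B / norm (z - p) ^ (if is_pole w p then nat (- zorder w p) else 0)"
        using True r(4)[OF zr] B(2)[of z] zr by (simp add: norm_divide norm_power divide_right_mono)
    qed (use r B in auto)
  next
    case False
    then obtain l where "w \<midarrow>p\<rightarrow> l" using ness by (auto simp: not_essential_def)
    then have "\<forall>\<^sub>F z in at p. dist (w z) l < 1" by (rule tendstoD) auto
    then obtain d where d: "d > 0" "\<And>z. z \<noteq> p \<Longrightarrow> dist z p < d \<Longrightarrow> dist (w z) l < 1"
      unfolding eventually_at by auto
    show thesis
    proof (rule that[of "min d e / 2" "norm l + 1"])
      fix z assume z: "z \<noteq> p" "norm (z - p) \<le> min d e / 2"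
      then show "\<not> is_pole w z" using npole e d by auto
      have "dist (w z) l < 1" using z d e by (intro d(2)) (auto simp: dist_norm)
      then show "norm (w z) \<le> (norm l + 1) / norm (z - p) ^ (if is_pole w p then nat (- zorder w p) else 0)"
        using False norm_triangle_sub[of "w z" l] by (simp add: dist_norm)
    qed (use d e in \<open>auto simp: add_nonneg_pos\<close>)
  qed
qed

text \<open>
  Separation of the poles gives a quadratic bound on their number, and thereby a bound on the integrated
  counting function. On a circle, \<open>log\<^sup>+ |w|\<close> is at most a polynomial in the radius plus the
  logarithmic singularities of the poles within distance \<open>\<delta>\<close>; by the uniform bound on their integrals,
  these contribute a multiple of the number of poles. That bound needs a radius bounded away from \<open>0\<close>. For
  smaller radii, the term \<open>n(0) ln r\<close> of the counting function cancels against the growth of the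
  proximity function at a pole at \<open>0\<close>.
\<close>

lemma nevanlinna_T_polynomial_bound:
  assumes w: "w nicely_meromorphic_on UNIV" and d: "\<delta> > 0"
    and sep: "\<And>p q. is_pole w p \<Longrightarrow> is_pole w q \<Longrightarrow> p \<noteq> q \<Longrightarrow> \<delta> \<le> norm (p - q)"
    and mult: "\<And>p. is_pole w p \<Longrightarrow> nat (- zorder w p) \<le> k"
    and B: "B \<ge> 0"
    and bnd: "\<And>z. \<not> is_pole w z \<Longrightarrow> norm (w z) \<le> exp (B * (1 + norm z) ^ j) \<or>
                (\<exists>p. is_pole w p \<and> norm (z - p) < \<delta> \<and> norm (w z) * norm (z - p) ^ k \<le> B)"
  shows "\<exists>C>0. \<forall>r\<ge>0. nevanlinna_T r w < C * (1 + r) ^ (j + 4)"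
proof -
  define Pl where "Pl = (\<lambda>t. {z. norm z \<le> t \<and> is_pole w z})"
  define c0 where "c0 = (4 / \<delta> + 5) ^ 2"
  have c0: "c0 \<ge> 0" by (simp add: c0_def)
  have Pl: "finite (Pl t)" "real (card (Pl t)) \<le> c0 * (1 + t) ^ 2" if t: "t \<ge> 0" for t
  proof -
    note * = separated_set_card[of \<delta> "Pl t" t, OF d]
    show "finite (Pl t)" using sep t by (intro *) (auto simp: Pl_def)
    have "real (card (Pl t)) \<le> (4 * t / \<delta> + 5) ^ 2" using sep t by (intro *) (auto simp: Pl_def)
    also have "\<dots> \<le> ((4 / \<delta> + 5) * (1 + t)) ^ 2"
      using t d by (intro power_mono) (auto simp: field_simps)
    finally show "real (card (Pl t)) \<le> c0 * (1 + t) ^ 2" by (simp add: c0_def power_mult_distrib)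
  qed
  define n where "n = (\<lambda>t. real (pole_count t w))"
  have n_le: "n t \<le> k * c0 * (1 + t) ^ 2" if t: "t \<ge> 0" for t
  proof -
    have "pole_count t w \<le> (\<Sum>z\<in>Pl t. k)"
      unfolding pole_count_def Pl_def using mult by (intro sum_mono) auto
    also have "\<dots> = k * card (Pl t)" by simp
    finally have "n t \<le> real (k * card (Pl t))" unfolding n_def by (rule of_nat_mono)
    also have "\<dots> \<le> k * (c0 * (1 + t) ^ 2)" using Pl(2)[OF t] by (simp add: mult_left_mono)
    finally show ?thesis by (simp add: mult.assoc)
  qed
  have mero: "w meromorphic_on UNIV" using w by (simp add: nicely_meromorphic_on_def)
  obtain d1 B1 where d1: "d1 > 0" and B1: "B1 > 0"
    and np: "\<And>z. z \<noteq> 0 \<Longrightarrow> norm z \<le> d1 \<Longrightarrow> \<not> is_pole w z"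
    and wB1: "\<And>z. z \<noteq> 0 \<Longrightarrow> norm z \<le> d1 \<Longrightarrow>
       norm (w z) \<le> B1 / norm z ^ (if is_pole w 0 then nat (- zorder w 0) else 0)"
    by (rule meromorphic_punctured_bound[OF mero, of 0]) auto
  define n0 where "n0 = pole_count 0 w"
  have Pl0: "Pl 0 = (if is_pole w 0 then {0} else {})" by (auto simp: Pl_def)
  have n0: "n0 = (if is_pole w 0 then nat (- zorder w 0) else 0)"
    using Pl0 unfolding n0_def pole_count_def Pl_def by auto
  \<comment> \<open>Up to the radius \<open>r1\<close> there is no pole except possibly \<open>0\<close>.\<close>
  define r1 where "r1 = min d1 1"
  have r1: "r1 > 0" "r1 \<le> 1" "r1 \<le> d1" using d1 by (auto simp: r1_def)
  have n_const: "n t = n0" if "0 \<le> t" "t \<le> r1" for t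
  proof -
    have "Pl t = Pl 0"
    proof -
      have "x = 0" if "norm x \<le> t" "is_pole w x" for x
        using np[of x] that \<open>t \<le> r1\<close> r1(3) by fastforce
      then show ?thesis using \<open>0 \<le> t\<close> by (auto simp: Pl_def)
    qed
    then show ?thesis unfolding n_def n0_def pole_count_def Pl_def by simp
  qed
  define D where "D = k * c0 / r1"
  have D: "D \<ge> 0" using c0 r1 by (simp add: D_def)
  have N: "integral {0..r} (\<lambda>t. (n t - n0) / t) \<le> D * (1 + r) ^ 3" if r: "r \<ge> 0" for r
  proof -
    have "integral {0..r} (\<lambda>t. (n t - n0) / t) \<le> integral {0..r} (\<lambda>t. D * (1 + r) ^ 2)"
    proof (rule integral_le_majorant)
      fix t assume t: "t \<in> {0..r}"
      show "(n t - n0) / t \<le> D * (1 + r) ^ 2"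
      proof (cases "t \<le> r1")
        case True
        then show ?thesis using n_const[of t] t D by simp
      next
        case False
        have "n t - n0 \<le> k * c0 * (1 + r) ^ 2"
        proof -
          have "k * c0 * (1 + t) ^ 2 \<le> k * c0 * (1 + r) ^ 2"
            using t c0 by (intro mult_left_mono power_mono) auto
          then show ?thesis using n_le[of t] t by simp
        qed
        then have "(n t - n0) / t \<le> k * c0 * (1 + r) ^ 2 / r1"
          using False r1 c0 by (intro frac_le) auto
        then show ?thesis by (simp add: D_def)
      qed
    qed (use D in auto)
    also have "\<dots> = r * (D * (1 + r) ^ 2)" using r by simp
    also have "\<dots> \<le> (1 + r) * (D * (1 + r) ^ 2)" using r D by (intro mult_right_mono) auto
    finally show ?thesis by (simp add: power2_eq_square power3_eq_cube algebra_simps)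
  qed
  have T_eq: "nevanlinna_T r w = proximity r w + (integral {0..r} (\<lambda>t. (n t - n0) / t) + n0 * ln r)" for r
    by (simp add: nevanlinna_T_def pole_count_integrated_def n_def n0_def)
  have prox: "proximity r w \<le> M"
    if "g integrable_on {0..2*pi}" "integral {0..2*pi} g \<le> 2 * pi * M"
      "\<And>\<theta>. \<theta> \<in> {0..2*pi} \<Longrightarrow> log_plus (norm (w (of_real r * cis \<theta>))) \<le> g \<theta>" for r g M
  proof -
    have "integral {0..2*pi} (\<lambda>\<theta>. log_plus (norm (w (of_real r * cis \<theta>)))) \<le> integral {0..2*pi} g"
      using that(3) by (intro integral_le_majorant that(1)) (auto simp: log_plus_def)
    also note that(2)
    finally show ?thesis unfolding proximity_def by (simp add: field_simps)
  qed
  have prox_const: "proximity r w \<le> M"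
    if "\<And>\<theta>. log_plus (norm (w (of_real r * cis \<theta>))) \<le> M" for r M
    using that by (intro prox[of "\<lambda>_. M"]) auto
  obtain C1 where C1: "C1 \<ge> 0" and C1': "\<And>r p. r \<ge> r1 \<Longrightarrow> \<exists>g. g integrable_on {0..2*pi} \<and>
      integral {0..2*pi} g \<le> C1 \<and> (\<forall>\<theta>\<in>{0..2*pi}. log_plus (1 / norm (of_real r * cis \<theta> - p)) \<le> g \<theta>)"
    using log_plus_circle_majorant[OF r1(1)] by metis
  define C2 where "C2 = c0 * (1 + \<delta>) ^ 2 * k * C1"
  have C2: "C2 \<ge> 0" using c0 C1 by (simp add: C2_def)
  define E where "E = B + log_plus B + C2 + D + n0 + log_plus B1 + log_plus (norm (w 0)) + 1"
  have lp_nonneg: "log_plus x \<ge> 0" for x by (simp add: log_plus_def)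
  have E: "E > 0" unfolding E_def using B C2 D lp_nonneg by (simp add: add_nonneg_pos)
  have large: "proximity r w \<le> B * (1 + r) ^ j + log_plus B + C2 * (1 + r) ^ 2" if r: "r \<ge> r1" for r
  proof -
    have r0: "r \<ge> 0" using r r1 by simp
    obtain G where G: "\<And>p. G p integrable_on {0..2*pi}" "\<And>p. integral {0..2*pi} (G p) \<le> C1"
      "\<And>p \<theta>. \<theta>\<in>{0..2*pi} \<Longrightarrow> log_plus (1 / norm (of_real r * cis \<theta> - p)) \<le> G p \<theta>"
      using C1'[OF r] by metis
    have G0: "0 \<le> G p \<theta>" if "\<theta>\<in>{0..2*pi}" for p \<theta> using G(3)[OF that] lp_nonneg order_trans by blast
    define Q where "Q = Pl (r + \<delta>)"
    have fQ: "finite Q" using Pl(1)[of "r + \<delta>"] r0 d by (simp add: Q_def)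
    define L where "L = B * (1 + r) ^ j + log_plus B"
    have L: "L \<ge> 0" using B r0 lp_nonneg by (simp add: L_def)
    show ?thesis
    proof (rule prox[of "\<lambda>\<theta>. L + (\<Sum>p\<in>Q. k * G p \<theta>)"])
      show "(\<lambda>\<theta>. L + (\<Sum>p\<in>Q. k * G p \<theta>)) integrable_on {0..2*pi}"
        using G(1) fQ by (intro integrable_add integrable_sum integrable_on_mult_right) auto
      have "integral {0..2*pi} (\<lambda>\<theta>. L + (\<Sum>p\<in>Q. k * G p \<theta>)) = 2 * pi * L + (\<Sum>p\<in>Q. k * integral {0..2*pi} (G p))"
      proof -
        have "integral {0..2*pi} (\<lambda>\<theta>. \<Sum>p\<in>Q. k * G p \<theta>) = (\<Sum>p\<in>Q. integral {0..2*pi} (\<lambda>\<theta>. k * G p \<theta>))"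
          using G(1) fQ by (intro integral_sum integrable_on_mult_right) auto
        then show ?thesis
          using G(1) fQ by (subst integral_add) (auto intro!: integrable_sum integrable_on_mult_right)
      qed
      also have "(\<Sum>p\<in>Q. k * integral {0..2*pi} (G p)) \<le> (\<Sum>p\<in>Q. k * C1)"
        using G(2) by (intro sum_mono mult_left_mono) auto
      also have "\<dots> = card Q * (k * C1)" by simp
      also have "\<dots> \<le> (c0 * (1 + (r + \<delta>)) ^ 2) * (k * C1)"
        using Pl(2)[of "r + \<delta>"] r0 d C1 by (intro mult_right_mono) (auto simp: Q_def)
      also have "\<dots> \<le> (c0 * ((1 + \<delta>) * (1 + r)) ^ 2) * (k * C1)"
        using r0 d C1 c0 by (intro mult_right_mono mult_left_mono power_mono) (auto simp: algebra_simps)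
      also have "\<dots> = 1 * (C2 * (1 + r) ^ 2)" by (simp add: C2_def power_mult_distrib)
      also have "\<dots> \<le> (2 * pi) * (C2 * (1 + r) ^ 2)" using C2 pi_ge_two by (intro mult_right_mono) auto
      finally show "integral {0..2*pi} (\<lambda>\<theta>. L + (\<Sum>p\<in>Q. k * G p \<theta>))
          \<le> 2 * pi * (B * (1 + r) ^ j + log_plus B + C2 * (1 + r)\<^sup>2)"
        by (simp add: L_def algebra_simps)
      fix \<theta> :: real assume \<theta>: "\<theta> \<in> {0..2*pi}"
      define z where "z = of_real r * cis \<theta>"
      have nz: "norm z = r" using r0 by (simp add: z_def norm_mult)
      have sum0: "0 \<le> (\<Sum>p\<in>Q. k * G p \<theta>)" using G0[OF \<theta>] by (intro sum_nonneg) auto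
      show "log_plus (norm (w (of_real r * cis \<theta>))) \<le> L + (\<Sum>p\<in>Q. k * G p \<theta>)"
      proof (cases "is_pole w z")
        case True
        then have "w z = 0" using w is_pole_zero_at_nicely_mero by blast
        then show ?thesis using L sum0 by (simp add: z_def log_plus_def)
      next
        case False
        from bnd[OF this] show ?thesis
        proof
          assume "norm (w z) \<le> exp (B * (1 + norm z) ^ j)"
          then have "log_plus (norm (w z)) \<le> log_plus (exp (B * (1 + norm z) ^ j))" by (intro log_plus_mono) auto
          also have "\<dots> = B * (1 + r) ^ j" using B r0 by (simp add: log_plus_def nz)
          finally show ?thesis using sum0 lp_nonneg[of B] by (simp add: L_def z_def)
        next
          assume "\<exists>p. is_pole w p \<and> norm (z - p) < \<delta> \<and> norm (w z) * norm (z - p) ^ k \<le> B"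
          then obtain p where p: "is_pole w p" "norm (z - p) < \<delta>" "norm (w z) * norm (z - p) ^ k \<le> B" by blast
          have zp: "z \<noteq> p" using p False by auto
          have "norm p \<le> norm z + norm (z - p)" using norm_triangle_sub[of p z] by (simp add: norm_minus_commute)
          then have pQ: "p \<in> Q" using p nz by (simp add: Q_def Pl_def)
          have "norm (w z) \<le> B * (1 / norm (z - p)) ^ k" using p(3) zp by (simp add: field_simps power_divide)
          then have "log_plus (norm (w z)) \<le> log_plus (B * (1 / norm (z - p)) ^ k)" by (intro log_plus_mono) auto
          also have "\<dots> \<le> log_plus B + log_plus ((1 / norm (z - p)) ^ k)" using B by (intro log_plus_mult_le) auto
          also have "log_plus ((1 / norm (z - p)) ^ k) \<le> k * log_plus (1 / norm (z - p))"
            by (intro log_plus_power_le) auto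
          also have "\<dots> \<le> k * G p \<theta>" using G(3)[OF \<theta>, of p] by (intro mult_left_mono) (auto simp: z_def)
          also have "\<dots> \<le> (\<Sum>p\<in>Q. k * G p \<theta>)"
            using pQ fQ G0[OF \<theta>] by (intro member_le_sum[of p Q "\<lambda>p. k * G p \<theta>"]) auto
          finally have "log_plus (norm (w z)) \<le> log_plus B + (\<Sum>p\<in>Q. k * G p \<theta>)" by simp
          moreover have "0 \<le> B * (1 + r) ^ j" using B r0 by simp
          ultimately show ?thesis by (simp add: L_def z_def)
        qed
      qed
    qed
  qed
  have "nevanlinna_T r w < E * (1 + r) ^ (j + 4)" if r: "r \<ge> 0" for r
  proof -
    have pw: "a * (1 + r) ^ i \<le> a * (1 + r) ^ (j + 4)" if "a \<ge> 0" "i \<le> j + 4" for a i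
      using that r by (intro mult_left_mono power_increasing) auto
    consider "r \<ge> r1" | "0 < r" "r < r1" | "r = 0" using r by linarith
    then show ?thesis
    proof cases
      case 1
      have "n0 * ln r \<le> n0 * (1 + r) ^ 1"
        using ln_le_minus_one[of r] 1 r1 by (intro mult_left_mono) auto
      then have "nevanlinna_T r w \<le> B * (1 + r) ^ j + log_plus B * (1 + r) ^ 0 + C2 * (1 + r) ^ 2
          + (D * (1 + r) ^ 3 + n0 * (1 + r) ^ 1)"
        unfolding T_eq using large[OF 1] N[OF r] by simp
      also have "\<dots> \<le> B * (1 + r) ^ (j + 4) + log_plus B * (1 + r) ^ (j + 4) + C2 * (1 + r) ^ (j + 4)
          + (D * (1 + r) ^ (j + 4) + n0 * (1 + r) ^ (j + 4))"
        using B C2 D lp_nonneg[of B] by (intro add_mono pw) auto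
      also have "\<dots> = (E - log_plus B1 - log_plus (norm (w 0)) - 1) * (1 + r) ^ (j + 4)"
        by (simp add: E_def algebra_simps)
      also have "\<dots> < E * (1 + r) ^ (j + 4)"
        using r lp_nonneg[of B1] lp_nonneg[of "norm (w 0)"] by (intro mult_strict_right_mono) auto
      finally show ?thesis .
    next
      case 2
      have "proximity r w \<le> log_plus B1 + n0 * (- ln r)"
      proof (rule prox_const)
        fix \<theta>
        define z where "z = of_real r * cis \<theta>"
        have nz: "norm z = r" using r by (simp add: z_def norm_mult)
        have "norm (w z) \<le> B1 * (1 / r) ^ n0"
          using wB1[of z] nz 2 r1 unfolding n0[symmetric] by (auto simp: power_divide)
        then have "log_plus (norm (w z)) \<le> log_plus (B1 * (1 / r) ^ n0)" by (intro log_plus_mono) auto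
        also have "\<dots> \<le> log_plus B1 + log_plus ((1 / r) ^ n0)" using B1 2 by (intro log_plus_mult_le) auto
        also have "log_plus ((1 / r) ^ n0) \<le> n0 * log_plus (1 / r)" using 2 by (intro log_plus_power_le) auto
        also have "log_plus (1 / r) = - ln r" using 2 r1 by (simp add: log_plus_def ln_div)
        finally show "log_plus (norm (w (of_real r * cis \<theta>))) \<le> log_plus B1 + n0 * (- ln r)" by (simp add: z_def)
      qed
      then have "nevanlinna_T r w \<le> log_plus B1 * (1 + r) ^ 0 + D * (1 + r) ^ 3" unfolding T_eq using N[OF r] by simp
      also have "\<dots> \<le> log_plus B1 * (1 + r) ^ (j + 4) + D * (1 + r) ^ (j + 4)"
        using D lp_nonneg by (intro add_mono pw) auto
      also have "\<dots> = (log_plus B1 + D) * (1 + r) ^ (j + 4)" by (simp add: algebra_simps)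
      also have "\<dots> < E * (1 + r) ^ (j + 4)"
        using r B C2 lp_nonneg[of B] lp_nonneg[of "norm (w 0)"]
        by (intro mult_strict_right_mono) (auto simp: E_def)
      finally show ?thesis .
    next
      case 3
      have "proximity r w \<le> log_plus (norm (w 0))" by (rule prox_const) (simp add: 3)
      moreover have "integral {0..r} (\<lambda>t. (n t - n0) / t) \<le> D" using N[OF r] 3 by simp
      ultimately show ?thesis
        unfolding T_eq using B C2 lp_nonneg[of B] lp_nonneg[of B1] by (simp add: 3 E_def)
    qed
  qed
  then show ?thesis using E by blast
qed

section \<open>The exponential of a function with a pole\<close>

text \<open>
  The reciprocal extends holomorphically by \<open>0\<close> and is an open map, so its image contains a
  neighbourhood of \<open>0\<close>.
\<close>

lemma pole_attains_large_values:
  fixes g :: "complex \<Rightarrow> complex"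
  assumes pole: "is_pole g p" and iso: "isolated_singularity_at g p" and e: "e > 0"
  obtains \<rho> where "\<rho> > 0" "\<And>y. norm y > \<rho> \<Longrightarrow> \<exists>z. z \<noteq> p \<and> dist z p < e \<and> g z = y"
proof -
  obtain e1 where e1: "e1 > 0" "g analytic_on ball p e1 - {p}"
    using iso unfolding isolated_singularity_at_def by blast
  obtain e2 where e2: "e2 > 0" "\<And>z. z \<noteq> p \<Longrightarrow> dist z p < e2 \<Longrightarrow> g z \<noteq> 0"
    using non_zero_neighbour_pole[OF pole] unfolding eventually_at by auto
  define d where "d = min e (min e1 e2)"
  have d: "d > 0" "d \<le> e" "d \<le> e1" "d \<le> e2" using e e1 e2 by (auto simp: d_def)
  define h where "h = (\<lambda>x. if x = p then 0 else inverse (g x))"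
  have h: "h holomorphic_on ball p d"
    unfolding h_def
  proof (rule is_pole_inverse_holomorphic[OF open_ball _ pole])
    show "g holomorphic_on ball p d - {p}"
      using e1(2) d by (intro analytic_imp_holomorphic) (auto elim: analytic_on_subset)
    show "\<forall>x\<in>ball p d - {p}. g x \<noteq> 0" using e2 d by (auto simp: dist_commute)
  qed
  have "open (h ` ball p d)"
  proof (rule open_mapping_thm[OF h])
    have "p + of_real (d / 2) \<in> ball p d" "p + of_real (d / 2) \<noteq> p" using d by (auto simp: dist_norm)
    then have "h (p + of_real (d / 2)) \<noteq> h p"
      using e2(2)[of "p + of_real (d / 2)"] d by (auto simp: h_def dist_norm)
    then show "\<not> h constant_on ball p d"
      using \<open>_ \<in> ball p d\<close> d unfolding constant_on_def by (metis centre_in_ball)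
  qed auto
  moreover have "0 \<in> h ` ball p d" using d by (auto simp: h_def image_iff)
  ultimately obtain \<eta> where \<eta>: "\<eta> > 0" "ball 0 \<eta> \<subseteq> h ` ball p d" by (meson open_contains_ball)
  show thesis
  proof (rule that[of "1 / \<eta>"])
    fix y :: complex assume y: "norm y > 1 / \<eta>"
    then have y0: "y \<noteq> 0" using \<eta>(1) by (metis divide_pos_pos less_asym norm_zero zero_less_one)
    have "inverse y \<in> ball 0 \<eta>" using y \<eta>(1) y0 by (simp add: norm_inverse inverse_eq_divide field_simps norm_divide)
    then obtain z where z: "z \<in> ball p d" "h z = inverse y" using \<eta>(2) by (metis (no_types, lifting) imageE subsetD)
    then have "z \<noteq> p" "g z = y" using y0 by (auto simp: h_def split: if_splits)
    then show "\<exists>z. z \<noteq> p \<and> dist z p < e \<and> g z = y" using z(1) d by (auto simp: dist_commute)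
  qed (use \<eta> in auto)
qed

text \<open>
  Near the pole, \<open>g\<close> takes all values \<open>c + 2 \<pi> i n\<close> with large \<open>n\<close>. So \<open>exp \<circ> g\<close> takes the value \<open>exp c\<close>
  arbitrarily close to \<open>p\<close>, for every \<open>c\<close>; two different values exclude a limit, and one excludes a pole.
\<close>

lemma exp_pole_is_essential:
  fixes g :: "complex \<Rightarrow> complex"
  assumes pole: "is_pole g p" and iso: "isolated_singularity_at g p"
  shows "\<not> not_essential (\<lambda>z. exp (g z)) p"
proof
  have freq: "\<exists>\<^sub>F z in at p. exp (g z) = exp c" for c
    unfolding frequently_at
  proof safe
    fix e :: real assume "e > 0"
    then obtain \<rho> where \<rho>: "\<rho> > 0" "\<And>y. norm y > \<rho> \<Longrightarrow> \<exists>z. z \<noteq> p \<and> dist z p < e \<and> g z = y"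
      using pole_attains_large_values[OF pole iso] by metis
    obtain n :: nat where n: "real n > \<rho> + norm c" using reals_Archimedean2 by blast
    define y where "y = c + of_real (2 * real n * pi) * \<i>"
    have "real n * 1 \<le> real n * (2 * pi)" using pi_gt3 by (intro mult_left_mono) auto
    then have "\<rho> + norm c < norm (of_real (2 * real n * pi) * \<i>)" using n by (simp add: norm_mult)
    then have "norm y > \<rho>" using norm_diff_ineq[of "of_real (2 * real n * pi) * \<i>" c] by (simp add: y_def add.commute)
    moreover have "exp y = exp c" unfolding exp_eq y_def by (intro exI[of _ "int n"]) simp
    ultimately show "\<exists>x\<in>UNIV. x \<noteq> p \<and> dist x p < e \<and> exp (g x) = exp c" using \<rho>(2)[of y] by auto
  qed
  assume "not_essential (\<lambda>z. exp (g z)) p"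
  then consider l where "(\<lambda>z. exp (g z)) \<midarrow>p\<rightarrow> l" | "is_pole (\<lambda>z. exp (g z)) p"
    unfolding not_essential_def by blast
  then show False
  proof cases
    case 1
    have "exp c = l" for c
    proof (rule ccontr)
      assume "exp c \<noteq> l"
      then have "\<forall>\<^sub>F z in at p. exp (g z) \<noteq> exp c" using tendsto_imp_eventually_ne[OF 1] by metis
      then show False using freq[of c] by (simp add: frequently_def)
    qed
    from this[of 0] this[of 1] show False by (metis exp_zero of_real_1 exp_of_real of_real_eq_iff exp_eq_one_iff zero_neq_one)
  next
    case 2
    then have "\<forall>\<^sub>F z in at p. exp (g z) \<noteq> exp 0"
      unfolding is_pole_def by (rule filterlim_at_infinity_imp_eventually_ne)
    then show False using freq[of 0] by (simp add: frequently_def)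
  qed
qed

section \<open>Entire functions with small derivative\<close>

text \<open>
  Gronwall's argument along the ray from \<open>0\<close> to \<open>z\<close>. Using the square of the modulus avoids the
  points where the modulus is not differentiable.
\<close>

lemma entire_ray_bound:
  fixes \<Phi> \<Phi>' :: "real \<Rightarrow> real"
  assumes g: "g holomorphic_on UNIV"
    and \<Phi>: "\<And>x. x \<ge> 0 \<Longrightarrow> (\<Phi> has_real_derivative \<Phi>' x) (at x)" "\<And>x. x \<ge> 0 \<Longrightarrow> \<Phi>' x \<ge> 0"
    and L: "\<And>z. 2 * \<Phi>' ((norm (g z))\<^sup>2) * (norm (g z) * norm (deriv g z)) \<le> L"
  shows "\<Phi> ((norm (g z))\<^sup>2) \<le> \<Phi> ((norm (g 0))\<^sup>2) + L * norm z"
proof -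
  define f where "f = (\<lambda>t::real. g (of_real t * z))"
  define D where "D = (\<lambda>t::real. deriv g (of_real t * z) * z)"
  have f': "(f has_vector_derivative D t) (at t)" for t
  proof -
    have "(g has_field_derivative deriv g (of_real t * z)) (at (of_real t * z))"
      using g holomorphic_derivI by blast
    moreover have "((\<lambda>t::real. of_real t * z) has_vector_derivative z) (at t)"
      by (auto intro!: derivative_eq_intros)
    ultimately have "(g \<circ> (\<lambda>t::real. of_real t * z) has_vector_derivative z * deriv g (of_real t * z)) (at t)"
      by (rule field_vector_diff_chain_at[rotated])
    then show ?thesis by (simp add: f_def D_def o_def mult.commute)
  qed
  have N': "((\<lambda>t. (norm (f t))\<^sup>2) has_real_derivative 2 * (f t \<bullet> D t)) (at t)" for t
  proof -
    have "((\<lambda>t. f t \<bullet> f t) has_derivative (\<lambda>h. f t \<bullet> (h *\<^sub>R D t) + (h *\<^sub>R D t) \<bullet> f t)) (at t)"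
      using f' by (intro has_derivative_inner) (auto simp: has_vector_derivative_def)
    then show ?thesis
      by (simp add: has_field_derivative_def power2_norm_eq_inner inner_commute mult_commute_abs algebra_simps)
  qed
  define \<psi> where "\<psi> = (\<lambda>t. \<Phi> ((norm (f t))\<^sup>2))"
  have \<psi>': "(\<psi> has_real_derivative \<Phi>' ((norm (f t))\<^sup>2) * (2 * (f t \<bullet> D t))) (at t)" for t
    unfolding \<psi>_def by (rule DERIV_chain2[OF \<Phi>(1) N']) auto
  obtain t where t: "\<psi> 1 - \<psi> 0 = (1 - 0) * (\<Phi>' ((norm (f t))\<^sup>2) * (2 * (f t \<bullet> D t)))"
    using MVT2[of 0 1 \<psi> "\<lambda>t. \<Phi>' ((norm (f t))\<^sup>2) * (2 * (f t \<bullet> D t))"] \<psi>' by auto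
  have "f t \<bullet> D t \<le> norm (f t) * norm (D t)" by (rule norm_cauchy_schwarz)
  then have "\<Phi>' ((norm (f t))\<^sup>2) * (2 * (f t \<bullet> D t)) \<le> \<Phi>' ((norm (f t))\<^sup>2) * (2 * (norm (f t) * norm (D t)))"
    using \<Phi>(2) by (intro mult_left_mono) auto
  also have "\<dots> = 2 * \<Phi>' ((norm (f t))\<^sup>2) * (norm (f t) * norm (deriv g (of_real t * z))) * norm z"
    by (simp add: D_def norm_mult)
  also have "\<dots> \<le> L * norm z"
    unfolding f_def by (intro mult_right_mono L) auto
  finally show ?thesis using t by (simp add: \<psi>_def f_def)
qed

lemma entire_exp_growth:
  assumes g: "g holomorphic_on UNIV" and K: "K \<ge> 0" "\<And>z. norm (deriv g z) \<le> K * (1 + norm (g z))"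
  shows "\<exists>B\<ge>0. \<forall>z. norm (g z) \<le> exp (B * (1 + norm z) ^ 1)"
proof -
  define B where "B = ln (1 + (norm (g 0))\<^sup>2) + 4 * K"
  have ln0: "ln (1 + (norm (g 0))\<^sup>2) \<ge> 0" by simp
  have "norm (g z) \<le> exp (B * (1 + norm z))" for z
  proof -
    have "ln (1 + (norm (g z))\<^sup>2) \<le> ln (1 + (norm (g 0))\<^sup>2) + 4 * K * norm z"
    proof (rule entire_ray_bound[where \<Phi> = "\<lambda>x. ln (1 + x)" and \<Phi>' = "\<lambda>x. 1 / (1 + x)"])
      fix z
      define x where "x = norm (g z)"
      have x: "x \<ge> 0" by (simp add: x_def)
      have "x * norm (deriv g z) \<le> x * (K * (1 + x))" using K(2)[of z] x by (simp add: mult_left_mono x_def)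
      also have "\<dots> = K * (x + x\<^sup>2)" by (simp add: power2_eq_square algebra_simps)
      also have "\<dots> \<le> K * (2 * (1 + x\<^sup>2))"
        using K(1) x zero_le_power2[of "x - 1"] by (intro mult_left_mono) (auto simp: power2_diff)
      finally have "2 * (x * norm (deriv g z)) \<le> 4 * K * (1 + x\<^sup>2)" by (simp add: algebra_simps)
      moreover have "1 + x\<^sup>2 > 0" by (simp add: add_pos_nonneg)
      ultimately show "2 * (1 / (1 + (norm (g z))\<^sup>2)) * (norm (g z) * norm (deriv g z)) \<le> 4 * K"
        unfolding x_def[symmetric] by (simp add: divide_le_eq)
    qed (use g in \<open>auto intro!: derivative_eq_intros simp: field_simps\<close>)
    also have "\<dots> \<le> B * (1 + norm z)"
      using ln0 K(1) by (simp add: B_def algebra_simps)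
    finally have "exp (ln (1 + (norm (g z))\<^sup>2)) \<le> exp (B * (1 + norm z))" by simp
    then have "1 + (norm (g z))\<^sup>2 \<le> exp (B * (1 + norm z))" by (simp add: add_pos_nonneg)
    moreover have "norm (g z) \<le> 1 + (norm (g z))\<^sup>2"
    proof -
      have "0 \<le> (norm (g z) - 1)\<^sup>2" by simp
      also have "\<dots> = 1 + (norm (g z))\<^sup>2 - 2 * norm (g z)" by (simp add: power2_diff)
      finally show ?thesis using norm_ge_zero[of "g z"] by linarith
    qed
    ultimately show ?thesis by linarith
  qed
  moreover have "B \<ge> 0" using ln0 K(1) by (simp add: B_def)
  ultimately show ?thesis by auto
qed

lemma entire_quadratic_growth:
  assumes g: "g holomorphic_on UNIV" and K: "K \<ge> 0" "\<And>z. (norm (deriv g z))\<^sup>2 \<le> K * (1 + norm (g z))"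
  shows "\<exists>C. \<forall>z. norm (g z) \<le> C * (1 + norm z) ^ 2"
proof -
  define \<Phi> where "\<Phi> = (\<lambda>x::real. (1 + x) powr (1/4))"
  define \<Phi>' where "\<Phi>' = (\<lambda>x::real. 1/4 * (1 + x) powr (-3/4))"
  define C where "C = \<Phi> ((norm (g 0))\<^sup>2) + sqrt (2 * K)"
  have bd: "\<Phi> ((norm (g z))\<^sup>2) \<le> \<Phi> ((norm (g 0))\<^sup>2) + sqrt (2 * K) * norm z" for z
  proof (rule entire_ray_bound[OF g, where \<Phi>' = \<Phi>'])
    show "(\<Phi> has_real_derivative \<Phi>' x) (at x)" if "x \<ge> 0" for x
      unfolding \<Phi>_def \<Phi>'_def using that by (auto intro!: derivative_eq_intros simp: powr_diff powr_minus field_simps)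
    fix z
    define y where "y = 1 + (norm (g z))\<^sup>2"
    have y: "y \<ge> 1" by (simp add: y_def)
    have gy: "norm (g z) \<le> y powr (1/2)"
      unfolding y_def by (simp add: powr_half_sqrt real_le_rsqrt)
    have "(norm (deriv g z))\<^sup>2 \<le> K * (2 * y powr (1/2))"
    proof -
      have "1 \<le> y powr (1/2)" using y by (intro ge_one_powr_ge_zero) auto
      then have "K * (1 + norm (g z)) \<le> K * (2 * y powr (1/2))" using gy K by (intro mult_left_mono) auto
      then show ?thesis using K(2)[of z] by linarith
    qed
    then have "norm (deriv g z) \<le> sqrt (K * (2 * y powr (1/2)))" by (rule real_le_rsqrt)
    also have "\<dots> = sqrt (2 * K) * y powr (1/4)"
      using y by (simp add: real_sqrt_mult powr_half_sqrt[symmetric] powr_powr)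
    finally have "norm (g z) * norm (deriv g z) \<le> y powr (1/2) * (sqrt (2 * K) * y powr (1/4))"
      using gy by (intro mult_mono) auto
    also have "\<dots> = sqrt (2 * K) * (y powr (1/2) * y powr (1/4))" by simp
    also have "y powr (1/2) * y powr (1/4) = y powr (3/4)" by (simp add: powr_add[symmetric])
    finally have "2 * \<Phi>' ((norm (g z))\<^sup>2) * (norm (g z) * norm (deriv g z)) \<le>
        2 * (1/4 * y powr (-3/4)) * (sqrt (2 * K) * y powr (3/4))"
      unfolding \<Phi>'_def y_def[symmetric] by (intro mult_left_mono) auto
    also have "\<dots> = sqrt (2 * K) / 2 * (y powr (-3/4) * y powr (3/4))" by simp
    also have "y powr (-3/4) * y powr (3/4) = 1" using y by (simp add: powr_add[symmetric])
    also have "sqrt (2 * K) / 2 * 1 \<le> sqrt (2 * K)" using K by simp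
    finally show "2 * \<Phi>' ((norm (g z))\<^sup>2) * (norm (g z) * norm (deriv g z)) \<le> sqrt (2 * K)" .
  qed (auto simp: \<Phi>'_def)
  have "norm (g z) \<le> C ^ 2 * (1 + norm z) ^ 2" for z
  proof -
    define y where "y = 1 + (norm (g z))\<^sup>2"
    have y: "y \<ge> 1" by (simp add: y_def)
    have \<Phi>0: "0 \<le> \<Phi> ((norm (g 0))\<^sup>2)" by (simp add: \<Phi>_def)
    have "\<Phi> ((norm (g 0))\<^sup>2) + sqrt (2 * K) * norm z \<le> C * (1 + norm z)"
      using mult_nonneg_nonneg[OF \<Phi>0 norm_ge_zero[of z]] K by (simp add: C_def algebra_simps)
    with bd[of z] have "y powr (1/4) \<le> C * (1 + norm z)" by (simp add: \<Phi>_def y_def)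
    then have "(y powr (1/4)) ^ 2 \<le> (C * (1 + norm z)) ^ 2" by (intro power_mono) auto
    moreover have "norm (g z) \<le> (y powr (1/4)) ^ 2"
    proof -
      have "norm (g z) \<le> y powr (1/2)" by (simp add: powr_half_sqrt real_le_rsqrt y_def)
      also have "\<dots> = (y powr (1/4)) ^ 2" by (simp add: power2_eq_square powr_add[symmetric])
      finally show ?thesis .
    qed
    ultimately show ?thesis by (simp add: power_mult_distrib)
  qed
  then show ?thesis by blast
qed

lemma nevanlinna_T_entire_bound:
  assumes w: "w holomorphic_on UNIV" and B: "B \<ge> 0" "\<And>z. norm (w z) \<le> exp (B * (1 + norm z) ^ j)"
  shows "\<exists>C>0. \<exists>n. \<forall>r\<ge>0. nevanlinna_T r w < C * (1 + r) ^ n"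
proof -
  have an: "w analytic_on UNIV" using w by (simp add: analytic_on_open)
  then have np: "\<not> is_pole w z" for z
    using analytic_at_imp_no_pole analytic_on_subset by blast
  have "w nicely_meromorphic_on UNIV" using an by (rule analytic_on_imp_nicely_meromorphic_on)
  from nevanlinna_T_polynomial_bound[OF this, of 1 0 B j] np B show ?thesis by simp blast
qed

section \<open>Polynomial bounds\<close>

lemma poly_norm_le:
  fixes p :: "complex poly"
  obtains K where "K > 0" "\<And>x. norm (poly p x) \<le> K * (1 + norm x) ^ degree p"
proof
  define K where "K = (\<Sum>i\<le>degree p. norm (coeff p i)) + 1"
  show "K > 0" unfolding K_def by (intro add_nonneg_pos sum_nonneg) auto
  fix x
  have "norm (poly p x) \<le> (\<Sum>i\<le>degree p. norm (coeff p i) * norm x ^ i)"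
    unfolding poly_altdef by (rule order_trans[OF norm_sum]) (simp add: norm_mult norm_power)
  also have "\<dots> \<le> (\<Sum>i\<le>degree p. norm (coeff p i) * (1 + norm x) ^ degree p)"
  proof (intro sum_mono mult_left_mono)
    fix i assume "i \<in> {..degree p}"
    have "norm x ^ i \<le> (1 + norm x) ^ i" by (intro power_mono) auto
    also have "\<dots> \<le> (1 + norm x) ^ degree p" using \<open>i \<in> _\<close> by (intro power_increasing) auto
    finally show "norm x ^ i \<le> (1 + norm x) ^ degree p" .
  qed auto
  also have "\<dots> \<le> K * (1 + norm x) ^ degree p"
    unfolding K_def sum_distrib_right[symmetric] by (simp add: algebra_simps)
  finally show "norm (poly p x) \<le> K * (1 + norm x) ^ degree p" .
qed

lemma power_le_poly_norm:
  fixes p :: "complex poly"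
  assumes "p \<noteq> 0"
  obtains K where "K > 0" "\<And>x. norm x ^ degree p \<le> K * (1 + norm (poly p x))"
proof -
  define l where "l = norm (lead_coeff p)"
  have l: "l > 0" using assms by (simp add: l_def)
  have "((\<lambda>x. norm (poly p x / x ^ degree p)) \<longlongrightarrow> l) at_infinity"
    unfolding l_def by (intro tendsto_norm poly_divide_tendsto_aux)
  then have "\<forall>\<^sub>F x in at_infinity. norm (poly p x / x ^ degree p) > l / 2"
    using l by (intro order_tendstoD) auto
  then obtain \<rho> where \<rho>: "\<And>x. norm x \<ge> \<rho> \<Longrightarrow> norm (poly p x / x ^ degree p) > l / 2"
    unfolding eventually_at_infinity by blast
  define s where "s = max \<rho> 1"
  show thesis
  proof (rule that[of "s ^ degree p + 2 / l"])
    show "s ^ degree p + 2 / l > 0" using l by (auto simp: s_def intro!: add_pos_pos)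
    fix x
    show "norm x ^ degree p \<le> (s ^ degree p + 2 / l) * (1 + norm (poly p x))"
    proof (cases "norm x \<ge> s")
      case True
      then have "norm x > 0" "norm (poly p x / x ^ degree p) > l / 2" using \<rho> by (auto simp: s_def)
      then have "norm x ^ degree p \<le> 2 / l * norm (poly p x)"
        using l by (simp add: norm_divide norm_power field_simps)
      also have "\<dots> \<le> (s ^ degree p + 2 / l) * (1 + norm (poly p x))"
        using l by (intro mult_mono) (auto simp: s_def)
      finally show ?thesis .
    next
      case False
      then have "norm x ^ degree p \<le> s ^ degree p" by (intro power_mono) auto
      also have "\<dots> = (s ^ degree p) * 1" by simp
      also have "\<dots> \<le> (s ^ degree p + 2 / l) * (1 + norm (poly p x))"
        using l by (intro mult_mono) (auto simp: s_def)
      finally show ?thesis .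
    qed
  qed
qed

section \<open>First-order equations with polynomial right-hand side\<close>

text \<open>
  The quotient \<open>w'\<^sup>2 / w\<^sup>d\<close> tends to the leading coefficient of \<open>R\<close>, so it has order \<open>0\<close> at the pole;
  with \<open>m\<close> the order of the pole this says \<open>m d = 2 (m + 1)\<close>.
\<close>

lemma pole_order_of_first_order_ode:
  assumes w: "w meromorphic_on {p}" and pole: "is_pole w p"
    and ode: "\<forall>\<^sub>F z in at p. (deriv w z)\<^sup>2 = poly R (w z)"
  shows "nat (- zorder w p) * degree R = 2 * nat (- zorder w p) + 2"
proof -
  define d where "d = degree R"
  have w': "deriv w meromorphic_on {p}" using w by (rule meromorphic_on_deriv)
  have pole': "is_pole (deriv w) p" using w pole by (simp add: is_pole_deriv_iff)
  have iso: "isolated_singularity_at w p" "not_essential w p" using w by (auto simp: meromorphic_at_iff)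
  have nz: "\<exists>\<^sub>F z in at p. w z \<noteq> 0" "\<exists>\<^sub>F z in at p. deriv w z \<noteq> 0"
    using non_zero_neighbour_pole[OF pole] non_zero_neighbour_pole[OF pole']
    by (auto intro: eventually_frequently)
  have ord: "zorder w p < 0" using iso(1) pole by (rule isolated_pole_imp_neg_zorder)
  have ord': "zorder (deriv w) p = zorder w p - 1"
    using iso nz ord by (intro zorder_deriv_minus_1) auto
  have R: "R \<noteq> 0"
  proof
    assume "R = 0"
    then have "\<forall>\<^sub>F z in at p. deriv w z = 0" using ode by simp
    then show False using nz(2) by (simp add: frequently_def)
  qed
  define F where "F = (\<lambda>z. (deriv w z)\<^sup>2 / w z ^ d)"
  have "((\<lambda>z. poly R (w z) / w z ^ d) \<longlongrightarrow> lead_coeff R) (at p)"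
    using filterlim_compose[OF poly_divide_tendsto_aux[of R], of w "at p"] pole
    by (simp add: is_pole_def d_def)
  then have F: "F \<midarrow>p\<rightarrow> lead_coeff R"
    by (rule Lim_transform_eventually) (use ode in \<open>auto simp: F_def elim: eventually_mono\<close>)
  have Fm: "F meromorphic_on {p}" unfolding F_def using w w' by (intro meromorphic_intros)
  have "\<not> is_pole F p"
    using F not_tendsto_and_filterlim_at_infinity[OF at_neq_bot F] by (auto simp: is_pole_def)
  moreover have "\<not> isolated_zero F p"
    using tendsto_unique[OF at_neq_bot F] R by (metis isolated_zero_def leading_coeff_0_iff)
  moreover have "\<exists>\<^sub>F z in at p. F z \<noteq> 0"
    using tendsto_imp_eventually_ne[OF F, of 0] R by (intro eventually_frequently) auto
  ultimately have "zorder F p = 0" using Fm by (intro not_pole_not_isolated_zero_imp_zorder_eq_0)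
  moreover have "zorder F p = 2 * zorder (deriv w) p - int d * zorder w p"
  proof -
    have "\<exists>\<^sub>F z in at p. (deriv w z)\<^sup>2 \<noteq> 0" "\<exists>\<^sub>F z in at p. w z ^ d \<noteq> 0"
      using nz by (auto elim: frequently_elim1)
    then have "zorder F p = zorder (\<lambda>z. (deriv w z)\<^sup>2) p - zorder (\<lambda>z. w z ^ d) p"
      unfolding F_def using w w' by (intro zorder_divide meromorphic_intros)
    also have "\<dots> = 2 * zorder (deriv w) p - int d * zorder w p"
      using zorder_power[OF w' nz(2), of 2] zorder_power[OF w nz(1), of d] by simp
    finally show ?thesis .
  qed
  ultimately have eq: "int d * (- zorder w p) = 2 * (- zorder w p) + 2" using ord' by (simp add: algebra_simps)
  define m where "m = nat (- zorder w p)"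
  have "- zorder w p = int m" using ord by (simp add: m_def)
  then have "int (d * m) = int (2 * m + 2)" using eq by simp
  then have "d * m = 2 * m + 2" by (simp only: of_nat_eq_iff)
  then show ?thesis unfolding m_def[symmetric] d_def[symmetric] by (simp add: mult.commute)
qed

text \<open>
  A quantitative inverse function theorem: \<open>F - \<alpha> z\<close> has Lipschitz constant \<open>|\<alpha>| / 2\<close>, so \<open>F\<close> is expanding,
  and a zero of \<open>F\<close> is a fixed point of the contraction \<open>z - F z / \<alpha>\<close>.
\<close>

lemma almost_linear_map:
  fixes F :: "complex \<Rightarrow> complex"
  assumes F: "F holomorphic_on ball c \<delta>" and \<alpha>: "\<alpha> \<noteq> 0"
    and der: "\<And>z. z \<in> ball c \<delta> \<Longrightarrow> norm (deriv F z - \<alpha>) \<le> norm \<alpha> / 2"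
  shows almost_linear_map_expanding:
      "\<And>x y. x \<in> ball c \<delta> \<Longrightarrow> y \<in> ball c \<delta> \<Longrightarrow> norm \<alpha> / 2 * norm (x - y) \<le> norm (F x - F y)"
    and almost_linear_map_zero:
      "norm (F c) < norm \<alpha> * \<delta> / 2 \<Longrightarrow> \<exists>p\<in>ball c \<delta>. F p = 0"
proof -
  have lip: "norm ((F x - \<alpha> * x) - (F y - \<alpha> * y)) \<le> norm \<alpha> / 2 * norm (x - y)"
    if "x \<in> ball c \<delta>" "y \<in> ball c \<delta>" for x y
  proof (rule field_differentiable_bound[OF convex_ball[of c \<delta>] _ _ that])
    fix z assume z: "z \<in> ball c \<delta>"
    have "(F has_field_derivative deriv F z) (at z)" using F z by (meson holomorphic_derivI open_ball)
    then show "((\<lambda>z. F z - \<alpha> * z) has_field_derivative deriv F z - \<alpha>) (at z within ball c \<delta>)"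
      by (auto intro!: derivative_eq_intros intro: has_field_derivative_at_within)
  qed (rule der)
  show "norm \<alpha> / 2 * norm (x - y) \<le> norm (F x - F y)" if "x \<in> ball c \<delta>" "y \<in> ball c \<delta>" for x y
  proof -
    have "\<alpha> * (x - y) = (F x - F y) - ((F x - \<alpha> * x) - (F y - \<alpha> * y))" by (simp add: algebra_simps)
    then have "norm \<alpha> * norm (x - y) \<le> norm (F x - F y) + norm ((F x - \<alpha> * x) - (F y - \<alpha> * y))"
      by (metis norm_mult norm_triangle_ineq4)
    then show ?thesis using lip[OF that] by linarith
  qed
  assume small: "norm (F c) < norm \<alpha> * \<delta> / 2"
  \<comment> \<open>The contraction moves the centre by \<open>\<rho> / 2\<close> and halves distances, so it maps this disc to itself.\<close>
  define \<rho> where "\<rho> = 2 * norm (F c) / norm \<alpha>"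
  have \<rho>: "0 \<le> \<rho>" "\<rho> < \<delta>" "norm (F c) / norm \<alpha> = \<rho> / 2" using small \<alpha> by (auto simp: \<rho>_def field_simps)
  then have sub: "cball c \<rho> \<subseteq> ball c \<delta>" by auto
  define \<Phi> where "\<Phi> = (\<lambda>z. z - F z / \<alpha>)"
  have con: "dist (\<Phi> x) (\<Phi> y) \<le> 1 / 2 * dist x y" if "x \<in> cball c \<rho>" "y \<in> cball c \<rho>" for x y
  proof -
    have "\<Phi> x - \<Phi> y = - ((F x - \<alpha> * x) - (F y - \<alpha> * y)) / \<alpha>" using \<alpha> by (simp add: \<Phi>_def field_simps)
    then have "norm (\<Phi> x - \<Phi> y) = norm ((F x - \<alpha> * x) - (F y - \<alpha> * y)) / norm \<alpha>"
      by (metis norm_divide norm_minus_cancel)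
    also have "\<dots> \<le> (norm \<alpha> / 2 * norm (x - y)) / norm \<alpha>"
    proof (rule divide_right_mono)
      show "norm ((F x - \<alpha> * x) - (F y - \<alpha> * y)) \<le> norm \<alpha> / 2 * norm (x - y)"
        by (rule lip) (use that sub in blast)+
    qed simp
    finally show ?thesis using \<alpha> by (simp add: dist_norm)
  qed
  have "\<exists>!x\<in>cball c \<rho>. \<Phi> x = x"
  proof (rule Banach_fix[of _ "1 / 2"])
    show "\<Phi> ` cball c \<rho> \<subseteq> cball c \<rho>"
    proof safe
      fix x assume x: "x \<in> cball c \<rho>"
      have "dist c (\<Phi> x) \<le> dist c (\<Phi> c) + dist (\<Phi> c) (\<Phi> x)" by (rule dist_triangle)
      also have "\<dots> \<le> \<rho> / 2 + 1 / 2 * dist c x"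
        using con[of c x] x \<rho> by (intro add_mono) (auto simp: \<Phi>_def dist_norm norm_divide)
      finally show "\<Phi> x \<in> cball c \<rho>" using x by simp
    qed
  qed (use con \<rho> in \<open>auto simp: complete_eq_closed\<close>)
  then obtain p where "p \<in> cball c \<rho>" "\<Phi> p = p" by blast
  then show "\<exists>p\<in>ball c \<delta>. F p = 0" using sub \<alpha> by (auto simp: \<Phi>_def)
qed

lemma poly_close_at_0:
  fixes p :: "complex poly"
  assumes "e > 0"
  obtains \<eta> where "\<eta> > 0" "\<And>x. norm x \<le> \<eta> \<Longrightarrow> norm (poly p x - poly p 0) \<le> e"
proof -
  have "isCont (poly p) 0" by simp
  then obtain d where "d > 0" "\<And>x. dist x 0 < d \<Longrightarrow> dist (poly p x) (poly p 0) < e"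
    using assms unfolding continuous_at_eps_delta by blast
  note d = this
  show thesis
  proof (rule that[of "d / 2"])
    fix x :: complex assume "norm x \<le> d / 2"
    then have "dist (poly p x) (poly p 0) < e" using d by (intro d(2)) auto
    then show "norm (poly p x - poly p 0) \<le> e" by (simp add: dist_norm)
  qed (use d in simp)
qed

lemma poly_bounded_on_unit_ball:
  fixes p :: "complex poly"
  obtains K where "K \<ge> 1" "\<And>x. norm x \<le> 1 \<Longrightarrow> norm (poly p x) \<le> K"
proof -
  obtain K where K: "K > 0" "\<And>x. norm (poly p x) \<le> K * (1 + norm x) ^ degree p"
    using poly_norm_le[of p] by blast
  have "norm (poly p x) \<le> max 1 (K * 2 ^ degree p)" if "norm x \<le> 1" for x
  proof -
    have "K * (1 + norm x) ^ degree p \<le> K * 2 ^ degree p" using that K(1) by (intro mult_left_mono power_mono) auto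
    then show ?thesis using K(2)[of x] by linarith
  qed
  then show thesis using that[of "max 1 (K * 2 ^ degree p)"] by simp
qed

lemma nonpole_region:
  assumes w: "w nicely_meromorphic_on UNIV"
  shows "open {z. \<not> is_pole w z}" "connected {z. \<not> is_pole w z}"
proof -
  have mero: "w meromorphic_on UNIV" using w by (simp add: nicely_meromorphic_on_def)
  have sp: "{z. is_pole w z} sparse_in UNIV"
    using meromorphic_on_imp_not_pole_cosparse[OF mero] by (simp add: eventually_cosparse)
  have eq: "{z. \<not> is_pole w z} = UNIV - {z. is_pole w z}" by auto
  show "open {z. \<not> is_pole w z}" unfolding eq
    by (rule open_diff_sparse_pts) (use sp in auto)
  show "connected {z. \<not> is_pole w z}" unfolding eq
    by (rule sparse_imp_connected) (use sp in auto)
qed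

lemma nonpole_derivatives:
  assumes w: "w nicely_meromorphic_on UNIV" and z: "\<not> is_pole w z"
  shows "w analytic_on {z}" "(w has_field_derivative deriv w z) (at z)"
    "(deriv w has_field_derivative deriv (deriv w) z) (at z)"
proof -
  show an: "w analytic_on {z}" using w z by (intro nicely_meromorphic_on_imp_analytic_at) auto
  then show "(w has_field_derivative deriv w z) (at z)"
    using analytic_on_imp_differentiable_at field_differentiable_derivI by blast
  show "(deriv w has_field_derivative deriv (deriv w) z) (at z)"
    using analytic_deriv[OF an] analytic_on_imp_differentiable_at field_differentiable_derivI by blast
qed

text \<open>
  The setting for the reciprocal \<open>v = 1/w\<close> of a solution of \<open>w'\<^sup>2 = R(w)\<close> with \<open>T(y) = y\<^sup>4 R(1/y)\<close>. The zeros
  of \<open>v\<close> are excluded in the equation because they are the poles of \<open>w\<close>.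
\<close>

locale reciprocal_ode =
  fixes v :: "complex \<Rightarrow> complex" and T :: "complex poly"
  assumes nice: "v nicely_meromorphic_on UNIV"
    and nonconst: "\<And>c. \<exists>z. v z \<noteq> c"
    and ode: "\<And>z. \<not> is_pole v z \<Longrightarrow> v z \<noteq> 0 \<Longrightarrow> (deriv v z)\<^sup>2 = poly T (v z)"
begin

definition Reg :: "complex set" where "Reg = {z. \<not> is_pole v z}"

lemma open_Reg: "open Reg"
  unfolding Reg_def by (rule nonpole_region(1)[OF nice])

lemma holomorphic_Reg: "v holomorphic_on Reg"
proof (rule analytic_imp_holomorphic, subst analytic_on_analytic_at, intro ballI)
  show "v analytic_on {z}" if "z \<in> Reg" for z
    using that by (intro nonpole_derivatives(1)[OF nice]) (auto simp: Reg_def)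
qed

lemma eventually_neq: "\<forall>\<^sub>F x in at z. v x \<noteq> c"
proof (rule ccontr)
  assume "\<not> ?thesis"
  then have "\<exists>\<^sub>F x in at z. v x = c" by (simp add: frequently_def)
  then have "v x = c" for x by (rule frequently_eq_meromorphic_imp_constant[OF _ nice]) auto
  with nonconst[of c] show False by blast
qed

lemma eventually_Reg: "z \<in> Reg \<Longrightarrow> \<forall>\<^sub>F x in at z. x \<in> Reg"
  using open_Reg by (rule eventually_at_in_open')

lemma first_order:
  assumes "z \<in> Reg"
  shows "(deriv v z)\<^sup>2 = poly T (v z)"
proof (rule ccontr)
  define H where "H = (\<lambda>z. (deriv v z)\<^sup>2 - poly T (v z))"
  assume "(deriv v z)\<^sup>2 \<noteq> poly T (v z)"
  then have "H z \<noteq> 0" by (simp add: H_def)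
  have "continuous_on Reg H" unfolding H_def
    by (intro continuous_intros holomorphic_on_imp_continuous_on holomorphic_deriv holomorphic_Reg open_Reg)
  then have "H \<midarrow>z\<rightarrow> H z" using assms open_Reg by (simp add: continuous_on_eq_continuous_at isCont_def)
  then have "\<forall>\<^sub>F x in at z. H x \<noteq> 0" using \<open>H z \<noteq> 0\<close> by (rule tendsto_imp_eventually_ne)
  with eventually_Reg[OF assms] eventually_neq[of 0 z] have "\<forall>\<^sub>F x in at z. False"
    by eventually_elim (simp add: ode H_def Reg_def)
  then show False by simp
qed

text \<open>
  Differentiating the equation gives this up to a factor \<open>v'\<close>. If it failed at a point, it would fail
  nearby, so \<open>v'\<close> would vanish on a disc.
\<close>

lemma second_order:
  assumes "z \<in> Reg"
  shows "deriv (deriv v) z = poly (pderiv T) (v z) / 2"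
proof (rule ccontr)
  define H where "H = (\<lambda>z. 2 * deriv (deriv v) z - poly (pderiv T) (v z))"
  assume "\<not> ?thesis"
  then have "H z \<noteq> 0" by (auto simp: H_def field_simps)
  have v'H: "deriv v x * H x = 0" if x: "x \<in> Reg" for x
  proof -
    have d1: "(v has_field_derivative deriv v x) (at x)"
      using holomorphic_Reg open_Reg x by (rule holomorphic_derivI)
    have d2: "(deriv v has_field_derivative deriv (deriv v) x) (at x)"
      using holomorphic_deriv[OF holomorphic_Reg open_Reg] open_Reg x by (rule holomorphic_derivI)
    have "((\<lambda>z. (deriv v z)\<^sup>2) has_field_derivative 2 * deriv v x * deriv (deriv v) x) (at x)"
      using d2 by (auto intro!: derivative_eq_intros)
    moreover have "((\<lambda>z. poly T (v z)) has_field_derivative poly (pderiv T) (v x) * deriv v x) (at x)"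
      by (rule DERIV_chain2[OF poly_DERIV d1])
    then have "((\<lambda>z. (deriv v z)\<^sup>2) has_field_derivative poly (pderiv T) (v x) * deriv v x) (at x)"
      by (rule has_field_derivative_transform_within_open[OF _ open_Reg x]) (simp add: first_order)
    ultimately have "2 * deriv v x * deriv (deriv v) x = poly (pderiv T) (v x) * deriv v x"
      by (rule DERIV_unique)
    then show ?thesis by (simp add: H_def algebra_simps)
  qed
  have "continuous_on Reg H" unfolding H_def
    by (intro continuous_intros holomorphic_on_imp_continuous_on holomorphic_deriv holomorphic_Reg open_Reg)
  then have "continuous (at z) H" using assms open_Reg by (simp add: continuous_on_eq_continuous_at)
  then obtain e1 where e1: "e1 > 0" "\<And>x. dist z x < e1 \<Longrightarrow> H x \<noteq> 0"
    using continuous_at_avoid[of z H 0] \<open>H z \<noteq> 0\<close> by blast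
  obtain e2 where e2: "e2 > 0" "ball z e2 \<subseteq> Reg" using assms open_Reg open_contains_ball by blast
  define e where "e = min e1 e2"
  have e: "e > 0" "ball z e \<subseteq> Reg" "\<And>x. x \<in> ball z e \<Longrightarrow> H x \<noteq> 0" using e1 e2 by (auto simp: e_def)
  have "\<exists>c. \<forall>x\<in>ball z e. v x = c"
  proof (rule has_field_derivative_zero_constant[OF convex_ball])
    fix x assume x: "x \<in> ball z e"
    then have "deriv v x = 0" using v'H[of x] e by auto
    then show "(v has_field_derivative 0) (at x within ball z e)"
      using holomorphic_derivI[OF holomorphic_Reg open_Reg, of x] x e by (auto intro: has_field_derivative_at_within)
  qed
  then obtain c where c: "\<And>x. x \<in> ball z e \<Longrightarrow> v x = c" by blast
  have "\<forall>\<^sub>F x in at z. x \<in> ball z e" using e(1) by (intro eventually_at_in_open') auto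
  with eventually_neq[of c z] have "\<forall>\<^sub>F x in at z. False" by eventually_elim (use c in auto)
  then show False by simp
qed

text \<open>
  As long as \<open>|v| < 1\<close>, the equation gives \<open>|v'| \<le> K\<close>. So from a value of modulus at most \<open>1/2\<close>
  it takes a distance of at least \<open>1/(2K)\<close> to leave the unit disc, and there is no pole within that distance.
\<close>

lemma stays_small:
  assumes K: "K > 0" "\<And>x. norm x \<le> 1 \<Longrightarrow> norm (poly T x) \<le> K\<^sup>2"
    and c: "c \<in> Reg" "norm (v c) \<le> 1 / 2" and z: "z \<in> ball c (1 / (2 * K))"
  shows "z \<in> Reg \<and> norm (v z) < 1 \<and> norm (v z - v c) \<le> K * norm (z - c)"
proof -
  define G where "G = {z \<in> Reg. norm (v z) < 1}"
  have cont: "continuous_on Reg v" using holomorphic_Reg by (rule holomorphic_on_imp_continuous_on)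
  have openG: "open G"
  proof -
    have "open (Reg \<inter> v -` ball 0 1)" using cont open_Reg by (intro continuous_open_preimage) auto
    also have "Reg \<inter> v -` ball 0 1 = G" by (auto simp: G_def)
    finally show ?thesis .
  qed
  have der: "norm (deriv v x) \<le> K" if "x \<in> G" for x
  proof -
    have "norm (deriv v x) ^ 2 = norm (poly T (v x))" using first_order[of x] that
      by (metis (no_types, lifting) G_def mem_Collect_eq norm_power)
    also have "\<dots> \<le> K\<^sup>2" using that K(2) by (simp add: G_def)
    finally show ?thesis by (rule power2_le_imp_le) (use K(1) in simp)
  qed
  have lip: "norm (v x - v c) \<le> K * norm (x - c)" if "closed_segment c x \<subseteq> G" for x
  proof (rule field_differentiable_bound[OF convex_closed_segment])
    fix y assume "y \<in> closed_segment c x"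
    then have "y \<in> G" using that by blast
    then show "(v has_field_derivative deriv v y) (at y within closed_segment c x)"
      using holomorphic_derivI[OF holomorphic_Reg open_Reg, of y]
      by (auto simp: G_def intro: has_field_derivative_at_within)
    show "norm (deriv v y) \<le> K" using \<open>y \<in> G\<close> by (rule der)
  qed auto
  define q where "q = 1 / 2 + K * norm (z - c)"
  have q: "q < 1" using z K(1) by (simp add: q_def dist_norm norm_minus_commute field_simps)
  define \<gamma> where "\<gamma> = (\<lambda>t::real. c + of_real t * (z - c))"
  define Bad where "Bad = {t \<in> {0..1}. \<gamma> t \<notin> G}"
  \<comment> \<open>Otherwise there is a first bad point \<open>\<gamma> s\<close> on the segment; before it \<open>|v| \<le> q < 1\<close>, while
    near it \<open>|v| > q\<close>, whether it is a pole or a point with \<open>|v| \<ge> 1\<close>.\<close>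
  have "Bad = {}"
  proof (rule ccontr)
    assume "Bad \<noteq> {}"
    have "closed Bad"
    proof -
      have "closed ({0..1} \<inter> \<gamma> -` (- G))"
        using openG unfolding \<gamma>_def by (intro continuous_closed_preimage continuous_intros) auto
      also have "{0..1} \<inter> \<gamma> -` (- G) = Bad" by (auto simp: Bad_def)
      finally show ?thesis .
    qed
    moreover have "bounded Bad" by (rule bounded_subset[of "{0..1}"]) (auto simp: Bad_def)
    ultimately obtain s where s: "s \<in> Bad" "\<And>t. t \<in> Bad \<Longrightarrow> s \<le> t"
      using compact_attains_inf[of Bad] \<open>Bad \<noteq> {}\<close> by (auto simp: compact_eq_bounded_closed)
    have "c \<in> G" using c by (auto simp: G_def)
    then have "s \<noteq> 0" using s(1) by (auto simp: Bad_def \<gamma>_def)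
    then have s01: "0 < s" "s \<le> 1" "\<gamma> s \<notin> G" using s(1) by (auto simp: Bad_def)
    have le_q: "\<gamma> t \<in> Reg \<and> norm (v (\<gamma> t)) \<le> q" if t: "0 \<le> t" "t < s" for t
    proof -
      have seg: "closed_segment c (\<gamma> t) \<subseteq> G"
      proof
        fix y assume "y \<in> closed_segment c (\<gamma> t)"
        then obtain u where u: "0 \<le> u" "u \<le> 1" "y = (1 - u) *\<^sub>R c + u *\<^sub>R \<gamma> t"
          by (auto simp: in_segment)
        then have "y = \<gamma> (u * t)" by (simp add: \<gamma>_def scaleR_conv_of_real algebra_simps)
        moreover have "u * t < s" "0 \<le> u * t" using u t mult_left_le_one_le[of t u] by auto
        ultimately show "y \<in> G" using s(2)[of "u * t"] s01 by (fastforce simp: Bad_def)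
      qed
      have "norm (v (\<gamma> t)) \<le> norm (v c) + norm (v (\<gamma> t) - v c)"
        using norm_triangle_sub[of "v (\<gamma> t)" "v c"] by simp
      also have "norm (v (\<gamma> t) - v c) \<le> K * norm (\<gamma> t - c)" by (rule lip[OF seg])
      also have "norm (\<gamma> t - c) \<le> norm (z - c)"
        using t s01 by (simp add: \<gamma>_def norm_mult mult_left_le_one_le)
      finally have "norm (v (\<gamma> t)) \<le> q" using c K(1) by (simp add: q_def mult_left_mono)
      moreover have "\<gamma> t \<in> G" using seg by auto
      ultimately show ?thesis by (simp add: G_def)
    qed
    have "z \<noteq> c" using s01 \<open>c \<in> G\<close> by (auto simp: \<gamma>_def)
    have "\<forall>\<^sub>F x in at (\<gamma> s). norm (v x) > q"
    proof (cases "is_pole v (\<gamma> s)")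
      case True
      then show ?thesis unfolding is_pole_def filterlim_at_infinity_conv_norm_at_top
        by (simp add: filterlim_at_top_dense)
    next
      case False
      then have r: "\<gamma> s \<in> Reg" by (simp add: Reg_def)
      then have "(\<lambda>x. norm (v x)) \<midarrow>\<gamma> s\<rightarrow> norm (v (\<gamma> s))"
        using cont open_Reg by (intro tendsto_norm) (simp add: continuous_on_eq_continuous_at isCont_def)
      moreover have "norm (v (\<gamma> s)) > q" using r s01 q by (auto simp: G_def)
      ultimately show ?thesis by (rule order_tendstoD)
    qed
    then obtain e where e: "e > 0" "\<And>x. x \<noteq> \<gamma> s \<Longrightarrow> dist x (\<gamma> s) < e \<Longrightarrow> norm (v x) > q"
      unfolding eventually_at by auto
    define h where "h = min s (e / (2 * norm (z - c)))"
    have h: "h > 0" "h \<le> s" using s01 e \<open>z \<noteq> c\<close> by (auto simp: h_def)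
    have diff: "\<gamma> (s - h) - \<gamma> s = - of_real h * (z - c)" by (simp add: \<gamma>_def algebra_simps)
    have "dist (\<gamma> (s - h)) (\<gamma> s) = h * norm (z - c)" using h by (simp add: dist_norm diff norm_mult)
    also have "\<dots> \<le> e / (2 * norm (z - c)) * norm (z - c)" by (intro mult_right_mono) (auto simp: h_def)
    also have "\<dots> < e" using e \<open>z \<noteq> c\<close> by simp
    finally have "dist (\<gamma> (s - h)) (\<gamma> s) < e" .
    moreover have "\<gamma> (s - h) - \<gamma> s \<noteq> 0" unfolding diff using h \<open>z \<noteq> c\<close> by simp
    ultimately have "norm (v (\<gamma> (s - h))) > q" using e(2)[of "\<gamma> (s - h)"] by auto
    then show False using le_q[of "s - h"] h by auto
  qed
  have "closed_segment c z \<subseteq> G"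
  proof
    fix y assume "y \<in> closed_segment c z"
    then obtain u where u: "0 \<le> u" "u \<le> 1" "y = (1 - u) *\<^sub>R c + u *\<^sub>R z" by (auto simp: in_segment)
    then have "y = \<gamma> u" by (simp add: \<gamma>_def scaleR_conv_of_real algebra_simps)
    then show "y \<in> G" using \<open>Bad = {}\<close> u by (auto simp: Bad_def)
  qed
  then show ?thesis using lip[of z] by (auto simp: G_def)
qed

text \<open>
  In terms of \<open>w = 1/v\<close>: wherever \<open>|w| \<ge> 1/\<eta>\<close> there is a pole \<open>p\<close> within distance \<open>\<delta>\<close> with
  \<open>|w| \<le> B |z - p|\<^sup>-\<^sup>k\<close>, and the poles are separated by \<open>\<delta>\<close>.
\<close>

definition zeros_controlled :: "nat \<Rightarrow> bool" where
  "zeros_controlled k \<longleftrightarrow> (\<exists>\<delta>>0. \<exists>\<eta>>0. \<exists>B\<ge>0.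
     (\<forall>z\<in>Reg. norm (v z) \<le> \<eta> \<longrightarrow>
        (\<exists>p\<in>Reg. v p = 0 \<and> norm (z - p) < \<delta> \<and> norm (z - p) ^ k \<le> B * norm (v z))) \<and>
     (\<forall>p\<in>Reg. \<forall>q\<in>Reg. v p = 0 \<longrightarrow> v q = 0 \<longrightarrow> p \<noteq> q \<longrightarrow> \<delta> \<le> norm (p - q)))"

lemma zeros_controlledI:
  assumes "\<delta> > 0" "\<eta> > 0" "B \<ge> 0"
    and "\<And>z. z \<in> Reg \<Longrightarrow> norm (v z) \<le> \<eta> \<Longrightarrow>
      \<exists>p\<in>Reg. v p = 0 \<and> norm (z - p) < \<delta> \<and> norm (z - p) ^ k \<le> B * norm (v z)"
    and "\<And>p q. p \<in> Reg \<Longrightarrow> q \<in> Reg \<Longrightarrow> v p = 0 \<Longrightarrow> v q = 0 \<Longrightarrow> p \<noteq> q \<Longrightarrow> \<delta> \<le> norm (p - q)"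
  shows "zeros_controlled k"
  unfolding zeros_controlled_def using assms by blast

lemma bounds_on_unit_disc:
  obtains K where "K \<ge> 1" "\<And>x. norm x \<le> 1 \<Longrightarrow> norm (poly T x) \<le> K\<^sup>2"
    "\<And>x. norm x \<le> 1 \<Longrightarrow> norm (poly (pderiv T) x / 2) \<le> K"
proof -
  obtain K1 where K1: "K1 \<ge> 1" "\<And>x. norm x \<le> 1 \<Longrightarrow> norm (poly T x) \<le> K1"
    using poly_bounded_on_unit_ball[of T] by blast
  obtain K2 where K2: "K2 \<ge> 1" "\<And>x. norm x \<le> 1 \<Longrightarrow> norm (poly (pderiv T) x) \<le> K2"
    using poly_bounded_on_unit_ball[of "pderiv T"] by blast
  define K where "K = max K1 K2"
  have K: "K \<ge> 1" "K1 \<le> K" "K2 \<le> K" using K1 by (auto simp: K_def)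
  have "K * 1 \<le> K * K" using K by (intro mult_left_mono) auto
  then have KK: "K \<le> K\<^sup>2" by (simp add: power2_eq_square)
  show thesis
  proof (rule that[of K])
    fix x :: complex assume "norm x \<le> 1"
    then show "norm (poly T x) \<le> K\<^sup>2" "norm (poly (pderiv T) x / 2) \<le> K"
      using K1(2)[of x] K2(2)[of x] K KK norm_ge_zero[of "poly (pderiv T) x"]
      by (auto simp: norm_divide intro: order_trans)
  qed (use K in auto)
qed

text \<open>
  Where \<open>v\<close> is small, \<open>v'\<close> is bounded away from \<open>0\<close> because \<open>T(0) \<noteq> 0\<close>, and \<open>v''\<close> is bounded; so \<open>v\<close> is
  almost linear on a disc of fixed radius.
\<close>

lemma zeros_controlled_simple:
  assumes T0: "poly T 0 \<noteq> 0"
  shows "zeros_controlled 1"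
proof -
  obtain K where K: "K \<ge> 1" "\<And>x. norm x \<le> 1 \<Longrightarrow> norm (poly T x) \<le> K\<^sup>2"
    "\<And>x. norm x \<le> 1 \<Longrightarrow> norm (poly (pderiv T) x / 2) \<le> K" using bounds_on_unit_disc by blast
  have K0: "K > 0" using K by simp
  define a where "a = norm (poly T 0)"
  have a: "a > 0" using T0 by (simp add: a_def)
  define \<beta> where "\<beta> = sqrt (a / 2)"
  have \<beta>: "\<beta> > 0" "\<beta>\<^sup>2 = a / 2" using a by (auto simp: \<beta>_def)
  obtain \<eta>0 where \<eta>0: "\<eta>0 > 0" "\<And>x. norm x \<le> \<eta>0 \<Longrightarrow> norm (poly T x - poly T 0) \<le> a / 2"
    using poly_close_at_0[of "a / 2" T] a by auto
  define \<delta> where "\<delta> = min (1 / (2 * K)) (\<beta> / (2 * K))"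
  have \<delta>: "\<delta> > 0" "\<delta> \<le> 1 / (2 * K)" "\<delta> \<le> \<beta> / (2 * K)" using K0 \<beta> by (auto simp: \<delta>_def)
  define \<eta> where "\<eta> = min (min \<eta>0 (1 / 2)) (\<beta> * \<delta> / 4)"
  have \<eta>: "\<eta> > 0" "\<eta> \<le> \<eta>0" "\<eta> \<le> 1 / 2" "\<eta> \<le> \<beta> * \<delta> / 4" using \<eta>0 \<beta> \<delta> by (auto simp: \<eta>_def)
  have loc: "ball c \<delta> \<subseteq> Reg \<and> \<beta> \<le> norm (deriv v c) \<and> v holomorphic_on ball c \<delta> \<and>
      (\<forall>z\<in>ball c \<delta>. norm (deriv v z - deriv v c) \<le> norm (deriv v c) / 2)"
    if c: "c \<in> Reg" "norm (v c) \<le> \<eta>" for c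
  proof -
    have c2: "norm (v c) \<le> 1 / 2" using c \<eta> by simp
    have st: "z \<in> Reg \<and> norm (v z) < 1" if "z \<in> ball c \<delta>" for z
      using stays_small[OF K0 K(2) c(1) c2, of z] that \<delta> by auto
    have "a / 2 \<le> norm (poly T (v c))"
      using \<eta>0(2)[of "v c"] c \<eta> norm_triangle_sub[of "poly T 0" "poly T (v c)"]
      by (simp add: a_def norm_minus_commute)
    also have "\<dots> = (norm (deriv v c))\<^sup>2" using first_order[OF c(1)] by (simp add: norm_power[symmetric])
    finally have \<beta>le: "\<beta> \<le> norm (deriv v c)" unfolding \<beta>(2)[symmetric] by (rule power2_le_imp_le) simp
    have "norm (deriv v z - deriv v c) \<le> norm (deriv v c) / 2" if z: "z \<in> ball c \<delta>" for z
    proof -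
      have zc: "norm (z - c) \<le> \<beta> / (2 * K)"
      proof -
        have "norm (z - c) < \<delta>" using z by (simp add: dist_norm norm_minus_commute)
        then show ?thesis using \<delta>(3) by linarith
      qed
      have "norm (deriv v z - deriv v c) \<le> K * norm (z - c)"
      proof (rule field_differentiable_bound[OF convex_ball[of c \<delta>] _ _ z])
        fix y assume y: "y \<in> ball c \<delta>"
        show "(deriv v has_field_derivative deriv (deriv v) y) (at y within ball c \<delta>)"
          using holomorphic_derivI[OF holomorphic_deriv[OF holomorphic_Reg open_Reg] open_Reg, of y] st[OF y]
          by (auto intro: has_field_derivative_at_within)
        show "norm (deriv (deriv v) y) \<le> K"
        proof -
          have "norm (poly (pderiv T) (v y) / 2) \<le> K" using st[OF y] by (intro K(3)) simp
          moreover have "deriv (deriv v) y = poly (pderiv T) (v y) / 2" using st[OF y] by (intro second_order) simp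
          ultimately show ?thesis by (simp only:)
        qed
      qed (use \<delta>(1) in simp)
      also have "\<dots> \<le> K * (\<beta> / (2 * K))" by (rule mult_left_mono[OF zc]) (use K0 in simp)
      also have "\<dots> = \<beta> / 2" using K0 by simp
      finally show ?thesis using \<beta>le by simp
    qed
    then show ?thesis using st \<beta>le holomorphic_on_subset[OF holomorphic_Reg, of "ball c \<delta>"] by blast
  qed
  show ?thesis
  proof (rule zeros_controlledI[of \<delta> \<eta> "2 / \<beta>"])
    fix z assume z: "z \<in> Reg" "norm (v z) \<le> \<eta>"
    note L = loc[OF z]
    have "norm (deriv v z) > 0" using L \<beta>(1) by linarith
    then have ne: "deriv v z \<noteq> 0" by simp
    have "0 < \<beta> * \<delta>" using \<beta>(1) \<delta>(1) by simp
    then have "norm (v z) < \<beta> * \<delta> / 2" using z(2) \<eta>(4) by linarith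
    also have "\<dots> \<le> norm (deriv v z) * \<delta> / 2" using L \<delta> by (intro divide_right_mono mult_right_mono) auto
    finally obtain p where p: "p \<in> ball z \<delta>" "v p = 0"
      using almost_linear_map_zero[of v z \<delta> "deriv v z"] L ne by blast
    have "norm (deriv v z) / 2 * norm (z - p) \<le> norm (v z - v p)"
      using almost_linear_map_expanding[of v z \<delta> "deriv v z" z p] L ne p \<delta> by auto
    moreover have "\<beta> / 2 * norm (z - p) \<le> norm (deriv v z) / 2 * norm (z - p)"
      using L by (intro mult_right_mono) auto
    ultimately have "\<beta> / 2 * norm (z - p) \<le> norm (v z)" using p by simp
    then have "norm (z - p) \<le> 2 / \<beta> * norm (v z)" using \<beta> by (simp add: field_simps)
    then show "\<exists>p\<in>Reg. v p = 0 \<and> norm (z - p) < \<delta> \<and> norm (z - p) ^ 1 \<le> 2 / \<beta> * norm (v z)"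
      using p L by (intro bexI[of _ p]) (auto simp: dist_norm)
  next
    fix p q assume pq: "p \<in> Reg" "q \<in> Reg" "v p = 0" "v q = 0" "p \<noteq> q"
    show "\<delta> \<le> norm (p - q)"
    proof (rule ccontr)
      assume "\<not> \<delta> \<le> norm (p - q)"
      then have q: "p \<in> ball p \<delta>" "q \<in> ball p \<delta>" using \<delta>(1) by (auto simp: dist_norm)
      have "norm (v p) \<le> \<eta>" using pq(3) \<eta>(1) by simp
      note L = loc[OF pq(1) this]
      have ne: "norm (deriv v p) > 0" using L \<beta>(1) by linarith
      then have "norm (deriv v p) / 2 * norm (p - q) \<le> norm (v p - v q)"
        using almost_linear_map_expanding[of v p \<delta> "deriv v p" p q] L q by auto
      then have "norm (deriv v p) / 2 * norm (p - q) \<le> 0" by (simp add: pq)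
      then show False using ne pq(5) by (simp add: mult_le_0_iff)
    qed
  qed (use \<delta> \<eta> \<beta> in auto)
qed

text \<open>
  Now \<open>T\<close> has a simple zero at \<open>0\<close>, and \<open>v\<close> has double zeros. Where \<open>v\<close> is small, \<open>v'' = T'(v)/2\<close> is
  close to \<open>T'(0)/2 \<noteq> 0\<close>, so it is \<open>v'\<close> that is almost linear. The zeros of \<open>v'\<close> found in this way are
  zeros of \<open>v\<close> by the equation, and \<open>|v'|\<^sup>2 \<le> K |v|\<close> turns the lower bound on \<open>|v'|\<close> into one on \<open>|v|\<close>.
\<close>

lemma zeros_controlled_double:
  assumes T: "T = [:0, 1:] * S" and S0: "poly S 0 \<noteq> 0"
  shows "zeros_controlled 2"
proof -
  obtain K1 where K1: "K1 \<ge> 1" "\<And>x. norm x \<le> 1 \<Longrightarrow> norm (poly T x) \<le> K1\<^sup>2"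
    "\<And>x. norm x \<le> 1 \<Longrightarrow> norm (poly (pderiv T) x / 2) \<le> K1"
    using bounds_on_unit_disc by blast
  obtain K2 where K2: "K2 \<ge> 1" "\<And>x. norm x \<le> 1 \<Longrightarrow> norm (poly S x) \<le> K2"
    using poly_bounded_on_unit_ball[of S] by blast
  define K where "K = max K1 K2"
  have K0: "K > 0" using K1 by (simp add: K_def)
  have K: "norm (poly T x) \<le> K\<^sup>2" "norm (poly S x) \<le> K" if "norm x \<le> 1" for x
  proof -
    have "K1\<^sup>2 \<le> K\<^sup>2" using K1 by (intro power_mono) (auto simp: K_def)
    then show "norm (poly T x) \<le> K\<^sup>2" "norm (poly S x) \<le> K"
      using K1(2)[OF that] K2(2)[OF that] by (auto simp: K_def)
  qed
  define \<alpha> where "\<alpha> = poly S 0 / 2"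
  have \<alpha>: "\<alpha> \<noteq> 0" "norm \<alpha> > 0" using S0 by (auto simp: \<alpha>_def)
  have T'0: "poly (pderiv T) 0 = 2 * \<alpha>" unfolding T pderiv_mult by (simp add: pderiv_pCons \<alpha>_def)
  obtain \<eta>1 where \<eta>1: "\<eta>1 > 0" "\<And>x. norm x \<le> \<eta>1 \<Longrightarrow> norm (poly (pderiv T) x - poly (pderiv T) 0) \<le> norm \<alpha>"
    using poly_close_at_0[of "norm \<alpha>" "pderiv T"] \<alpha> by auto
  obtain \<eta>2 where \<eta>2: "\<eta>2 > 0" "\<And>x. norm x \<le> \<eta>2 \<Longrightarrow> norm (poly S x - poly S 0) \<le> norm \<alpha>"
    using poly_close_at_0[of "norm \<alpha>" S] \<alpha> by auto
  define e0 where "e0 = min (min \<eta>1 \<eta>2) 1"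
  have e0: "e0 > 0" "e0 \<le> \<eta>1" "e0 \<le> \<eta>2" "e0 \<le> 1" using \<eta>1 \<eta>2 by (auto simp: e0_def)
  define \<delta> where "\<delta> = e0 / (2 * K)"
  have \<delta>: "\<delta> > 0" "\<delta> \<le> 1 / (2 * K)" using K0 e0 by (auto simp: \<delta>_def divide_right_mono)
  define \<eta> where "\<eta> = min (e0 / 2) ((norm \<alpha> * \<delta> / 2)\<^sup>2 / (2 * K))"
  have sq: "(norm \<alpha> * \<delta> / 2)\<^sup>2 > 0" using \<alpha> \<delta> by (intro zero_less_power) simp
  have \<eta>: "\<eta> > 0" "\<eta> \<le> e0 / 2" "\<eta> \<le> (norm \<alpha> * \<delta> / 2)\<^sup>2 / (2 * K)" using e0 sq K0 by (auto simp: \<eta>_def)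
  have S_ne: "poly S x \<noteq> 0" if "norm x \<le> e0" for x
  proof
    assume "poly S x = 0"
    then have "norm (2 * \<alpha>) \<le> norm \<alpha>" using \<eta>2(2)[of x] that e0 by (simp add: \<alpha>_def)
    then show False using \<alpha> by (simp add: norm_mult)
  qed
  have loc: "ball c \<delta> \<subseteq> Reg \<and> deriv v holomorphic_on ball c \<delta> \<and>
      (\<forall>z\<in>ball c \<delta>. norm (v z) \<le> e0 \<and> norm (deriv (deriv v) z - \<alpha>) \<le> norm \<alpha> / 2)"
    if c: "c \<in> Reg" "norm (v c) \<le> \<eta>" for c
  proof -
    have c2: "norm (v c) \<le> 1 / 2" using c \<eta> e0 by simp
    have st: "z \<in> Reg \<and> norm (v z) \<le> e0" if z: "z \<in> ball c \<delta>" for z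
    proof -
      have "z \<in> Reg" "norm (v z - v c) \<le> K * norm (z - c)"
        using stays_small[OF K0 K(1) c(1) c2, of z] z \<delta> by auto
      moreover have "K * norm (z - c) \<le> K * \<delta>"
        by (rule mult_left_mono) (use z K0 in \<open>simp_all add: dist_norm norm_minus_commute\<close>)
      moreover have "K * \<delta> = e0 / 2" using K0 by (simp add: \<delta>_def)
      ultimately show ?thesis using c \<eta> norm_triangle_sub[of "v z" "v c"] by simp
    qed
    have "norm (deriv (deriv v) z - \<alpha>) \<le> norm \<alpha> / 2" if z: "z \<in> ball c \<delta>" for z
    proof -
      have "deriv (deriv v) z - \<alpha> = (poly (pderiv T) (v z) - poly (pderiv T) 0) / 2"
        using st[OF z] second_order[of z] by (simp add: T'0 diff_divide_distrib)
      moreover have "norm (poly (pderiv T) (v z) - poly (pderiv T) 0) \<le> norm \<alpha>"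
        using \<eta>1(2)[of "v z"] st[OF z] e0 by simp
      ultimately show ?thesis by (simp only: norm_divide) simp
    qed
    moreover have "deriv v holomorphic_on ball c \<delta>"
      using st by (intro holomorphic_on_subset[OF holomorphic_deriv[OF holomorphic_Reg open_Reg]]) auto
    ultimately show ?thesis using st by blast
  qed
  have v': "(norm (deriv v z))\<^sup>2 \<le> K * norm (v z)" if "z \<in> Reg" "norm (v z) \<le> 1" for z
  proof -
    have "(norm (deriv v z))\<^sup>2 = norm (v z) * norm (poly S (v z))"
      using first_order[OF that(1)] by (simp add: norm_power[symmetric] T norm_mult)
    also have "\<dots> \<le> norm (v z) * K" using K(2)[OF that(2)] by (intro mult_left_mono) auto
    finally show ?thesis by (simp add: mult.commute)
  qed
  have v'0: "deriv v z = 0 \<longleftrightarrow> v z = 0" if "z \<in> Reg" "norm (v z) \<le> e0" for z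
  proof -
    have "(deriv v z)\<^sup>2 = v z * poly S (v z)" using first_order[OF that(1)] by (simp add: T)
    then show ?thesis using S_ne[OF that(2)] by (metis mult_eq_0_iff power2_eq_square)
  qed
  show ?thesis
  proof (rule zeros_controlledI[of \<delta> \<eta> "4 * K / (norm \<alpha>)\<^sup>2"])
    fix z assume z: "z \<in> Reg" "norm (v z) \<le> \<eta>"
    note L = loc[OF z]
    have z1: "norm (v z) \<le> 1" using z \<eta> e0 by simp
    have "(norm (deriv v z))\<^sup>2 \<le> K * \<eta>"
      using v'[OF z(1) z1] z K0 by (meson mult_left_mono less_imp_le order_trans)
    also have "\<dots> \<le> K * ((norm \<alpha> * \<delta> / 2)\<^sup>2 / (2 * K))" using \<eta> K0 by (intro mult_left_mono) auto
    also have "\<dots> < (norm \<alpha> * \<delta> / 2)\<^sup>2" using K0 sq by simp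
    finally have "norm (deriv v z) < norm \<alpha> * \<delta> / 2" by (rule power2_less_imp_less) (use \<delta> in auto)
    then obtain p where p: "p \<in> ball z \<delta>" "deriv v p = 0"
      using almost_linear_map_zero[of "deriv v" z \<delta> \<alpha>] L \<alpha> by blast
    then have vp: "p \<in> Reg" "v p = 0" using v'0[of p] L by blast+
    have "norm \<alpha> / 2 * norm (z - p) \<le> norm (deriv v z - deriv v p)"
      using almost_linear_map_expanding[of "deriv v" z \<delta> \<alpha> z p] L \<alpha> p \<delta> by auto
    then have "(norm \<alpha> / 2 * norm (z - p))\<^sup>2 \<le> (norm (deriv v z))\<^sup>2" using p by (intro power_mono) auto
    also have "\<dots> \<le> K * norm (v z)" by (rule v'[OF z(1) z1])
    finally have "norm (z - p) ^ 2 \<le> 4 * K / (norm \<alpha>)\<^sup>2 * norm (v z)"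
      using \<alpha> by (simp add: field_simps power_mult_distrib power_divide)
    then show "\<exists>p\<in>Reg. v p = 0 \<and> norm (z - p) < \<delta> \<and> norm (z - p) ^ 2 \<le> 4 * K / (norm \<alpha>)\<^sup>2 * norm (v z)"
      using p vp by (intro bexI[of _ p]) (auto simp: dist_norm)
  next
    fix p q assume pq: "p \<in> Reg" "q \<in> Reg" "v p = 0" "v q = 0" "p \<noteq> q"
    show "\<delta> \<le> norm (p - q)"
    proof (rule ccontr)
      assume "\<not> \<delta> \<le> norm (p - q)"
      then have q: "p \<in> ball p \<delta>" "q \<in> ball p \<delta>" using \<delta>(1) by (auto simp: dist_norm)
      have "norm (v p) \<le> \<eta>" using pq(3) \<eta>(1) by simp
      note L = loc[OF pq(1) this]
      have "norm \<alpha> / 2 * norm (p - q) \<le> norm (deriv v p - deriv v q)"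
        using almost_linear_map_expanding[of "deriv v" p \<delta> \<alpha> p q] L q \<alpha>(1) by auto
      moreover have "deriv v p = 0" "deriv v q = 0" using v'0[of p] v'0[of q] pq e0(1) by auto
      ultimately have "norm \<alpha> / 2 * norm (p - q) \<le> 0" by simp
      then show False using \<alpha>(2) pq(5) by (simp add: mult_le_0_iff)
    qed
  qed (use \<delta> \<eta> K0 in auto)
qed

end

text \<open>
  For degree at most \<open>2\<close> the derivative grows at most linearly in \<open>w\<close>; for degree at least \<open>3\<close> it
  grows at least like \<open>|w|\<^sup>3\<^sup>/\<^sup>2\<close>, which forces \<open>w\<close> to be bounded.
\<close>

lemma nevanlinna_T_entire_ode_bound:
  assumes w: "w holomorphic_on UNIV" and ode: "\<And>z. (deriv w z)\<^sup>2 = poly R (w z)"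
  shows "\<exists>C>0. \<exists>n. \<forall>r\<ge>0. nevanlinna_T r w < C * (1 + r) ^ n"
proof (cases "degree R \<le> 2")
  case True
  obtain K where K: "K > 0" "\<And>x. norm (poly R x) \<le> K * (1 + norm x) ^ degree R"
    using poly_norm_le[of R] by blast
  have "norm (deriv w z) \<le> sqrt K * (1 + norm (w z))" for z
  proof -
    have "(norm (deriv w z))\<^sup>2 = norm (poly R (w z))" using ode[of z] by (simp add: norm_power[symmetric])
    also have "\<dots> \<le> K * (1 + norm (w z)) ^ degree R" by (rule K(2))
    also have "\<dots> \<le> K * (1 + norm (w z)) ^ 2"
      using True K(1) by (intro mult_left_mono power_increasing) auto
    also have "\<dots> = (sqrt K * (1 + norm (w z)))\<^sup>2" using K(1) by (simp add: power_mult_distrib)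
    finally show ?thesis by (rule power2_le_imp_le) (use K(1) in simp)
  qed
  then obtain B where "B \<ge> 0" "\<And>z. norm (w z) \<le> exp (B * (1 + norm z) ^ 1)"
    using entire_exp_growth[OF w, of "sqrt K"] K(1) by auto
  then show ?thesis by (rule nevanlinna_T_entire_bound[OF w])
next
  case False
  then have d: "degree R \<ge> 3" and R: "R \<noteq> 0" by auto
  obtain K where K: "K > 0" "\<And>x. norm x ^ degree R \<le> K * (1 + norm (poly R x))"
    using power_le_poly_norm[OF R] by blast
  have "norm (w z) powr (3/2) \<le> sqrt (1 + K) * (1 + norm (deriv w z))" for z
  proof -
    have "norm (w z) ^ 3 \<le> 1 + norm (w z) ^ degree R"
    proof (cases "norm (w z) \<le> 1")
      case True
      then have "norm (w z) ^ 3 \<le> 1" by (simp add: power_le_one)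
      then show ?thesis by (simp add: add_increasing2)
    next
      case False
      then have "norm (w z) ^ 3 \<le> norm (w z) ^ degree R" using d by (intro power_increasing) auto
      then show ?thesis by simp
    qed
    also have "\<dots> \<le> 1 + K * (1 + (norm (deriv w z))\<^sup>2)"
      using K(2)[of "w z"] ode[of z] by (simp add: norm_power[symmetric])
    also have "\<dots> \<le> (1 + K) * (1 + norm (deriv w z))\<^sup>2"
      using K(1) by (simp add: power2_eq_square algebra_simps)
    finally have "norm (w z) ^ 3 \<le> (sqrt (1 + K) * (1 + norm (deriv w z)))\<^sup>2"
      using K(1) by (simp add: power_mult_distrib)
    moreover have "norm (w z) ^ 3 = (norm (w z) powr (3/2))\<^sup>2"
    proof -
      have "(norm (w z) powr (3/2))\<^sup>2 = norm (w z) powr 3" by (simp add: power2_eq_square powr_add[symmetric])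
      also have "\<dots> = norm (w z) ^ 3" by (cases "w z = 0") (auto simp: powr_numeral)
      finally show ?thesis by simp
    qed
    ultimately have "(norm (w z) powr (3/2))\<^sup>2 \<le> (sqrt (1 + K) * (1 + norm (deriv w z)))\<^sup>2" by simp
    then show ?thesis by (rule power2_le_imp_le) (use K(1) in simp)
  qed
  then obtain B where B: "\<And>z. norm (w z) \<le> B"
    using entire_bounded_of_superlinear_derivative[OF w, of "sqrt (1 + K)"] K(1) by auto
  have "norm (w z) \<le> exp (\<bar>B\<bar> * (1 + norm z) ^ 0)" for z
  proof -
    have "norm (w z) \<le> 1 + \<bar>B\<bar>" using B[of z] by linarith
    also have "\<dots> \<le> exp \<bar>B\<bar>" by (rule exp_ge_add_one_self)
    finally show ?thesis by simp
  qed
  then show ?thesis by (intro nevanlinna_T_entire_bound[OF w, of "\<bar>B\<bar>" 0]) auto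
qed

proposition nevanlinna_T_polynomial_ode_bound:
  assumes w: "w nicely_meromorphic_on UNIV"
    and ode: "\<And>z. \<not> is_pole w z \<Longrightarrow> (deriv w z)\<^sup>2 = poly R (w z)"
  shows "\<exists>C>0. \<exists>n. \<forall>r\<ge>0. nevanlinna_T r w < C * (1 + r) ^ n"
proof (cases "\<exists>p. is_pole w p")
  case False
  then have "w analytic_on UNIV" using w by (intro nicely_meromorphic_without_singularities) auto
  then have "w holomorphic_on UNIV" by (rule analytic_imp_holomorphic)
  then show ?thesis using ode False by (intro nevanlinna_T_entire_ode_bound) auto
next
  case True
  have mero: "w meromorphic_on UNIV" using w by (simp add: nicely_meromorphic_on_def)
  have mero1: "w meromorphic_on {p}" for p using mero meromorphic_on_subset by blast
  have order: "nat (- zorder w p) * degree R = 2 * nat (- zorder w p) + 2" if p: "is_pole w p" for p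
  proof (rule pole_order_of_first_order_ode[OF mero1 p])
    have "\<forall>\<^sub>F z in at p. w analytic_on {z}"
      using mero1[of p] by (simp add: meromorphic_at_iff isolated_singularity_at_altdef)
    then show "\<forall>\<^sub>F z in at p. (deriv w z)\<^sup>2 = poly R (w z)"
      by eventually_elim (use ode analytic_at_imp_no_pole in blast)
  qed
  obtain p0 where p0: "is_pole w p0" using True by blast
  define d where "d = degree R"
  define k where "k = nat (- zorder w p0)"
  have kd: "k * d = 2 * k + 2" using order[OF p0] by (simp add: k_def d_def)
  \<comment> \<open>The equation \<open>k (d - 2) = 2\<close> has only these two solutions.\<close>
  have cases: "d = 4 \<and> k = 1 \<or> d = 3 \<and> k = 2"
  proof -
    have "d \<ge> 3"
    proof (rule ccontr)
      assume "\<not> d \<ge> 3"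
      then have "k * d \<le> k * 2" by (intro mult_le_mono2) auto
      then show False using kd by simp
    qed
    then obtain e where e: "d = e + 3" by (metis add.commute le_Suc_ex)
    then have ke: "k * (e + 1) = 2" using kd by (simp add: algebra_simps)
    then have "k dvd 2" by (metis dvd_triv_left)
    then have "k \<le> 2" by (rule dvd_imp_le) simp
    then consider "k = 0" | "k = 1" | "k = 2" by linarith
    then show ?thesis
    proof cases
      case 1
      then show ?thesis using ke by simp
    next
      case 2
      then show ?thesis using ke e by simp
    next
      case 3
      then have "e = 0" using ke by simp
      then show ?thesis using 3 e by simp
    qed
  qed
  have mult: "nat (- zorder w p) \<le> k" if "is_pole w p" for p
  proof -
    define m where "m = nat (- zorder w p)"
    have "m * d = 2 * m + 2" using order[OF that] by (simp add: m_def d_def)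
    with cases have "m = k" by auto
    then show ?thesis by (simp add: m_def)
  qed
  define v where "v = (\<lambda>z. inverse (w z))"
  define T where "T = monom 1 (4 - d) * reflect_poly R"
  have v_nice: "v nicely_meromorphic_on UNIV" unfolding v_def using w by (rule nicely_meromorphic_on_inverse)
  have w_ne: "\<exists>z. w z \<noteq> c" for c
  proof -
    have "\<forall>\<^sub>F z in at p0. w z \<noteq> c"
      using p0 unfolding is_pole_def by (rule filterlim_at_infinity_imp_eventually_ne)
    then show ?thesis using eventually_happens[of _ "at p0"] by auto
  qed
  have v_pole: "is_pole w z \<longleftrightarrow> \<not> is_pole v z \<and> v z = 0" for z
  proof
    assume z: "is_pole w z"
    then have "isolated_zero v z" unfolding v_def by (rule is_pole_imp_isolated_zero_inverse)
    then show "\<not> is_pole v z \<and> v z = 0"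
      using pole_is_not_zero is_pole_zero_at_nicely_mero[OF w z] by (auto simp: v_def)
  next
    assume z: "\<not> is_pole v z \<and> v z = 0"
    have "v \<midarrow>z\<rightarrow> 0" using z v_nice by (auto simp: nicely_meromorphic_on_def)
    moreover have "\<forall>\<^sub>F x in at z. v x \<noteq> 0"
    proof (rule ccontr)
      assume "\<not> ?thesis"
      then have "\<exists>\<^sub>F x in at z. w x = 0" by (simp add: frequently_def v_def)
      then have "w x = 0" for x by (rule frequently_eq_meromorphic_imp_constant[OF _ w]) auto
      then show False using w_ne[of 0] by blast
    qed
    ultimately have "isolated_zero v z" by (simp add: isolated_zero_def)
    then have "is_pole (\<lambda>x. inverse (v x)) z" by (rule isolated_zero_imp_pole_inverse)
    then show "is_pole w z" by (simp add: v_def)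
  qed
  interpret reciprocal_ode v T
  proof
    show "v nicely_meromorphic_on UNIV" by (rule v_nice)
    show "\<exists>z. v z \<noteq> c" for c
      using w_ne[of "inverse c"] by (metis inverse_inverse_eq v_def)
    show "(deriv v z)\<^sup>2 = poly T (v z)" if z: "\<not> is_pole v z" "v z \<noteq> 0" for z
    proof -
      have np: "\<not> is_pole w z" using z v_pole by blast
      have wz: "w z \<noteq> 0" using z by (auto simp: v_def)
      have "w analytic_on {z}" using w np by (intro nicely_meromorphic_on_imp_analytic_at) auto
      then have "(w has_field_derivative deriv w z) (at z)"
        using analytic_on_imp_differentiable_at field_differentiable_derivI by blast
      then have "(v has_field_derivative - (inverse (w z) * deriv w z * inverse (w z))) (at z)"
        unfolding v_def using wz by (intro DERIV_inverse')
      then have "deriv v z = - (v z * deriv w z * v z)" by (simp add: DERIV_imp_deriv v_def)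
      then have "(deriv v z)\<^sup>2 = v z ^ 4 * (deriv w z)\<^sup>2" by (simp add: power2_eq_square power4_eq_xxxx)
      also have "\<dots> = v z ^ 4 * poly R (inverse (v z))" using ode[OF np] by (simp add: v_def)
      also have "v z ^ 4 = v z ^ (4 - d) * v z ^ d" using cases by (auto simp flip: power_add)
      finally show ?thesis using z(2) by (simp add: T_def poly_monom poly_reflect_poly_nz d_def)
    qed
  qed
  have R0: "poly (reflect_poly R) 0 \<noteq> 0" using cases by (auto simp: d_def)
  have "zeros_controlled k"
    using cases
  proof
    assume "d = 4 \<and> k = 1"
    then show ?thesis using R0 zeros_controlled_simple by (simp add: T_def poly_monom)
  next
    assume "d = 3 \<and> k = 2"
    moreover have "monom 1 1 = [:0, 1 :: complex:]" by (simp add: monom_altdef)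
    ultimately show ?thesis using R0 zeros_controlled_double[of "reflect_poly R"] by (simp add: T_def)
  qed
  then obtain \<delta> \<eta> B where \<delta>: "\<delta> > 0" and \<eta>: "\<eta> > 0" and B: "B \<ge> 0"
    and near: "\<And>z. z \<in> Reg \<Longrightarrow> norm (v z) \<le> \<eta> \<Longrightarrow>
      \<exists>p\<in>Reg. v p = 0 \<and> norm (z - p) < \<delta> \<and> norm (z - p) ^ k \<le> B * norm (v z)"
    and sep: "\<And>p q. p \<in> Reg \<Longrightarrow> q \<in> Reg \<Longrightarrow> v p = 0 \<Longrightarrow> v q = 0 \<Longrightarrow> p \<noteq> q \<Longrightarrow> \<delta> \<le> norm (p - q)"
    unfolding zeros_controlled_def by blast
  have poles: "is_pole w p \<longleftrightarrow> p \<in> Reg \<and> v p = 0" for p using v_pole by (simp add: Reg_def)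
  define B' where "B' = max B (1 / \<eta>)"
  have "\<exists>C>0. \<forall>r\<ge>0. nevanlinna_T r w < C * (1 + r) ^ (0 + 4)"
  proof (rule nevanlinna_T_polynomial_bound[OF w \<delta>])
    show "B' \<ge> 0" using B by (simp add: B'_def)
    fix z assume np: "\<not> is_pole w z"
    show "norm (w z) \<le> exp (B' * (1 + norm z) ^ 0) \<or>
       (\<exists>p. is_pole w p \<and> norm (z - p) < \<delta> \<and> norm (w z) * norm (z - p) ^ k \<le> B')"
    proof (cases "norm (w z) \<le> 1 / \<eta>")
      case True
      also have "1 / \<eta> \<le> B'" by (simp add: B'_def)
      also have "B' \<le> exp B'" using exp_ge_add_one_self[of B'] by linarith
      finally show ?thesis by simp
    next
      case False
      then have w0: "norm (w z) > 0" using \<eta> by (smt (verit) divide_nonneg_pos norm_ge_zero)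
      have "norm (v z) = 1 / norm (w z)" by (simp add: v_def norm_inverse inverse_eq_divide norm_divide)
      also have "\<dots> \<le> \<eta>" using False \<eta> w0 by (simp add: field_simps)
      finally have vz: "norm (v z) \<le> \<eta>" "v z \<noteq> 0" using w0 by (auto simp: v_def)
      have "\<not> is_pole v z"
        using vz(2) is_pole_zero_at_nicely_mero[OF nice] by blast
      then obtain p where p: "p \<in> Reg" "v p = 0" "norm (z - p) < \<delta>" "norm (z - p) ^ k \<le> B * norm (v z)"
        using near[of z] vz by (auto simp: Reg_def)
      have "norm (w z) * norm (z - p) ^ k \<le> norm (w z) * (B * norm (v z))" using p(4) by (intro mult_left_mono) auto
      also have "\<dots> = B" using w0 by (simp add: v_def norm_inverse)
      also have "B \<le> B'" by (simp add: B'_def)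
      finally show ?thesis using p poles by blast
    qed
  qed (use sep poles mult in auto)
  then show ?thesis by blast
qed

section \<open>First integrals of the two equations\<close>

text \<open>
  Dividing by \<open>a\<close> solves the equation up to a derivative, which has smaller degree.
\<close>

lemma ex_poly_linear_ode:
  fixes Q :: "complex poly"
  assumes "a \<noteq> 0"
  shows "\<exists>R. pderiv R + smult a R = Q"
proof (induction "degree Q" arbitrary: Q rule: less_induct)
  case less
  define R0 where "R0 = smult (1 / a) Q"
  show ?case
  proof (cases "degree Q = 0")
    case True
    then have "pderiv R0 = 0" by (simp add: R0_def pderiv_eq_0_iff)
    then show ?thesis using assms by (intro exI[of _ R0]) (simp add: R0_def)
  next
    case False
    then have "degree (- pderiv R0) < degree Q" using assms by (simp add: R0_def degree_pderiv)
    then obtain R1 where "pderiv R1 + smult a R1 = - pderiv R0" using less by blast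
    note R1 = this
    have "pderiv (R0 + R1) + smult a (R0 + R1) = (pderiv R0 + (pderiv R1 + smult a R1)) + smult a R0"
      by (simp add: pderiv_add smult_add_right algebra_simps)
    also have "\<dots> = smult a R0" unfolding R1 by simp
    also have "\<dots> = Q" using assms by (simp add: R0_def)
    finally show ?thesis by blast
  qed
qed

lemma ex_poly_antiderivative:
  fixes Q :: "complex poly"
  shows "\<exists>R. pderiv R = Q \<and> poly R 0 = 0"
proof -
  define R where "R = (\<Sum>i\<le>degree Q. monom (coeff Q i / of_nat (Suc i)) (Suc i))"
  have "coeff R (Suc n) = coeff Q n / of_nat (Suc n)" for n
  proof -
    have "coeff R (Suc n) = (\<Sum>i\<le>degree Q. if i = n then coeff Q i / of_nat (Suc i) else 0)"
      unfolding R_def coeff_sum by (intro sum.cong) auto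
    also have "\<dots> = coeff Q n / of_nat (Suc n)" by (auto simp: coeff_eq_0)
    finally show ?thesis .
  qed
  then have "pderiv R = Q" by (intro poly_eqI) (simp add: coeff_pderiv del: of_nat_Suc)
  moreover have "poly R 0 = 0" by (simp add: R_def poly_sum poly_monom)
  ultimately show ?thesis by blast
qed

lemma meromorphic_on_poly:
  assumes "f meromorphic_on A"
  shows "(\<lambda>z. poly p (f z)) meromorphic_on A"
  unfolding poly_altdef using assms by (intro meromorphic_intros)

lemma constant_of_deriv_0:
  fixes f :: "complex \<Rightarrow> complex"
  assumes "connected S" "open S" "\<And>x. x \<in> S \<Longrightarrow> (f has_field_derivative 0) (at x)"
  obtains c where "\<And>x. x \<in> S \<Longrightarrow> f x = c"
  using has_field_derivative_0_imp_constant_on[OF assms(3,1,2)] unfolding constant_on_def by blast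

text \<open>
  A nonconstant polynomial in \<open>exp g\<close> is at least of the size of \<open>exp g\<close>, which reduces the bound to
  the one on \<open>exp (Re g)\<close>. Vanishing at \<open>0\<close> without being zero, \<open>S\<close> is nonconstant.
\<close>

lemma entire_quadratic_of_exp_poly_bound:
  assumes g: "g holomorphic_on UNIV" and S: "S \<noteq> 0" "poly S 0 = 0" and \<kappa>: "\<kappa> \<noteq> 0" and M: "M \<ge> 0"
    and bnd: "\<And>z. norm (poly S (\<kappa> * exp (g z))) \<le> M * (1 + norm (g z) + norm (deriv g z)) ^ n"
  shows "\<exists>C. \<forall>z. norm (g z) \<le> C * (1 + norm z) ^ 2"
proof -
  have deg: "degree S \<ge> 1"
  proof (rule ccontr)
    assume "\<not> degree S \<ge> 1"
    then obtain a where "S = [:a:]" using degree_eq_zeroE[of S] by auto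
    then show False using S by simp
  qed
  obtain K1 where K1: "K1 > 0" "\<And>x. norm x ^ degree S \<le> K1 * (1 + norm (poly S x))"
    using power_le_poly_norm[OF S(1)] by blast
  define K where "K = (1 + K1 + K1 * M) / norm \<kappa>"
  show ?thesis
  proof (rule entire_quadratic_of_exp_bound[OF g, of K])
    show "K > 0" using K1(1) M \<kappa> by (simp add: K_def add_pos_nonneg)
    fix z
    define y where "y = \<kappa> * exp (g z)"
    define X where "X = (1 + norm (g z) + norm (deriv g z)) ^ n"
    have X: "X \<ge> 1" unfolding X_def by (intro one_le_power) simp
    have "norm y \<le> 1 + norm y ^ degree S"
    proof (cases "norm y \<le> 1")
      case False
      then have "norm y ^ 1 \<le> norm y ^ degree S" using deg by (intro power_increasing) auto
      then show ?thesis by simp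
    qed (simp add: add_increasing2)
    also have "\<dots> \<le> 1 + K1 * (1 + M * X)"
    proof -
      have "K1 * (1 + norm (poly S y)) \<le> K1 * (1 + M * X)"
        using bnd[of z] K1(1) by (intro mult_left_mono) (auto simp: y_def X_def)
      then show ?thesis using K1(2)[of y] by linarith
    qed
    also have "\<dots> \<le> (1 + K1 + K1 * M) * X"
      using mult_left_mono[OF X, of "1 + K1"] K1(1) by (simp add: algebra_simps)
    finally have "norm y / norm \<kappa> \<le> (1 + K1 + K1 * M) * X / norm \<kappa>" by (intro divide_right_mono) auto
    moreover have "norm y / norm \<kappa> = exp (Re (g z))" using \<kappa> by (simp add: y_def norm_mult)
    ultimately show "exp (Re (g z)) \<le> K * (1 + norm (g z) + norm (deriv g z)) ^ n"
      by (simp add: K_def X_def)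
  qed
qed

text \<open>
  The function \<open>G = (w'\<^sup>2 - R(w)) exp(2 c w)\<close> is constant. If \<open>c = 0\<close> or the constant is \<open>0\<close>, then \<open>w'\<^sup>2\<close> is a polynomial
  in \<open>w\<close>. Otherwise \<open>exp(2 c w)\<close> is meromorphic, so \<open>w\<close> has no poles, and \<open>exp(-2 c w)\<close> is a polynomial in \<open>w\<close> and
  \<open>w'\<close>, which forces \<open>w\<close> to grow slowly.
\<close>

proposition square_equation_bound:
  assumes w: "w nicely_meromorphic_on UNIV"
    and ode: "\<And>z. \<not> is_pole w z \<Longrightarrow> deriv (deriv w) z + c * (deriv w z)\<^sup>2 + poly P (w z) = 0"
  shows "\<exists>C>0. \<exists>n. \<forall>r\<ge>0. nevanlinna_T r w < C * (1 + r) ^ n"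
proof -
  obtain R where R: "pderiv R + smult (2 * c) R = smult (-2) P"
    using ex_poly_linear_ode[of "2 * c" "smult (-2) P"] ex_poly_antiderivative[of "smult (-2) P"]
    by (cases "c = 0") auto
  define D where "D = {z. \<not> is_pole w z}"
  define G where "G = (\<lambda>z. ((deriv w z)\<^sup>2 - poly R (w z)) * exp (2 * c * w z))"
  obtain C where C: "\<And>z. z \<in> D \<Longrightarrow> G z = C"
  proof (rule constant_of_deriv_0[of D G])
    fix z assume "z \<in> D"
    then have z: "\<not> is_pole w z" by (simp add: D_def)
    note d = nonpole_derivatives[OF w z]
    have "poly (pderiv R + smult (2 * c) R) (w z) = poly (smult (-2) P) (w z)" using R by simp
    then have R': "poly (pderiv R) (w z) + 2 * c * poly R (w z) = -2 * poly P (w z)" by simp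
    have "(G has_field_derivative
        (2 * deriv w z * deriv (deriv w) z - poly (pderiv R) (w z) * deriv w z
           + ((deriv w z)\<^sup>2 - poly R (w z)) * (2 * c * deriv w z)) * exp (2 * c * w z)) (at z)"
      unfolding G_def using d(2,3)
      by (auto intro!: derivative_eq_intros DERIV_chain2[OF poly_DERIV d(2)] simp: algebra_simps)
    also have "2 * deriv w z * deriv (deriv w) z - poly (pderiv R) (w z) * deriv w z
           + ((deriv w z)\<^sup>2 - poly R (w z)) * (2 * c * deriv w z)
         = deriv w z * (2 * (deriv (deriv w) z + c * (deriv w z)\<^sup>2)
             - (poly (pderiv R) (w z) + 2 * c * poly R (w z)))"
      by (simp add: algebra_simps power2_eq_square)
    also have "\<dots> = deriv w z * (2 * (deriv (deriv w) z + c * (deriv w z)\<^sup>2 + poly P (w z)))"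
      unfolding R' by (simp add: algebra_simps)
    finally show "(G has_field_derivative 0) (at z)" by (simp add: ode[OF z])
  qed (use nonpole_region[OF w] in \<open>auto simp: D_def\<close>)
  show ?thesis
  proof (cases "c = 0 \<or> C = 0")
    case True
    have "(deriv w z)\<^sup>2 = poly (R + [:C:]) (w z)" if "\<not> is_pole w z" for z
    proof -
      have "((deriv w z)\<^sup>2 - poly R (w z)) * exp (2 * c * w z) = C"
        using C[of z] that by (simp add: D_def G_def)
      then show ?thesis using True by (auto simp: algebra_simps)
    qed
    then show ?thesis by (rule nevanlinna_T_polynomial_ode_bound[OF w])
  next
    case False
    have mero: "w meromorphic_on {p}" for p
      using w meromorphic_on_subset unfolding nicely_meromorphic_on_def by blast
    have np: "\<not> is_pole w p" for p
    proof
      assume p: "is_pole w p"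
      have "is_pole (\<lambda>z. 2 * c * w z) p"
        using p False by (simp add: is_pole_cmult_iff)
      moreover have "(\<lambda>z. 2 * c * w z) meromorphic_on {p}" using mero by (intro meromorphic_intros)
      then have "isolated_singularity_at (\<lambda>z. 2 * c * w z) p" by (simp add: meromorphic_at_iff)
      ultimately have ess: "\<not> not_essential (\<lambda>z. exp (2 * c * w z)) p" by (rule exp_pole_is_essential)
      have "(\<lambda>z. C / ((deriv w z)\<^sup>2 - poly R (w z))) meromorphic_on {p}"
        using mero by (intro meromorphic_intros meromorphic_on_poly)
      then have ne: "not_essential (\<lambda>z. C / ((deriv w z)\<^sup>2 - poly R (w z))) p" by (simp add: meromorphic_at_iff)
      have "\<forall>\<^sub>F z in at p. w analytic_on {z}"
        using mero[of p] by (simp add: meromorphic_at_iff isolated_singularity_at_altdef)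
      then have ev: "\<forall>\<^sub>F z in at p. C / ((deriv w z)\<^sup>2 - poly R (w z)) = exp (2 * c * w z)"
      proof eventually_elim
        case (elim z)
        then have "((deriv w z)\<^sup>2 - poly R (w z)) * exp (2 * c * w z) = C"
          using C[of z] analytic_at_imp_no_pole by (auto simp: D_def G_def)
        moreover from this have "(deriv w z)\<^sup>2 - poly R (w z) \<noteq> 0" using False by auto
        ultimately show ?case by (metis nonzero_mult_div_cancel_left)
      qed
      show False using ess not_essential_transform[OF ne ev] by simp
    qed
    then have hol: "w holomorphic_on UNIV"
      using nicely_meromorphic_without_singularities[OF w] analytic_imp_holomorphic by blast
    define g where "g = (\<lambda>z. - 2 * c * w z)"
    have g: "g holomorphic_on UNIV" unfolding g_def using hol by (intro holomorphic_intros)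
    have g': "deriv g z = - 2 * c * deriv w z" for z
      unfolding g_def using hol by (intro deriv_cmult) (auto intro: holomorphic_on_imp_differentiable_at)
    obtain K where K: "K > 0" "\<And>x. norm (poly R x) \<le> K * (1 + norm x) ^ degree R"
      using poly_norm_le[of R] by blast
    define s where "s = 1 / norm (2 * c)"
    define n where "n = degree R + 2"
    define M where "M = s\<^sup>2 + K * (1 + s) ^ degree R"
    have s: "s > 0" using False by (simp add: s_def)
    have "norm (poly [:0, 1:] (C * exp (g z))) \<le> M * (1 + norm (g z) + norm (deriv g z)) ^ n" for z
    proof -
      define X where "X = 1 + norm (g z) + norm (deriv g z)"
      have X: "X \<ge> 1" by (simp add: X_def)
      have wz: "norm (w z) = s * norm (g z)" "norm (deriv w z) = s * norm (deriv g z)"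
        using False by (simp add: s_def g_def norm_mult, simp add: s_def g' norm_mult)
      have "((deriv w z)\<^sup>2 - poly R (w z)) * exp (2 * c * w z) = C"
        using C[of z] np by (simp add: D_def G_def)
      then have "C * exp (g z) = ((deriv w z)\<^sup>2 - poly R (w z)) * (exp (2 * c * w z) * exp (g z))"
        by (simp add: mult.assoc)
      also have "exp (2 * c * w z) * exp (g z) = 1" by (simp add: g_def exp_add[symmetric])
      finally have "norm (C * exp (g z)) \<le> (norm (deriv w z))\<^sup>2 + norm (poly R (w z))"
        by (simp add: norm_triangle_ineq4 flip: norm_power)
      also have "\<dots> \<le> s\<^sup>2 * X ^ n + K * (1 + s) ^ degree R * X ^ n"
      proof (rule add_mono)
        have "(norm (deriv w z))\<^sup>2 = s\<^sup>2 * norm (deriv g z) ^ 2" by (simp add: wz power_mult_distrib)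
        also have "\<dots> \<le> s\<^sup>2 * X ^ 2" by (intro mult_left_mono power_mono) (auto simp: X_def)
        also have "\<dots> \<le> s\<^sup>2 * X ^ n" using X by (intro mult_left_mono power_increasing) (auto simp: n_def)
        finally show "(norm (deriv w z))\<^sup>2 \<le> s\<^sup>2 * X ^ n" .
        have "norm (poly R (w z)) \<le> K * (1 + norm (w z)) ^ degree R" by (rule K(2))
        also have "\<dots> \<le> K * ((1 + s) * X) ^ degree R"
        proof -
          have "1 + s * norm (g z) \<le> (1 + s) * X"
            using s by (simp add: X_def algebra_simps add_increasing2)
          then show ?thesis using K(1) s by (intro mult_left_mono power_mono) (auto simp: wz)
        qed
        also have "\<dots> = K * (1 + s) ^ degree R * X ^ degree R" by (simp add: power_mult_distrib)
        also have "\<dots> \<le> K * (1 + s) ^ degree R * X ^ n"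
          using X K(1) s by (intro mult_left_mono power_increasing) (auto simp: n_def)
        finally show "norm (poly R (w z)) \<le> K * (1 + s) ^ degree R * X ^ n" .
      qed
      also have "\<dots> = M * X ^ n" by (simp add: M_def algebra_simps)
      finally show ?thesis by (simp add: X_def)
    qed
    then obtain C' where C': "\<And>z. norm (g z) \<le> C' * (1 + norm z) ^ 2"
      using entire_quadratic_of_exp_poly_bound[OF g, of "[:0, 1:]" C M n] False K(1) s by (auto simp: M_def)
    define B where "B = s * \<bar>C'\<bar>"
    have "norm (w z) \<le> exp (B * (1 + norm z) ^ 2)" for z
    proof -
      have "norm (w z) = s * norm (g z)" using False by (simp add: s_def g_def norm_mult)
      also have "\<dots> \<le> s * (\<bar>C'\<bar> * (1 + norm z) ^ 2)"
      proof (rule mult_left_mono)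
        have "C' * (1 + norm z) ^ 2 \<le> \<bar>C'\<bar> * (1 + norm z) ^ 2" by (intro mult_right_mono) auto
        then show "norm (g z) \<le> \<bar>C'\<bar> * (1 + norm z) ^ 2" using C'[of z] by linarith
      qed (use s in simp)
      also have "\<dots> = B * (1 + norm z) ^ 2" by (simp add: B_def)
      also have "\<dots> \<le> exp (B * (1 + norm z) ^ 2)"
        using exp_ge_add_one_self[of "B * (1 + norm z) ^ 2"] by linarith
      finally show ?thesis .
    qed
    then show ?thesis using s by (intro nevanlinna_T_entire_bound[OF hol, of B 2]) (auto simp: B_def)
  qed
qed

text \<open>
  Dividing the equation by \<open>w\<^sup>2\<close> gives \<open>(w'/w)' = - P(w) / w\<^sup>2\<close>. Multiplied by \<open>2 w'/w\<close>, the right-hand side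
  becomes a derivative except for the term of \<open>P\<close> of degree \<open>2\<close>, which leaves the logarithmic derivative.
\<close>

lemma log_first_integral:
  assumes w: "w nicely_meromorphic_on UNIV"
    and ode: "\<And>z. \<not> is_pole w z \<Longrightarrow> w z * deriv (deriv w) z - (deriv w z)\<^sup>2 + poly P (w z) = 0"
    and P: "P = pCons p0 (pCons p1 (pCons p2 Q))" and Q1: "pderiv Q1 = Q"
    and z: "w z \<noteq> 0"
  shows "((\<lambda>z. (deriv w z * inverse (w z))\<^sup>2 - p0 * (inverse (w z))\<^sup>2 - 2 * p1 * inverse (w z)
            + 2 * poly Q1 (w z)) has_field_derivative - 2 * p2 * (deriv w z * inverse (w z))) (at z)"
proof -
  have np: "\<not> is_pole w z" using is_pole_zero_at_nicely_mero[OF w] z by blast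
  note d = nonpole_derivatives[OF w np]
  define a b i where "a = w z" and "b = deriv w z" and "i = inverse a"
  have ai: "a * i = 1" using z by (simp add: a_def i_def)
  have di: "((\<lambda>z. inverse (w z)) has_field_derivative - (b * i\<^sup>2)) (at z)"
    using DERIV_inverse'[OF d(2) z] by (simp add: a_def b_def i_def power2_eq_square mult_ac)
  define q where "q = poly Q a"
  have Pa: "poly P a = p0 + p1 * a + p2 * a\<^sup>2 + a ^ 3 * q"
    by (simp add: P q_def algebra_simps power2_eq_square power3_eq_cube)
  have "deriv (deriv w) z = (a * deriv (deriv w) z) * i" using ai by (simp add: mult_ac)
  also have "a * deriv (deriv w) z = b\<^sup>2 - poly P a" using ode[OF np] by (simp add: a_def b_def algebra_simps)
  finally have e: "deriv (deriv w) z = (b\<^sup>2 - poly P a) * i" .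
  have h': "((\<lambda>z. deriv w z * inverse (w z)) has_field_derivative - poly P a * i\<^sup>2) (at z)"
  proof -
    have "((\<lambda>z. deriv w z * inverse (w z)) has_field_derivative
        deriv (deriv w) z * inverse (w z) + (- (b * i\<^sup>2)) * deriv w z) (at z)"
      by (rule DERIV_mult[OF d(3) di])
    also have "deriv (deriv w) z * inverse (w z) + (- (b * i\<^sup>2)) * deriv w z = - poly P a * i\<^sup>2"
      unfolding e a_def[symmetric] b_def[symmetric] i_def[symmetric] by (simp add: algebra_simps power2_eq_square)
    finally show ?thesis .
  qed
  have Q': "((\<lambda>z. poly Q1 (w z)) has_field_derivative q * b) (at z)"
    using DERIV_chain2[OF poly_DERIV d(2), of Q1] by (simp add: Q1 q_def a_def b_def)
  have "((\<lambda>z. (deriv w z * inverse (w z))\<^sup>2 - p0 * (inverse (w z))\<^sup>2 - 2 * p1 * inverse (w z)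
            + 2 * poly Q1 (w z)) has_field_derivative
      2 * (b * i) * (- poly P a * i\<^sup>2) - p0 * (2 * i * (- (b * i\<^sup>2))) - 2 * p1 * (- (b * i\<^sup>2)) + 2 * (q * b)) (at z)"
    by (rule derivative_eq_intros h' di Q' refl)+ (simp add: a_def b_def i_def)
  also have "2 * (b * i) * (- poly P a * i\<^sup>2) - p0 * (2 * i * (- (b * i\<^sup>2))) - 2 * p1 * (- (b * i\<^sup>2)) + 2 * (q * b)
     = - 2 * p2 * (b * i)"
  proof -
    have "(b * i) * (poly P a * i\<^sup>2) = b * (p0 * i ^ 3 + p1 * i\<^sup>2 * (a * i) + p2 * i * (a * i) ^ 2 + q * (a * i) ^ 3)"
      unfolding Pa by (simp add: algebra_simps power2_eq_square power3_eq_cube)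
    then have *: "(b * i) * (poly P a * i\<^sup>2) = b * (p0 * i ^ 3 + p1 * i\<^sup>2 + p2 * i + q)" unfolding ai by simp
    have "2 * (b * i) * (- poly P a * i\<^sup>2) - p0 * (2 * i * (- (b * i\<^sup>2))) - 2 * p1 * (- (b * i\<^sup>2)) + 2 * (q * b)
        = - 2 * ((b * i) * (poly P a * i\<^sup>2)) + 2 * b * (p0 * i ^ 3 + p1 * i\<^sup>2 + q)"
      by (simp add: algebra_simps power2_eq_square power3_eq_cube)
    also have "\<dots> = - 2 * p2 * (b * i)" unfolding * by (simp add: algebra_simps)
    finally show ?thesis .
  qed
  finally show ?thesis by (simp add: a_def b_def i_def)
qed

text \<open>
  If \<open>w\<close> vanished at \<open>q\<close>, then \<open>q\<close> would be a zero or a pole of \<open>w\<close>, since the normalised value at a pole is \<open>0\<close>.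
  Neither is possible for \<open>K exp g\<close>: a pole of \<open>g\<close> would make it essential, and a finite limit of \<open>g\<close> gives a finite
  nonzero limit.
\<close>

lemma nonzero_of_global_logarithm:
  assumes w: "w nicely_meromorphic_on UNIV" and g: "g meromorphic_on UNIV" and K: "K \<noteq> 0"
    and eq: "\<And>z. w z \<noteq> 0 \<Longrightarrow> w z = K * exp (g z)"
    and ne: "\<And>q. \<forall>\<^sub>F z in at q. w z \<noteq> 0"
  shows "w q \<noteq> 0"
proof
  assume q: "w q = 0"
  have wm: "w meromorphic_on {q}" and gm: "g meromorphic_on {q}"
    using w g meromorphic_on_subset unfolding nicely_meromorphic_on_def by blast+
  have ev: "\<forall>\<^sub>F z in at q. inverse K * w z = exp (g z)"
    using ne[of q] by eventually_elim (use eq K in \<open>simp add: field_simps\<close>)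
  have iso: "isolated_singularity_at g q" "not_essential g q" using gm by (auto simp: meromorphic_at_iff)
  show False
  proof (cases "is_pole g q")
    case True
    have "(\<lambda>z. inverse K * w z) meromorphic_on {q}" using wm by (intro meromorphic_intros)
    then have "not_essential (\<lambda>z. inverse K * w z) q" by (simp add: meromorphic_at_iff)
    then show False using not_essential_transform[OF _ ev] exp_pole_is_essential[OF True iso(1)] by blast
  next
    case False
    then obtain l where "g \<midarrow>q\<rightarrow> l" using iso(2) by (auto simp: not_essential_def)
    then have "(\<lambda>z. K * exp (g z)) \<midarrow>q\<rightarrow> K * exp l" by (intro tendsto_intros)
    moreover have "\<forall>\<^sub>F z in at q. K * exp (g z) = w z" using ne[of q] by eventually_elim (use eq in simp)
    ultimately have lim: "w \<midarrow>q\<rightarrow> K * exp l" by (rule Lim_transform_eventually)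
    then have "\<not> is_pole w q" using not_tendsto_and_filterlim_at_infinity[OF at_neq_bot lim] by (auto simp: is_pole_def)
    then have "w \<midarrow>q\<rightarrow> 0" using w q by (auto simp: nicely_meromorphic_on_def)
    then show False using tendsto_unique[OF at_neq_bot lim] K by force
  qed
qed

text \<open>
  The first integral for \<open>w = \<kappa> exp g\<close>. Its right-hand side is a polynomial in \<open>w\<close> plus a polynomial in \<open>1/w\<close> plus
  a linear term in \<open>g\<close>. If the first polynomial is nonzero, then the equation bounds \<open>exp g\<close> where it is large,
  and the polynomial in \<open>1/w\<close> is bounded there. If only the second one is nonzero, the roles of \<open>g\<close> and
  \<open>-g\<close> are exchanged. If both vanish, then \<open>g'\<^sup>2\<close> is proportional to \<open>g\<close>.
\<close>

lemma entire_quadratic_of_log_integral: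
  assumes g: "g holomorphic_on UNIV" and \<kappa>: "\<kappa> \<noteq> 0" and Q1: "poly Q1 0 = 0"
    and eq: "\<And>z. (deriv g z)\<^sup>2 = p0 * (inverse (\<kappa> * exp (g z)))\<^sup>2 + 2 * p1 * inverse (\<kappa> * exp (g z))
               - 2 * poly Q1 (\<kappa> * exp (g z)) + s * g z"
  shows "\<exists>C. \<forall>z. norm (g z) \<le> C * (1 + norm z) ^ 2"
proof -
  define X where "X = (\<lambda>z. 1 + norm (g z) + norm (deriv g z))"
  have X: "X z \<ge> 1" "norm (deriv g z) ^ 2 \<le> X z ^ 2" "norm (g z) \<le> X z ^ 2" "1 \<le> X z ^ 2" for z
  proof -
    show 1: "X z \<ge> 1" by (simp add: X_def)
    show "norm (deriv g z) ^ 2 \<le> X z ^ 2" by (intro power_mono) (auto simp: X_def)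
    have "norm (g z) \<le> X z" by (simp add: X_def)
    also have "X z \<le> X z ^ 2" using 1 self_le_power[of "X z" 2] by simp
    finally show "norm (g z) \<le> X z ^ 2" .
    show "1 \<le> X z ^ 2" using 1 by simp
  qed
  have main: "norm ((deriv g z)\<^sup>2 - s * g z) \<le> (1 + norm s) * X z ^ 2" for z
  proof -
    have "norm ((deriv g z)\<^sup>2 - s * g z) \<le> norm (deriv g z) ^ 2 + norm s * norm (g z)"
      by (metis norm_mult norm_power norm_triangle_ineq4)
    also have "\<dots> \<le> X z ^ 2 + norm s * X z ^ 2" using X[of z] by (intro add_mono mult_left_mono) auto
    finally show ?thesis by (simp add: algebra_simps)
  qed
  define Q2 where "Q2 = [:0, 2 * p1, p0:]"
  have Q2: "poly Q2 y = p0 * y\<^sup>2 + 2 * p1 * y" for y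
    by (simp add: Q2_def algebra_simps power2_eq_square)
  have eq': "(deriv g z)\<^sup>2 - s * g z = poly Q2 (inverse (\<kappa> * exp (g z))) - 2 * poly Q1 (\<kappa> * exp (g z))" for z
    using eq[of z] by (simp add: Q2)
  consider "Q1 \<noteq> 0" | "Q1 = 0" "Q2 \<noteq> 0" | "Q1 = 0" "Q2 = 0" by blast
  then show ?thesis
  proof cases
    case 1
    define S where "S = [:0, 1:] * Q1"
    obtain K2 where K2: "K2 \<ge> 1" "\<And>x. norm x \<le> 1 \<Longrightarrow> norm (poly Q2 x) \<le> K2"
      using poly_bounded_on_unit_ball[of Q2] by blast
    obtain K1 where K1: "K1 \<ge> 1" "\<And>x. norm x \<le> 1 \<Longrightarrow> norm (poly Q1 x) \<le> K1"
      using poly_bounded_on_unit_ball[of Q1] by blast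
    define M where "M = K1 + K2 + 1 + norm s"
    show ?thesis
    proof (rule entire_quadratic_of_exp_poly_bound[OF g 1 Q1 \<kappa>, of M 2])
      fix z
      define y where "y = \<kappa> * exp (g z)"
      have M: "K1 + (1 + norm s) * X z ^ 2 + K2 \<le> M * X z ^ 2"
        using mult_left_mono[OF X(4)[of z], of "K1 + K2"] K1 K2 by (simp add: M_def algebra_simps)
      have "norm (poly Q1 y) \<le> M * X z ^ 2"
      proof (cases "norm y \<le> 1")
        case True
        have "0 \<le> (1 + norm s) * X z ^ 2" by simp
        then show ?thesis using K1(2)[OF True] K2(1) M by linarith
      next
        case False
        have "norm (inverse y) \<le> 1"
          using False by (simp add: norm_inverse inverse_le_1_iff)
        then have "norm (poly Q2 (inverse y)) \<le> K2" by (rule K2(2))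
        moreover have "2 * poly Q1 y = poly Q2 (inverse y) - ((deriv g z)\<^sup>2 - s * g z)"
          using eq'[of z] by (simp add: y_def)
        then have "norm (2 * poly Q1 y) \<le> norm (poly Q2 (inverse y)) + norm ((deriv g z)\<^sup>2 - s * g z)"
          by (metis norm_triangle_ineq4)
        moreover have "norm (2 * poly Q1 y) = 2 * norm (poly Q1 y)" by (simp add: norm_mult)
        ultimately show ?thesis using main[of z] M K1(1) norm_ge_zero[of "poly Q1 y"] by linarith
      qed
      then show "norm (poly Q1 (\<kappa> * exp (g z))) \<le> M * (1 + norm (g z) + norm (deriv g z)) ^ 2"
        by (simp add: y_def X_def)
    qed (use K1 K2 in \<open>auto simp: M_def\<close>)
  next
    case 2
    define f where "f = (\<lambda>z. - g z)"
    have f: "f holomorphic_on UNIV" unfolding f_def using g by (intro holomorphic_intros)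
    have f': "deriv f z = - deriv g z" for z
      unfolding f_def using g by (intro deriv_minus) (auto intro: holomorphic_on_imp_differentiable_at)
    have "norm (poly Q2 (inverse \<kappa> * exp (f z))) \<le> (1 + norm s) * (1 + norm (f z) + norm (deriv f z)) ^ 2" for z
    proof -
      have inv: "inverse (\<kappa> * exp (g z)) = inverse \<kappa> * exp (f z)" by (simp add: f_def exp_minus)
      have "(deriv g z)\<^sup>2 - s * g z = poly Q2 (inverse \<kappa> * exp (f z))" using eq'[of z] 2(1) unfolding inv by simp
      moreover have n: "norm (f z) = norm (g z)" "norm (deriv f z) = norm (deriv g z)"
        by (simp add: f_def, simp add: f')
      ultimately show ?thesis using main[of z] unfolding n X_def by simp
    qed
    then have "\<exists>C. \<forall>z. norm (f z) \<le> C * (1 + norm z) ^ 2"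
      using \<kappa> by (intro entire_quadratic_of_exp_poly_bound[OF f 2(2), of "inverse \<kappa>" "1 + norm s" 2]) (auto simp: Q2)
    then show ?thesis by (simp add: f_def)
  next
    case 3
    show ?thesis
    proof (rule entire_quadratic_growth[OF g, of "norm s"])
      fix z
      have "(norm (deriv g z))\<^sup>2 = norm s * norm (g z)"
        using eq'[of z] 3 by (simp flip: norm_mult norm_power)
      then show "(norm (deriv g z))\<^sup>2 \<le> norm s * (1 + norm (g z))" by (simp add: algebra_simps)
    qed simp
  qed
qed

text \<open>
  Without a quadratic term in \<open>P\<close>, the first integral is a polynomial equation for \<open>w'\<^sup>2\<close> off the zeros of \<open>w\<close>,
  and everywhere by continuity. With a quadratic term, solving for the logarithm
  shows that \<open>w\<close> has a meromorphic logarithm \<open>g\<close>; this is entire, and the first integral bounds its growth.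
\<close>

proposition product_equation_bound:
  assumes w: "w nicely_meromorphic_on UNIV"
    and ode: "\<And>z. \<not> is_pole w z \<Longrightarrow> w z * deriv (deriv w) z - (deriv w z)\<^sup>2 + poly P (w z) = 0"
  shows "\<exists>C>0. \<exists>n. \<forall>r\<ge>0. nevanlinna_T r w < C * (1 + r) ^ n"
proof (cases "\<forall>z. w z = 0")
  case True
  then have "w = (\<lambda>_. 0)" by auto
  then show ?thesis by (intro nevanlinna_T_entire_bound[of w 0 0]) auto
next
  case False
  obtain p0 p1 p2 Q where P: "P = pCons p0 (pCons p1 (pCons p2 Q))" by (metis pCons_cases)
  obtain Q1 where Q1: "pderiv Q1 = Q" "poly Q1 0 = 0" using ex_poly_antiderivative by blast
  have wm: "w meromorphic_on UNIV" using w by (simp add: nicely_meromorphic_on_def)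
  have sp: "\<forall>\<^sub>\<approx>z\<in>UNIV. w z \<noteq> 0"
    using nicely_meromorphic_imp_constant_or_avoid[OF w, of 0] False by auto
  then have ne: "\<forall>\<^sub>F z in at q. w z \<noteq> 0" for q by (simp add: eventually_cosparse_open_eq)
  \<comment> \<open>The normalised value at a pole is \<open>0\<close>, so \<open>D\<close> omits the poles as well as the zeros.\<close>
  define D where "D = {z. w z \<noteq> 0}"
  have D: "open D" "connected D"
  proof -
    have sp': "{z. w z = 0} sparse_in UNIV" using sp by (simp add: eventually_cosparse)
    have eq: "D = UNIV - {z. w z = 0}" by (auto simp: D_def)
    show "open D" unfolding eq by (rule open_diff_sparse_pts) (use sp' in auto)
    show "connected D" unfolding eq by (rule sparse_imp_connected) (use sp' in auto)
  qed
  define G where "G = (\<lambda>z. (deriv w z * inverse (w z))\<^sup>2 - p0 * (inverse (w z))\<^sup>2 - 2 * p1 * inverse (w z)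
            + 2 * poly Q1 (w z))"
  have G': "(G has_field_derivative - 2 * p2 * (deriv w z * inverse (w z))) (at z)" if "z \<in> D" for z
    unfolding G_def using that by (intro log_first_integral[OF w ode P Q1(1)]) (auto simp: D_def)
  have G_eq: "(deriv w z)\<^sup>2 = poly [:p0, 2 * p1:] (w z) + (w z)\<^sup>2 * (G z - 2 * poly Q1 (w z))" if "z \<in> D" for z
    using that by (simp add: G_def D_def power_mult_distrib field_simps power2_eq_square)
  show ?thesis
  proof (cases "p2 = 0")
    case True
    obtain C where C: "\<And>z. z \<in> D \<Longrightarrow> G z = C"
      using constant_of_deriv_0[OF D(2,1), of G] G' True by auto
    define R where "R = [:p0, 2 * p1:] + [:0, 0, 1:] * ([:C:] - smult 2 Q1)"
    have R: "poly R y = poly [:p0, 2 * p1:] y + y\<^sup>2 * (C - 2 * poly Q1 y)" for y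
      by (simp add: R_def power2_eq_square algebra_simps)
    have "(deriv w z)\<^sup>2 = poly R (w z)" if z: "\<not> is_pole w z" for z
    proof -
      define H where "H = (\<lambda>z. (deriv w z)\<^sup>2 - poly R (w z))"
      have "isCont H z"
        unfolding H_def
        by (intro continuous_diff continuous_power isCont_o2[OF _ poly_isCont] DERIV_isCont)
          (rule nonpole_derivatives(2,3)[OF w z])+
      then have "H \<midarrow>z\<rightarrow> H z" by (simp add: isCont_def)
      moreover have "\<forall>\<^sub>F x in at z. H x = 0"
        using ne[of z] by eventually_elim (use G_eq C in \<open>simp add: H_def R D_def\<close>)
      then have "H \<midarrow>z\<rightarrow> 0" by (rule tendsto_eventually)
      ultimately have "H z = 0" by (rule tendsto_unique[OF at_neq_bot])
      then show ?thesis by (simp add: H_def)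
    qed
    then show ?thesis by (rule nevanlinna_T_polynomial_ode_bound[OF w])
  next
    case p2: False
    define g where "g = (\<lambda>z. - G z / (2 * p2))"
    have g': "(g has_field_derivative deriv w z / w z) (at z)" if "z \<in> D" for z
    proof -
      have "(g has_field_derivative - (- 2 * p2 * (deriv w z * inverse (w z))) / (2 * p2)) (at z)"
        unfolding g_def by (rule DERIV_cdivide[OF DERIV_minus[OF G'[OF that]]])
      also have "- (- 2 * p2 * (deriv w z * inverse (w z))) = (2 * p2) * (deriv w z / w z)"
        by (simp only: divide_inverse) simp
      also have "(2 * p2) * (deriv w z / w z) / (2 * p2) = deriv w z / w z"
        by (rule nonzero_mult_div_cancel_left) (use p2 in simp)
      finally show ?thesis .
    qed
    have gm: "g meromorphic_on UNIV"
      unfolding g_def G_def using wm by (intro meromorphic_intros meromorphic_on_poly)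
    have wd: "(w has_field_derivative deriv w z) (at z)" if "z \<in> D" for z
      using that is_pole_zero_at_nicely_mero[OF w] by (intro nonpole_derivatives(2)[OF w]) (auto simp: D_def)
    obtain K where K: "\<And>z. z \<in> D \<Longrightarrow> w z * exp (- g z) = K"
    proof (rule constant_of_deriv_0[OF D(2,1)])
      fix z assume z: "z \<in> D"
      have "((\<lambda>z. w z * exp (- g z)) has_field_derivative
          deriv w z * exp (- g z) + exp (- g z) * (- (deriv w z / w z)) * w z) (at z)"
        by (rule DERIV_mult[OF wd[OF z] DERIV_fun_exp[OF DERIV_minus[OF g'[OF z]]]])
      then show "((\<lambda>z. w z * exp (- g z)) has_field_derivative 0) (at z)" using z by (simp add: D_def)
    qed blast
    have w_eq: "w z = K * exp (g z)" if "w z \<noteq> 0" for z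
      using K[of z] that by (auto simp: D_def exp_minus field_simps)
    have K0: "K \<noteq> 0" using False w_eq by fastforce
    have w0: "w z \<noteq> 0" for z by (rule nonzero_of_global_logarithm[OF w gm K0 w_eq ne])
    then have DU: "D = UNIV" by (simp add: D_def)
    have w_exp: "w z = K * exp (g z)" for z using w_eq w0 by blast
    have hol: "w holomorphic_on UNIV" using wd DU by (auto simp: holomorphic_on_open)
    have g: "g holomorphic_on UNIV" using g' DU by (auto simp: holomorphic_on_open)
    have dg: "deriv g z = deriv w z * inverse (w z)" for z
      using g'[of z] DU by (simp add: DERIV_imp_deriv divide_inverse)
    have "\<exists>C. \<forall>z. norm (g z) \<le> C * (1 + norm z) ^ 2"
    proof (rule entire_quadratic_of_log_integral[OF g K0 Q1(2)])
      fix z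
      have "G z = - 2 * p2 * g z" using p2 by (simp add: g_def)
      then have "(deriv g z)\<^sup>2 = p0 * (inverse (w z))\<^sup>2 + 2 * p1 * inverse (w z) - 2 * poly Q1 (w z) + (- 2 * p2) * g z"
        by (simp add: G_def dg algebra_simps)
      then show "(deriv g z)\<^sup>2 = p0 * (inverse (K * exp (g z)))\<^sup>2 + 2 * p1 * inverse (K * exp (g z))
               - 2 * poly Q1 (K * exp (g z)) + (- 2 * p2) * g z"
        unfolding w_exp[symmetric] .
    qed
    then obtain C where C: "\<And>z. norm (g z) \<le> C * (1 + norm z) ^ 2" by blast
    define B where "B = \<bar>ln (norm K)\<bar> + \<bar>C\<bar>"
    have "norm (w z) \<le> exp (B * (1 + norm z) ^ 2)" for z
    proof -
      have X: "(1 + norm z) ^ 2 \<ge> 1" by (intro one_le_power) simp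
      have "norm (w z) = exp (ln (norm K) + Re (g z))" using K0 by (simp add: w_exp norm_mult exp_add)
      also have "\<dots> \<le> exp (B * (1 + norm z) ^ 2)"
      proof -
        have "ln (norm K) \<le> \<bar>ln (norm K)\<bar> * (1 + norm z) ^ 2"
          using mult_left_mono[OF X, of "\<bar>ln (norm K)\<bar>"] by simp
        moreover have "Re (g z) \<le> \<bar>C\<bar> * (1 + norm z) ^ 2"
        proof -
          have "C * (1 + norm z) ^ 2 \<le> \<bar>C\<bar> * (1 + norm z) ^ 2" by (intro mult_right_mono) auto
          then show ?thesis using C[of z] complex_Re_le_cmod[of "g z"] by linarith
        qed
        ultimately show ?thesis by (simp add: B_def algebra_simps)
      qed
      finally show ?thesis .
    qed
    then show ?thesis by (intro nevanlinna_T_entire_bound[OF hol, of B 2]) (auto simp: B_def)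
  qed
qed

section \<open>Finite order\<close>

lemma finite_order_of_polynomial_bound:
  assumes "C > 0" "\<And>r. r \<ge> 0 \<Longrightarrow> nevanlinna_T r w < C * (1 + r) ^ n"
  shows "finite_order w"
  unfolding finite_order_def
proof (intro exI conjI)
  show "eventually (\<lambda>r. nevanlinna_T r w < (C * 2 ^ (n + 1)) * r powr (real (n + 1))) at_top"
    using eventually_ge_at_top[of 1]
  proof eventually_elim
    case (elim r)
    have "nevanlinna_T r w < C * (1 + r) ^ n" using assms(2) elim by simp
    also have "\<dots> \<le> C * (1 + r) ^ (n + 1)" using assms(1) elim by (intro mult_left_mono power_increasing) auto
    also have "\<dots> \<le> C * (2 * r) ^ (n + 1)" using assms(1) elim by (intro mult_left_mono power_mono) auto
    also have "\<dots> = (C * 2 ^ (n + 1)) * r powr (real (n + 1))"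
      using elim by (simp add: powr_realpow power_mult_distrib del: power_Suc of_nat_Suc of_nat_add)
    finally show ?case .
  qed
qed (use assms(1) in auto)

lemma exp_bound_of_polynomial_bound:
  assumes C: "C > 0" "\<And>r. r \<ge> 0 \<Longrightarrow> nevanlinna_T r w < C * (1 + r) ^ n"
  shows "\<exists>a>0. \<exists>b>0. \<exists>\<gamma>>0. \<forall>r\<ge>0. nevanlinna_T r w < a * exp (b * r powr \<gamma>)"
proof -
  have "nevanlinna_T r w < C * exp (real (n + 1) * r powr 1)" if r: "r \<ge> 0" for r
  proof -
    have "(1 + r) ^ n \<le> exp r ^ (n + 1)"
    proof -
      have "(1 + r) ^ n \<le> (1 + r) ^ (n + 1)" using r by (intro power_increasing) auto
      also have "\<dots> \<le> exp r ^ (n + 1)" using r exp_ge_add_one_self[of r] by (intro power_mono) auto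
      finally show ?thesis .
    qed
    also have "\<dots> = exp (real (n + 1) * r powr 1)"
      using r by (simp add: exp_of_nat_mult[symmetric] del: power_Suc of_nat_Suc of_nat_add)
    finally have "C * (1 + r) ^ n \<le> C * exp (real (n + 1) * r powr 1)" using C(1) by simp
    then show ?thesis using C(2)[OF r] by linarith
  qed
  then show ?thesis using C(1) by (intro exI[of _ C] exI[of _ "real (n + 1)"] conjI exI[of _ 1]) auto
qed

theorem corollary3p3:
  fixes c :: complex and P :: "complex poly"
  defines "Q1 \<equiv> (\<lambda>y y' y''. y * y'' - y' ^ 2 + poly P y)"
    and "Q2 \<equiv> (\<lambda>y y' y''. y'' + c * y' ^ 2 + poly P y)"
  shows "(\<forall>w. meromorphic_solution Q1 w \<longrightarrow> finite_order w)
       \<and> (\<forall>w. meromorphic_solution Q2 w \<longrightarrow> finite_order w)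
       \<and> (\<forall>w. meromorphic_solution Q1 w \<or> meromorphic_solution Q2 w \<longrightarrow>
            (\<exists>a>0. \<exists>b>0. \<exists>\<gamma>>0. \<forall>r\<ge>0. nevanlinna_T r w < a * exp (b * r powr \<gamma>)))"
proof -
  have "\<exists>C>0. \<exists>n. \<forall>r\<ge>0. nevanlinna_T r w < C * (1 + r) ^ n" if "meromorphic_solution Q1 w" for w
    using that unfolding meromorphic_solution_def Q1_def by (intro product_equation_bound) auto
  moreover have "\<exists>C>0. \<exists>n. \<forall>r\<ge>0. nevanlinna_T r w < C * (1 + r) ^ n" if "meromorphic_solution Q2 w" for w
    using that unfolding meromorphic_solution_def Q2_def by (intro square_equation_bound) auto
  ultimately have bound: "\<exists>C>0. \<exists>n. \<forall>r\<ge>0. nevanlinna_T r w < C * (1 + r) ^ n"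
    if "meromorphic_solution Q1 w \<or> meromorphic_solution Q2 w" for w using that by blast
  have "finite_order w" if "meromorphic_solution Q1 w \<or> meromorphic_solution Q2 w" for w
    using bound[OF that] finite_order_of_polynomial_bound by blast
  moreover have "\<exists>a>0. \<exists>b>0. \<exists>\<gamma>>0. \<forall>r\<ge>0. nevanlinna_T r w < a * exp (b * r powr \<gamma>)"
    if "meromorphic_solution Q1 w \<or> meromorphic_solution Q2 w" for w
    using bound[OF that] exp_bound_of_polynomial_bound by blast
  ultimately show ?thesis by blast
qed

end
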